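(* Let $0<\alpha<2$, let $d\geq 1$ be an integer, and let $D=\{x=(x_1,\ldots,x_d)\in\mathbb{R}^d : x_d>0\}$. For $u\in C_c^\infty(D)$ let $$\mathcal{K}(u,u)=\frac12\,\mathcal{A}_{d,-\alpha}\int_{\mathbb{R}^d}\int_{\mathbb{R}^d}\frac{(u(x)-u(y))^2}{|x-y|^{d+\alpha}}\,dx\,dy,\qquad \mathcal{A}_{d,-\alpha}=\frac{\Gamma\left(\frac{d+\alpha}{2}\right)}{2^{-\alpha}\pi^{d/2}\,\left|\Gamma\left(-\frac{\alpha}{2}\right)\right|}.$$ Then for all $u\in C_c^\infty(D)$, $$\mathcal{K}(u,u)\;\geq\;\frac{\Gamma^2\left(\frac{1+\alpha}{2}\right)}{\pi}\int_D u^2(x)\,x_d^{-\alpha}\,dx ,$$ and the constant $\Gamma^2\left(\frac{1+\alpha}{2}\right)/\pi$ is the best possible, i.e. the inequality fails for some $u\in C_c^\infty(D)$ if this constant is replaced by any larger one.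
   Context: $C_c^\infty(D)$ is the class of smooth functions $u:\mathbb{R}^d\to\mathbb{R}$ with compact support contained in $D$. $|\cdot|$ is the Euclidean norm and $\Gamma$ is the Euler gamma function. ($\mathcal{K}$ is the Dirichlet form of the isotropic $\alpha$-stable process killed when leaving $D$.) *)

theory Defs
  imports "HOL-Analysis.Analysis"
begin

text \<open>
  Functions of class \<open>C\<^sup>m\<close> on the whole space: \<open>C\<^sup>0\<close> is continuity, and \<open>C\<^sup>m\<^sup>+\<^sup>1\<close> means
  (Frechet) differentiability everywhere with all first order partial derivatives of class \<open>C\<^sup>m\<close>.
\<close>

primrec C_class :: "nat \<Rightarrow> (real ^ 'n \<Rightarrow> real) \<Rightarrow> bool" where
  "C_class 0 u \<longleftrightarrow> continuous_on UNIV u"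
| "C_class (Suc m) u \<longleftrightarrow>
     (\<forall>x. u differentiable (at x)) \<and>
     (\<forall>i. C_class m (\<lambda>x. frechet_derivative u (at x) (axis i 1)))"

definition smooth :: "(real ^ 'n \<Rightarrow> real) \<Rightarrow> bool" where
  "smooth u \<longleftrightarrow> (\<forall>m. C_class m u)"

definition Cc_infinity :: "(real ^ 'n) set \<Rightarrow> (real ^ 'n \<Rightarrow> real) set" where
  "Cc_infinity D =
     {u. smooth u \<and> compact (closure (support_on UNIV u)) \<and> closure (support_on UNIV u) \<subseteq> D}"

text \<open>The index \<open>k\<close> plays the role of the distinguished (last) coordinate.\<close>

definition half_space :: "'n \<Rightarrow> (real ^ 'n) set" where
  "half_space k = {x. x $ k > 0}"

text \<open>The constant \<open>\<A>\<close> with indices \<open>d\<close> and \<open>-\<alpha>\<close>.\<close>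

definition stable_const :: "nat \<Rightarrow> real \<Rightarrow> real" where
  "stable_const d \<alpha> =
     Gamma ((real d + \<alpha>) / 2) / (2 powr (- \<alpha>) * pi powr (real d / 2) * \<bar>Gamma (- \<alpha> / 2)\<bar>)"

text \<open>
  The integrands here and in the Hardy inequality are nonnegative, so the integrals are taken with
  values in \<open>[0, \<infinity>]\<close>. On the diagonal the integrand below is \<open>0 / 0 = 0\<close>; the diagonal is a null set.
\<close>

definition dirichlet_form :: "real \<Rightarrow> (real ^ 'n \<Rightarrow> real) \<Rightarrow> ennreal" where
  "dirichlet_form \<alpha> u =
     ennreal (1 / 2 * stable_const CARD('n) \<alpha>) *
     (\<integral>\<^sup>+ x. \<integral>\<^sup>+ y. ennreal ((u x - u y)\<^sup>2 / norm (x - y) powr (real CARD('n) + \<alpha>)) \<partial>lborel \<partial>lborel)"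

end

(*
  Write w(x) = x_k^((alpha - 1)/2) on the half-space, 0 outside. The ground state representation
    (u(x) - u(y))^2 = u(x)^2 (1 - w(y)/w(x)) + u(y)^2 (1 - w(x)/w(y)) + w(x) w(y) (u(x)/w(x) - u(y)/w(y))^2
  is integrated against the kernel restricted to pairs whose k-th coordinates are not within a factor
  q > 1 of each other. This truncation is invariant under scaling, so the first two terms give an
  explicit multiple of the Hardy integral; folding r > 1 onto r < 1 by r -> 1/r makes the integrand
  of the multiple a square, and letting q -> 1 yields the constant by a Beta integral and the
  duplication formula. Integrating out the coordinates other than the k-th (Gaussian subordination of
  the kernel) reduces everything to dimension one. Sharpness: in dimension one, w(s) phi(ln s / n) has
  remainder O(1/n) and Hardy integral of order n; in higher dimension it is multiplied by bumps
  of width R in the other coordinates, at a relative cost O(R^(-alpha)).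
*)

theory Submission
  imports Defs "HOL-Probability.Distributions"
begin

section \<open>Integrating out coordinates of the kernel\<close>

text \<open>All integrals take values in [0, \<infinity>], where nothing can be subtracted, and the
  terms u(x)^2 and u(x)^2 w(y) / w(x) of the ground state representation have, separately, infinite
  integrals against the full kernel. The truncation makes their masses finite, so that one can be
  cancelled against part of the other. Cutting at |x - y| > eps would break the scaling; a bound on
  the ratio of the \<open>k\<close>-th coordinates keeps the inner integral at x an exact constant
  times x_k^(-\<alpha>). The exponent (\<alpha> - 1) / 2 of w is what completes the square: under r
  -> 1/r the kernel acquires the factor r^(\<alpha> - 1), and 1 + r^(\<alpha> - 1) - 2 r^((\<alpha>
  - 1) / 2) is the square of 1 - r^((\<alpha> - 1) / 2). Pairs with one point outside the half-space
  contribute an extra 1 / \<alpha>, which cancels a term of the Beta computation. The weight w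
  itself is no test function, since w^2 x_k^(-\<alpha>) = 1 / x_k is not integrable at 0 or at
  infinity. Both divergences are only logarithmic, which is why the cutoff is made in the variable
  ln s.\<close>

lemma nn_integral_gaussian:
  assumes "t > (0::real)"
  shows "(\<integral>\<^sup>+x. ennreal (exp (- (t * x\<^sup>2))) \<partial>lborel) = ennreal (sqrt (pi / t))"
proof -
  have e: "(\<integral>\<^sup>+x. ennreal (exp (- x\<^sup>2)) \<partial>lborel) = ennreal (sqrt pi)"
  proof -
    have "has_bochner_integral lborel (\<lambda>x::real. exp (- x\<^sup>2)) (2 *\<^sub>R (sqrt pi / 2))"
      by (rule has_bochner_integral_even_function[OF gaussian_moment_0]) simp
    then show ?thesis
      by (subst nn_integral_eq_integral) (auto simp: has_bochner_integral_iff)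
  qed
  have "(\<integral>\<^sup>+x. ennreal (exp (- x\<^sup>2)) \<partial>lborel) =
     ennreal \<bar>sqrt t\<bar> * (\<integral>\<^sup>+x. ennreal (exp (- (0 + sqrt t * x)\<^sup>2)) \<partial>lborel)"
    using assms by (intro nn_integral_real_affine) auto
  also have "\<dots> = ennreal (sqrt t) * (\<integral>\<^sup>+x. ennreal (exp (- (t * x\<^sup>2))) \<partial>lborel)"
    using assms by (simp add: power_mult_distrib)
  finally have "ennreal (1 / sqrt t) * ennreal (sqrt pi) =
      ennreal (1 / sqrt t) * ennreal (sqrt t) * (\<integral>\<^sup>+x. ennreal (exp (- (t * x\<^sup>2))) \<partial>lborel)"
    unfolding e by (simp add: mult.assoc)
  also have "ennreal (1 / sqrt t) * ennreal (sqrt t) = 1"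
    using assms by (simp flip: ennreal_mult)
  finally show ?thesis
    using assms by (simp add: real_sqrt_divide flip: ennreal_mult)
qed

text \<open>Subordination: a negative power is a mixture of exponentials. With \<open>a\<close> the
  square of a norm, the kernel becomes a mixture of Gaussians, which factor over the
  coordinates.\<close>

lemma nn_integral_Gamma_scaled:
  assumes "p > (0::real)" "a > 0"
  shows "(\<integral>\<^sup>+t. ennreal (indicator {0..} t * (t powr (p - 1) * exp (- (t * a)))) \<partial>lborel)
       = ennreal (Gamma p * a powr (- p))"
proof -
  have "ennreal (Gamma p) = \<bar>a\<bar> * (\<integral>\<^sup>+t. ennreal (indicator {0..} (0 + a * t) *
      (0 + a * t) powr (p - 1) / exp (0 + a * t)) \<partial>lborel)"
    unfolding Gamma_conv_nn_integral_real[OF assms(1)]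
    using assms by (intro nn_integral_real_affine) auto
  also have "(\<integral>\<^sup>+t. ennreal (indicator {0..} (0 + a * t) * (0 + a * t) powr (p - 1) / exp (0 + a * t)) \<partial>lborel)
     = (\<integral>\<^sup>+t. ennreal (a powr (p - 1)) *
        ennreal (indicator {0..} t * (t powr (p - 1) * exp (- (t * a)))) \<partial>lborel)"
    using assms
    by (intro nn_integral_cong)
       (auto simp: indicator_def powr_mult exp_minus divide_simps zero_le_mult_iff ac_simps
             simp flip: ennreal_mult)
  also have "\<dots> = ennreal (a powr (p - 1)) * (\<integral>\<^sup>+t.
        ennreal (indicator {0..} t * (t powr (p - 1) * exp (- (t * a)))) \<partial>lborel)"
    by (rule nn_integral_cmult) auto
  finally have "ennreal (a powr (- p)) * ennreal (Gamma p) =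
     (ennreal (a powr (- p)) * \<bar>a\<bar> * ennreal (a powr (p - 1))) * (\<integral>\<^sup>+t.
        ennreal (indicator {0..} t * (t powr (p - 1) * exp (- (t * a)))) \<partial>lborel)"
    by (simp add: mult.assoc)
  also have "ennreal (a powr (- p)) * \<bar>a\<bar> * ennreal (a powr (p - 1)) = ennreal (a powr (-p) * a powr 1 * a powr (p-1))"
    using assms by (simp flip: ennreal_mult)
  also have "a powr (-p) * a powr 1 * a powr (p-1) = 1"
    using assms by (simp only: flip: powr_add) simp
  finally show ?thesis using assms by (simp add: Gamma_real_pos less_imp_le ac_simps flip: ennreal_mult)
qed

text \<open>The Gaussian factors over the basis, and each coordinate orthogonal to \<open>e\<close>
  contributes sqrt (pi / t). The resulting power of 1 / t is what lowers the exponent of the kernel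
  in the next step.\<close>

lemma nn_integral_coordinate_gaussian:
  fixes e :: "'a::euclidean_space" and F :: "real \<Rightarrow> ennreal"
  assumes e: "e \<in> Basis" and [measurable]: "F \<in> borel_measurable borel" and t: "t > (0::real)"
  shows "(\<integral>\<^sup>+z. F (z \<bullet> e) * ennreal (exp (- (t * (norm z)\<^sup>2))) \<partial>lborel)
    = ennreal ((pi / t) powr ((real DIM('a) - 1) / 2)) * (\<integral>\<^sup>+x. F x * ennreal (exp (- (t * x\<^sup>2))) \<partial>lborel)"
proof -
  define f where "f b x = (if b = e then F x else 1) * ennreal (exp (- (t * x\<^sup>2)))" for b :: 'a and x
  have m[measurable]: "f b \<in> borel_measurable borel" for b
    unfolding f_def[abs_def] by measurable
  have "(\<integral>\<^sup>+z. F (z \<bullet> e) * ennreal (exp (- (t * (norm z)\<^sup>2))) \<partial>lborel)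
      = (\<integral>\<^sup>+z. (\<Prod>b\<in>Basis. f b (z \<bullet> b)) \<partial>lborel)"
  proof (intro nn_integral_cong)
    fix z :: 'a
    have "ennreal (exp (- (t * (norm z)\<^sup>2))) = ennreal (exp (\<Sum>b\<in>Basis. - (t * (z \<bullet> b)\<^sup>2)))"
      by (simp add: norm_eq_sqrt_inner euclidean_inner[of z z] real_sqrt_pow2 sum_nonneg
           sum_distrib_left sum_negf power2_eq_square)
    also have "\<dots> = (\<Prod>b\<in>Basis. ennreal (exp (- (t * (z \<bullet> b)\<^sup>2))))"
      by (simp add: exp_sum prod_ennreal)
    finally show "F (z \<bullet> e) * ennreal (exp (- (t * (norm z)\<^sup>2))) = (\<Prod>b\<in>Basis. f b (z \<bullet> b))"
      using e by (simp add: f_def prod.distrib)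
  qed
  also have "\<dots> = (\<Prod>b\<in>Basis. \<integral>\<^sup>+x. f b x \<partial>lborel)"
    by (rule nn_integral_lborel_prod) auto
  also have "\<dots> = (\<integral>\<^sup>+x. f e x \<partial>lborel) * (\<Prod>b\<in>Basis-{e}. \<integral>\<^sup>+x. f b x \<partial>lborel)"
    using e by (simp add: prod.remove)
  also have "(\<Prod>b\<in>Basis-{e}. \<integral>\<^sup>+x. f b x \<partial>lborel) = (\<Prod>b\<in>Basis-{e}. ennreal (sqrt (pi / t)))"
    by (intro prod.cong) (auto simp: f_def nn_integral_gaussian[OF t])
  also have "\<dots> = ennreal (sqrt (pi / t) ^ (DIM('a) - 1))"
    using e by (simp add: ennreal_power t less_imp_le)
  also have "sqrt (pi / t) ^ (DIM('a) - 1) = (pi / t) powr ((real DIM('a) - 1) / 2)"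
    using t by (simp add: powr_half_sqrt[symmetric] powr_powr powr_realpow[symmetric] of_nat_diff)
  finally show ?thesis by (simp add: f_def ac_simps)
qed

text \<open>The integral of (1 + |y|^2)^(-(d + \<alpha>) / 2) over R^(d - 1): the d-dimensional
  kernel, integrated over a hyperplane at distance |x| from the origin, is this multiple of |x|^(-(1
  + \<alpha>)).\<close>

definition slice_const :: "nat \<Rightarrow> real \<Rightarrow> real" where
  "slice_const d \<alpha> = pi powr ((real d - 1) / 2) * Gamma ((1 + \<alpha>) / 2) / Gamma ((real d + \<alpha>) / 2)"

lemma nn_integral_coordinate_kernel:
  fixes e :: "'a::euclidean_space" and F :: "real \<Rightarrow> ennreal"
  assumes e: "e \<in> Basis" and [measurable]: "F \<in> borel_measurable borel" and \<alpha>: "\<alpha> > (0::real)"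
  shows "(\<integral>\<^sup>+z. F (z \<bullet> e) * ennreal (norm z powr (- (real DIM('a) + \<alpha>))) \<partial>lborel)
    = ennreal (slice_const DIM('a) \<alpha>) * (\<integral>\<^sup>+x. F x * ennreal (\<bar>x\<bar> powr (- (1 + \<alpha>))) \<partial>lborel)"
proof -
  define p where "p = (real DIM('a) + \<alpha>) / 2"
  define p' where "p' = (1 + \<alpha>) / 2"
  define r where "r = (real DIM('a) - 1) / 2"
  \<comment> \<open>The Gaussian integrals multiply the subordination weight by (pi / t)^r, and p -
    r is exactly the exponent p' that represents the one-dimensional kernel.\<close>
  have p: "p > 0" "p' > 0" "p - r = p'" using \<alpha> by (auto simp: p_def p'_def r_def field_simps)
  define w where "w q t = ennreal (indicator {0..} t * t powr (q - 1))" for q t :: real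
  have [measurable]: "w q \<in> borel_measurable borel" for q unfolding w_def[abs_def] by measurable
  have G: "(\<integral>\<^sup>+t. w q t * ennreal (exp (- (t * a\<^sup>2))) \<partial>lborel) = ennreal (Gamma q) * ennreal (\<bar>a\<bar> powr (- (2*q)))"
    if "q > 0" "a \<noteq> 0" for q a :: real
  proof -
    have "(\<integral>\<^sup>+t. w q t * ennreal (exp (- (t * a\<^sup>2))) \<partial>lborel) = ennreal (Gamma q * (a\<^sup>2) powr (- q))"
      using nn_integral_Gamma_scaled[of q "a\<^sup>2"] that
      by (simp add: w_def ac_simps flip: ennreal_mult)
    also have "(a\<^sup>2) powr (-q) = \<bar>a\<bar> powr (- (2*q))"
    proof -
      have "a\<^sup>2 = \<bar>a\<bar> powr 2" using that by simp
      then show ?thesis by (simp only: powr_powr) simp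
    qed
    finally show ?thesis using that by (simp add: ennreal_mult Gamma_real_pos less_imp_le)
  qed
  have "ennreal (Gamma p) * (\<integral>\<^sup>+z. F (z \<bullet> e) * ennreal (norm z powr (- (real DIM('a) + \<alpha>))) \<partial>lborel)
     = (\<integral>\<^sup>+z. F (z \<bullet> e) * (ennreal (Gamma p) * ennreal (\<bar>norm z\<bar> powr (- (2*p)))) \<partial>lborel)"
  proof -
    have "2 * p = real DIM('a) + \<alpha>" by (simp add: p_def)
    then show ?thesis by (subst nn_integral_cmult[symmetric]) (auto simp: ac_simps)
  qed
  also have "\<dots> = (\<integral>\<^sup>+z. F (z \<bullet> e) * (\<integral>\<^sup>+t. w p t * ennreal (exp (- (t * (norm z)\<^sup>2))) \<partial>lborel) \<partial>lborel)"
    \<comment> \<open>At z = 0 the sides may differ: 0 to any \<open>powr\<close> is 0, while the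
      t-integral is infinite there. Hence equality only almost everywhere.\<close>
    using AE_lborel_singleton[of "0::'a"]
    by (intro nn_integral_cong_AE) (auto simp: G p)
  also have "\<dots> = (\<integral>\<^sup>+z. (\<integral>\<^sup>+t. F (z \<bullet> e) * (w p t * ennreal (exp (- (t * (norm z)\<^sup>2)))) \<partial>lborel) \<partial>lborel)"
    by (intro nn_integral_cong nn_integral_cmult[symmetric]) auto
  also have "\<dots> = (\<integral>\<^sup>+t. (\<integral>\<^sup>+z. F (z \<bullet> e) * (w p t * ennreal (exp (- (t * (norm z)\<^sup>2)))) \<partial>lborel) \<partial>lborel)"
    by (rule lborel_pair.Fubini') measurable
  also have "\<dots> = (\<integral>\<^sup>+t. w p t * (\<integral>\<^sup>+z. F (z \<bullet> e) * ennreal (exp (- (t * (norm z)\<^sup>2))) \<partial>lborel) \<partial>lborel)"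
    by (subst nn_integral_cmult[symmetric]) (auto simp: ac_simps)
  also have "\<dots> = (\<integral>\<^sup>+t. ennreal (pi powr r) * (w p' t * (\<integral>\<^sup>+x. F x * ennreal (exp (- (t * x\<^sup>2))) \<partial>lborel)) \<partial>lborel)"
  proof (intro nn_integral_cong_AE)
    show "AE t in lborel. w p t * (\<integral>\<^sup>+z. F (z \<bullet> e) * ennreal (exp (- (t * (norm z)\<^sup>2))) \<partial>lborel)
      = ennreal (pi powr r) * (w p' t * (\<integral>\<^sup>+x. F x * ennreal (exp (- (t * x\<^sup>2))) \<partial>lborel))"
      using AE_lborel_singleton[of "0::real"]
    proof eventually_elim
      case (elim t)
      show ?case
      proof (cases "t > 0")
        case True
        have "w p t * ennreal ((pi / t) powr r) = ennreal (pi powr r * t powr (p - 1 - r))"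
          using True by (simp add: w_def powr_divide powr_diff flip: ennreal_mult)
        also have "\<dots> = ennreal (pi powr r) * w p' t"
          using True by (simp add: w_def p(3)[symmetric] algebra_simps flip: ennreal_mult)
        finally show ?thesis
          using nn_integral_coordinate_gaussian[OF e _ True, of F] by (simp add: r_def mult.assoc[symmetric])
      next
        case False
        with elim show ?thesis by (simp add: w_def)
      qed
    qed
  qed
  also have "\<dots> = ennreal (pi powr r) * (\<integral>\<^sup>+t. (\<integral>\<^sup>+x. F x * (w p' t * ennreal (exp (- (t * x\<^sup>2)))) \<partial>lborel) \<partial>lborel)"
    by (subst nn_integral_cmult[symmetric], measurable, subst nn_integral_cmult[symmetric], measurable)
       (auto intro!: nn_integral_cong simp: ac_simps)
  also have "(\<integral>\<^sup>+t. (\<integral>\<^sup>+x. F x * (w p' t * ennreal (exp (- (t * x\<^sup>2)))) \<partial>lborel) \<partial>lborel)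
     = (\<integral>\<^sup>+x. (\<integral>\<^sup>+t. F x * (w p' t * ennreal (exp (- (t * x\<^sup>2)))) \<partial>lborel) \<partial>lborel)"
    by (rule lborel_pair.Fubini') measurable
  also have "\<dots> = (\<integral>\<^sup>+x. F x * (\<integral>\<^sup>+t. w p' t * ennreal (exp (- (t * x\<^sup>2))) \<partial>lborel) \<partial>lborel)"
    by (intro nn_integral_cong nn_integral_cmult) auto
  also have "\<dots> = (\<integral>\<^sup>+x. ennreal (Gamma p') * (F x * ennreal (\<bar>x\<bar> powr (- (2*p')))) \<partial>lborel)"
    using AE_lborel_singleton[of "0::real"] p
    by (intro nn_integral_cong_AE) (auto simp: G ac_simps)
  also have "\<dots> = ennreal (Gamma p') * (\<integral>\<^sup>+x. F x * ennreal (\<bar>x\<bar> powr (- (1 + \<alpha>))) \<partial>lborel)"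
  proof -
    have "2 * p' = 1 + \<alpha>" by (simp add: p'_def)
    then show ?thesis by (subst nn_integral_cmult) auto
  qed
  finally have *: "ennreal (Gamma p) * (\<integral>\<^sup>+z. F (z \<bullet> e) * ennreal (norm z powr (- (real DIM('a) + \<alpha>))) \<partial>lborel) =
    ennreal (pi powr r) * (ennreal (Gamma p') * (\<integral>\<^sup>+x. F x * ennreal (\<bar>x\<bar> powr (- (1 + \<alpha>))) \<partial>lborel))" .
  have "ennreal (1 / Gamma p) * ennreal (Gamma p) = 1"
    using Gamma_real_pos[OF p(1)] by (simp flip: ennreal_mult)
  then have "(\<integral>\<^sup>+z. F (z \<bullet> e) * ennreal (norm z powr (- (real DIM('a) + \<alpha>))) \<partial>lborel)
    = ennreal (1 / Gamma p) * (ennreal (Gamma p) * (\<integral>\<^sup>+z. F (z \<bullet> e) * ennreal (norm z powr (- (real DIM('a) + \<alpha>))) \<partial>lborel))"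
    by (simp add: mult.assoc[symmetric])
  also note *
  also have "ennreal (1 / Gamma p) * (ennreal (pi powr r) * (ennreal (Gamma p') * (\<integral>\<^sup>+x. F x * ennreal (\<bar>x\<bar> powr (- (1 + \<alpha>))) \<partial>lborel)))
     = ennreal (slice_const DIM('a) \<alpha>) * (\<integral>\<^sup>+x. F x * ennreal (\<bar>x\<bar> powr (- (1 + \<alpha>))) \<partial>lborel)"
    using Gamma_real_pos[OF p(1)] Gamma_real_pos[OF p(2)]
    by (simp add: slice_const_def p_def p'_def r_def mult.assoc[symmetric] flip: ennreal_mult)
  finally show ?thesis .
qed

section \<open>The one-dimensional constant\<close>

text \<open>Continuity from below of the measure with density \<open>f\<close>.\<close>

lemma SUP_nn_integral_indicator_incseq:
  assumes [measurable]: "f \<in> borel_measurable M" "\<And>n. A n \<in> sets M" and "incseq A"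
  shows "(SUP n::nat. \<integral>\<^sup>+x. f x * indicator (A n) x \<partial>M) = (\<integral>\<^sup>+x. f x * indicator (\<Union>n. A n) x \<partial>M)"
proof -
  have "(SUP n. emeasure (density M f) (A n)) = emeasure (density M f) (\<Union>n. A n)"
    using assms by (intro SUP_emeasure_incseq) auto
  then show ?thesis by (simp add: emeasure_density)
qed

lemma nn_integral_inversion:
  fixes G :: "real \<Rightarrow> ennreal"
  assumes [measurable]: "G \<in> borel_measurable borel"
  shows "(\<integral>\<^sup>+r. G r * indicator {1..} r \<partial>lborel)
       = (\<integral>\<^sup>+r. G (1 / r) * ennreal (1 / r\<^sup>2) * indicator {0<..1} r \<partial>lborel)"
proof -
  \<comment> \<open>The change of variables is made on compact intervals; \<open>+ 2\<close> keeps
    them nondegenerate for n = 0.\<close>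
  have eq: "(\<integral>\<^sup>+r. G r * indicator {1..real n + 2} r \<partial>lborel)
      = (\<integral>\<^sup>+r. G (1 / r) * ennreal (1 / r\<^sup>2) * indicator {1 / (real n + 2)..1} r \<partial>lborel)" for n :: nat
  proof -
    \<comment> \<open>Since r -> 1/r is decreasing, a reflection comes first, so that the
      substitution is by the increasing map r -> -1/r.\<close>
    have "(\<integral>\<^sup>+r. G r * indicator {1..real n + 2} r \<partial>lborel) =
       (\<integral>\<^sup>+r. G (- r) * indicator {-1 / (1 / (real n + 2)) .. - 1 / 1} r \<partial>lborel)"
      using nn_integral_real_affine[of "\<lambda>r. G r * indicator {1..real n + 2} r" "-1" 0]
      by (auto intro!: nn_integral_cong simp: indicator_def)
    also have "\<dots> = (\<integral>\<^sup>+r. G (- (-1 / r)) * ennreal (1 / r\<^sup>2) * indicator {1 / (real n + 2)..1} r \<partial>lborel)"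
    proof (rule nn_integral_substitution_aux)
      fix x :: real assume "x \<in> {1 / (real n + 2)..1}"
      then have "x > 0" by (auto intro: less_le_trans[rotated])
      then show "((\<lambda>r. -1 / r) has_real_derivative 1 / x\<^sup>2) (at x)"
        by (auto intro!: derivative_eq_intros simp: power2_eq_square)
    next
      have "x \<noteq> 0" if "x \<in> {1 / (real n + 2)..1}" for x
        using that by (auto simp: field_simps)
      then show "continuous_on {1 / (real n + 2)..1} (\<lambda>x. 1 / x\<^sup>2)"
        by (intro continuous_intros) auto
    qed auto
    finally show ?thesis by simp
  qed
  have U1: "(\<Union>n. {1..real n + 2}) = {1::real..}"
    by (auto, metis add.commute add_increasing2 real_arch_simple le_numeral_extra(1) order_trans zero_le_numeral)
  have U2: "(\<Union>n. {1 / (real n + 2)..1}) = {0<..1::real}"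
  proof (intro set_eqI iffI)
    fix x assume "x \<in> {0<..1::real}"
    then have x: "x > 0" "x \<le> 1" by auto
    obtain n where "1 / x \<le> real n" using real_arch_simple by blast
    then have "1 / x \<le> real n + 2" by simp
    then have "1 / (real n + 2) \<le> x" using x by (simp add: field_simps)
    then show "x \<in> (\<Union>n. {1 / (real n + 2)..1})" using x by auto
  next
    fix x assume "x \<in> (\<Union>n. {1 / (real n + 2)..1::real})"
    then obtain n where "1 / (real n + 2) \<le> x" "x \<le> 1" by auto
    moreover have "0 < 1 / (real n + 2)" by simp
    ultimately show "x \<in> {0<..1}" unfolding greaterThanAtMost_iff by linarith
  qed
  have "(\<integral>\<^sup>+r. G r * indicator {1..} r \<partial>lborel) = (SUP n. \<integral>\<^sup>+r. G r * indicator {1..real n + 2} r \<partial>lborel)"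
    unfolding U1[symmetric] by (subst SUP_nn_integral_indicator_incseq) (auto simp: incseq_def)
  also have "\<dots> = (SUP n. \<integral>\<^sup>+r. G (1 / r) * ennreal (1 / r\<^sup>2) * indicator {1 / (real n + 2)..1} r \<partial>lborel)"
    by (simp add: eq)
  also have "\<dots> = (\<integral>\<^sup>+r. G (1 / r) * ennreal (1 / r\<^sup>2) * indicator {0<..1} r \<partial>lborel)"
    unfolding U2[symmetric] by (subst SUP_nn_integral_indicator_incseq)
       (auto simp: incseq_def intro: order_trans[rotated] intro!: divide_left_mono)
  finally show ?thesis .
qed

text \<open>A power s^c with |c| \<le> 1 lies between s and 1/s. What matters is the first order
  zero at s = 1, which compensates the singularity of the kernel there.\<close>

lemma abs_one_minus_powr_le:
  fixes s c :: real
  assumes "0 < s" "s \<le> 1" "\<bar>c\<bar> \<le> 1"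
  shows "\<bar>1 - s powr c\<bar> \<le> (1 - s) / s"
proof -
  have "s powr 1 \<le> s powr c" "s powr c \<le> s powr (- 1)"
    using assms by (intro powr_mono'; simp)+
  then have *: "s \<le> s powr c" "s powr c \<le> 1 / s"
    using assms by (auto simp: powr_minus_divide)
  have "1 - s powr c \<le> 1 - s" using * by simp
  also have "\<dots> \<le> (1 - s) / s" using assms mult_left_le[of s "1 - s"] by (simp add: pos_le_divide_eq)
  finally have "1 - s powr c \<le> (1 - s) / s" .
  moreover have "s powr c - 1 \<le> (1 - s) / s" using * assms by (simp add: field_simps)
  ultimately show ?thesis by linarith
qed

section \<open>The Beta integral and the normalizing constant\<close>

context
  fixes \<alpha> :: real
  assumes \<alpha>: "0 < \<alpha>" "\<alpha> < 2"
begin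

text \<open>Expanding the square gives three terms that all diverge at s = 1, so no Beta integral
  applies to them one by one. The exponent of 1 - s has to be raised by two, to 1 - \<alpha> > -1,
  before the terms can be separated.\<close>

lemma has_integral_stable_kernel:
  "((\<lambda>s. (1 - s powr ((\<alpha> - 1) / 2))\<^sup>2 * (1 - s) powr (- (1 + \<alpha>))) has_integral
     Gamma ((1 + \<alpha>) / 2) * Gamma (2 - \<alpha>) / (\<alpha> * Gamma ((3 - \<alpha>) / 2)) - 1 / \<alpha>) {0..1}"
proof -
  define c where "c = (\<alpha> - 1) / 2"
  \<comment> \<open>Two integrations by parts: \<open>f\<close> is the derivative of \<open>G\<close>, which vanishes at both ends, plus the Beta integrand \<open>g\<close>.\<close>
  define G where "G s = ((s - 2 * s powr (c + 1) + s powr \<alpha>) * (1 - s) powr (- \<alpha>)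
     + (s - s powr (c + 1)) * (1 - s) powr (1 - \<alpha>)) / \<alpha>" for s :: real
  define g where "g s = (- (2 - \<alpha>) * (s powr (1 - 1) * (1 - s) powr ((2 - \<alpha>) - 1))
     + (3 - \<alpha>) / 2 * (s powr ((c + 1) - 1) * (1 - s) powr ((2 - \<alpha>) - 1))) / \<alpha>" for s :: real
  define f where "f s = (1 - s powr c)\<^sup>2 * (1 - s) powr (- (1 + \<alpha>))" for s :: real
  have c: "c + 1 > 0" "\<bar>c\<bar> \<le> 1" using \<alpha> by (auto simp: c_def field_simps)
  have powers: "s powr \<alpha> = s * (s powr c)\<^sup>2" "s powr (c + 1) = s * s powr c" "s powr (\<alpha> - 1) = (s powr c)\<^sup>2"
    if s: "0 < s" for s
  proof -
    show sq: "s powr (\<alpha> - 1) = (s powr c)\<^sup>2"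
      by (simp add: power2_eq_square c_def flip: powr_add)
    show "s powr (c + 1) = s * s powr c" using s by (simp add: powr_add)
    show "s powr \<alpha> = s * (s powr c)\<^sup>2" using s powr_add[of s 1 "\<alpha> - 1"] by (simp add: sq)
  qed
  have G: "(G has_real_derivative f s - g s) (at s)" if s: "0 < s" "s < 1" for s
  proof -
    note 1 = powers[OF s(1)]
    define Y where "Y = (1 - s) powr (- (1 + \<alpha>))"
    have 2: "(1 - s) powr (- \<alpha>) = (1 - s) * Y" "(1 - s) powr (1 - \<alpha>) = (1 - s)\<^sup>2 * Y"
         "(1 - s) powr (- \<alpha> - 1) = Y"
    proof -
      have "(1 - s) powr (- \<alpha>) = (1 - s) powr (1 + - (1 + \<alpha>))" by simp
      then show "(1 - s) powr (- \<alpha>) = (1 - s) * Y" using s unfolding powr_add Y_def by simp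
      have "(1 - s) powr (1 - \<alpha>) = (1 - s) powr (2 + - (1 + \<alpha>))" by simp
      then show "(1 - s) powr (1 - \<alpha>) = (1 - s)\<^sup>2 * Y" using s unfolding powr_add Y_def by simp
      have "- \<alpha> - 1 = - (1 + \<alpha>)" by simp
      then show "(1 - s) powr (- \<alpha> - 1) = Y" by (simp only: Y_def)
    qed
    have "(G has_real_derivative ((1 - 2 * ((c + 1) * s powr c) + \<alpha> * s powr (\<alpha> - 1)) * (1 - s) powr (- \<alpha>)
       + (s - 2 * s powr (c + 1) + s powr \<alpha>) * (\<alpha> * (1 - s) powr (- \<alpha> - 1))
       + (1 - (c + 1) * s powr c) * (1 - s) powr (1 - \<alpha>)
       + (s - s powr (c + 1)) * (- (1 - \<alpha>) * (1 - s) powr (- \<alpha>))) / \<alpha>) (at s)"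
      unfolding G_def[abs_def]
      using s \<alpha> by (auto intro!: derivative_eq_intros) algebra
    also have "((1 - 2 * ((c + 1) * s powr c) + \<alpha> * s powr (\<alpha> - 1)) * (1 - s) powr (- \<alpha>)
       + (s - 2 * s powr (c + 1) + s powr \<alpha>) * (\<alpha> * (1 - s) powr (- \<alpha> - 1))
       + (1 - (c + 1) * s powr c) * (1 - s) powr (1 - \<alpha>)
       + (s - s powr (c + 1)) * (- (1 - \<alpha>) * (1 - s) powr (- \<alpha>))) = \<alpha> * (f s - g s)"
    proof -
      have "\<alpha> * g s = (- (2 - \<alpha>) + (3 - \<alpha>) / 2 * s powr c) * ((1 - s)\<^sup>2 * Y)"
      proof -
        have "g s = (- (2 - \<alpha>) + (3 - \<alpha>) / 2 * s powr c) * ((1 - s)\<^sup>2 * Y) / \<alpha>"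
          using s unfolding g_def 2(2)[symmetric] by (simp add: distrib_right)
        then show ?thesis using \<alpha> by simp
      qed
      moreover have "f s = (1 - s powr c)\<^sup>2 * Y" by (simp add: f_def Y_def)
      moreover have "\<alpha> = 2 * c + 1" by (simp add: c_def field_simps)
      ultimately show ?thesis unfolding 1 2 right_diff_distrib
        by (simp add: field_simps) algebra
    qed
    finally show ?thesis using \<alpha> by simp
  qed
  have bound: "\<bar>G s\<bar> \<le> ((1 - s) powr (2 - \<alpha>) / s + (1 - s) powr (2 - \<alpha>)) / \<alpha>" if s: "0 < s" "s < 1" for s
  proof -
    note 1 = powers(1,2)[OF s(1)]
    have 2: "(1 - s) powr (2 - \<alpha>) = (1 - s)\<^sup>2 * (1 - s) powr (- \<alpha>)" "(1 - s) powr (1 - \<alpha>) = (1 - s) * (1 - s) powr (- \<alpha>)"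
      using s by (simp_all add: powr_diff powr_minus powr_numeral divide_inverse)
    have B: "\<bar>1 - s powr c\<bar> \<le> (1 - s) / s" using abs_one_minus_powr_le s c by simp
    have B': "s * \<bar>1 - s powr c\<bar> \<le> 1 - s" using B s by (simp add: pos_le_divide_eq mult.commute)
    \<comment> \<open>This form displays the zeros of \<open>1 - s powr c\<close> at 1: both terms
      are O((1 - s)^(2 - \<alpha>)), so G tends to 0 at 1 because \<alpha> < 2.\<close>
    have "G s = (s * (1 - s powr c)\<^sup>2 * (1 - s) powr (- \<alpha>) + s * (1 - s powr c) * ((1 - s) * (1 - s) powr (- \<alpha>))) / \<alpha>"
      unfolding G_def 1 2(2) by (simp add: power2_eq_square algebra_simps)
    also have "\<bar>\<dots>\<bar> \<le> (s * ((1 - s) / s)\<^sup>2 * (1 - s) powr (- \<alpha>) + s * ((1 - s) / s) * ((1 - s) * (1 - s) powr (- \<alpha>))) / \<alpha>"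
      unfolding abs_divide using \<alpha> s B' power_mono[OF B, of 2]
      by (auto simp: abs_mult intro!: divide_right_mono order_trans[OF abs_triangle_ineq] add_mono mult_mono)
    also have "\<dots> = ((1 - s) powr (2 - \<alpha>) / s + (1 - s) powr (2 - \<alpha>)) / \<alpha>"
      unfolding 2(1) using s by (simp add: power2_eq_square)
    finally show ?thesis .
  qed
  have "continuous_on {0..1} G"
  proof -
    have "continuous (at s within {0..1}) G" if "s \<in> {0..1}" for s
    proof (cases "s = 1")
      case True
      have "((\<lambda>s. (1 - s) powr (2 - \<alpha>)) \<longlongrightarrow> (1 - 1) powr (2 - \<alpha>)) (at 1 within {0..1})"
        using \<alpha> by (intro tendsto_powr' tendsto_intros) (auto simp: eventually_at_filter)
      then have "((\<lambda>s. ((1 - s) powr (2 - \<alpha>) / s + (1 - s) powr (2 - \<alpha>)) / \<alpha>) \<longlongrightarrow> 0) (at 1 within {0..1})"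
        using \<alpha> by (auto intro!: tendsto_eq_intros simp: eventually_at_filter)
      moreover have "eventually (\<lambda>s. norm (G s) \<le> ((1 - s) powr (2 - \<alpha>) / s + (1 - s) powr (2 - \<alpha>)) / \<alpha>) (at 1 within {0..1})"
        unfolding eventually_at by (rule exI[of _ 1]) (auto simp: dist_real_def intro!: bound)
      ultimately have "(G \<longlongrightarrow> 0) (at 1 within {0..1})" by (rule Lim_null_comparison[rotated])
      moreover have "G 1 = 0" by (simp add: G_def)
      ultimately show ?thesis using True by (simp add: continuous_within)
    next
      case False
      with that c show ?thesis unfolding G_def[abs_def] continuous_within using \<alpha>
        by (intro tendsto_add tendsto_diff tendsto_mult tendsto_divide tendsto_const tendsto_ident_at tendsto_powr')
          (auto simp: eventually_at_filter)
    qed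
    then show ?thesis by (simp add: continuous_on_eq_continuous_within)
  qed
  then have "((\<lambda>s. f s - g s) has_integral G 1 - G 0) {0..1}"
    using G by (intro fundamental_theorem_of_calculus_interior)
      (auto simp: has_real_derivative_iff_has_vector_derivative[symmetric])
  moreover have "G 1 = 0" "G 0 = 0" using \<alpha> by (auto simp: G_def)
  moreover have "(g has_integral (- (2 - \<alpha>) * Beta 1 (2 - \<alpha>) + (3 - \<alpha>) / 2 * Beta (c + 1) (2 - \<alpha>)) / \<alpha>) {0..1}"
    unfolding g_def[abs_def] using \<alpha> c
    by (intro has_integral_divide has_integral_add has_integral_mult_right has_integral_Beta_real) auto
  ultimately have T: "((\<lambda>s. (f s - g s) + g s) has_integral
    0 + (- (2 - \<alpha>) * Beta 1 (2 - \<alpha>) + (3 - \<alpha>) / 2 * Beta (c + 1) (2 - \<alpha>)) / \<alpha>) {0..1}"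
    by (intro has_integral_add) auto
  have b1: "(2 - \<alpha>) * Beta 1 (2 - \<alpha>) = 1"
  proof -
    have "Gamma (1 + (2 - \<alpha>)) = (2 - \<alpha>) * Gamma (2 - \<alpha>)"
      using \<alpha> by (subst add.commute, intro Gamma_plus1) (auto elim!: nonpos_Ints_cases)
    moreover have "Gamma (2 - \<alpha>) \<noteq> 0" using \<alpha> by (intro less_imp_neq[THEN not_sym] Gamma_real_pos) simp
    ultimately show ?thesis using \<alpha> by (simp add: Beta_def)
  qed
  have b2: "(3 - \<alpha>) / 2 * Beta (c + 1) (2 - \<alpha>) = Gamma ((1 + \<alpha>) / 2) * Gamma (2 - \<alpha>) / Gamma ((3 - \<alpha>) / 2)"
  proof -
    have 1: "c + 1 = (1 + \<alpha>) / 2" and 2: "(1 + \<alpha>) / 2 + (2 - \<alpha>) = (3 - \<alpha>) / 2 + 1"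
      by (auto simp: c_def field_simps)
    have 3: "Gamma ((3 - \<alpha>) / 2 + 1) = (3 - \<alpha>) / 2 * Gamma ((3 - \<alpha>) / 2)"
      using \<alpha> by (intro Gamma_plus1) (auto elim!: nonpos_Ints_cases)
    have "Gamma ((3 - \<alpha>) / 2) \<noteq> 0" using \<alpha> by (intro less_imp_neq[THEN not_sym] Gamma_real_pos) simp
    then show ?thesis using \<alpha> unfolding Beta_def 1 2 3 by simp
  qed
  have "0 + (- (2 - \<alpha>) * Beta 1 (2 - \<alpha>) + (3 - \<alpha>) / 2 * Beta (c + 1) (2 - \<alpha>)) / \<alpha>
     = Gamma ((1 + \<alpha>) / 2) * Gamma (2 - \<alpha>) / (\<alpha> * Gamma ((3 - \<alpha>) / 2)) - 1 / \<alpha>"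
    unfolding b2 mult_minus_left b1 by (simp add: add_divide_distrib diff_divide_distrib mult.commute)
  with T show ?thesis unfolding f_def c_def by simp
qed

text \<open>The powers pi^(d/2) and the factors Gamma ((d + \<alpha>) / 2) cancel, which is why the
  Hardy constant does not depend on the dimension. The rest is the functional equation for Gamma
  (-\<alpha> / 2) and duplication at 1 - \<alpha> / 2, which ties the quotient Gamma (2 - \<alpha>)
  / Gamma ((3 - \<alpha>) / 2) from the Beta integral to the normalization.\<close>

lemma stable_const_identity:
  "stable_const d \<alpha> * pi powr ((real d - 1) / 2) * Gamma ((1 + \<alpha>) / 2) / Gamma ((real d + \<alpha>) / 2) *
     (Gamma ((1 + \<alpha>) / 2) * Gamma (2 - \<alpha>) / (\<alpha> * Gamma ((3 - \<alpha>) / 2))) = (Gamma ((1 + \<alpha>) / 2))\<^sup>2 / pi"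
proof -
  have nz: "x \<notin> \<int>\<^sub>\<le>\<^sub>0" if "x > 0" for x :: real
    using that by (auto elim!: nonpos_Ints_cases)
  have "- \<alpha> / 2 \<notin> \<int>\<^sub>\<le>\<^sub>0"
  proof
    assume "- \<alpha> / 2 \<in> \<int>\<^sub>\<le>\<^sub>0"
    then obtain n where "- \<alpha> / 2 = of_int n" by (auto elim!: nonpos_Ints_cases)
    then have "real_of_int n < of_int 0" "real_of_int (- 1) < of_int n" using \<alpha> by auto
    then show False unfolding of_int_less_iff by linarith
  qed
  then have "Gamma (1 - \<alpha> / 2) = - \<alpha> / 2 * Gamma (- \<alpha> / 2)"
    using Gamma_plus1[of "- \<alpha> / 2"] by simp
  then have "Gamma (- \<alpha> / 2) = - (2 / \<alpha> * Gamma (1 - \<alpha> / 2))"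
    using \<alpha> by (simp add: field_simps)
  then have 1: "\<bar>Gamma (- \<alpha> / 2)\<bar> = 2 / \<alpha> * Gamma (1 - \<alpha> / 2)"
    using \<alpha> Gamma_real_pos[of "1 - \<alpha> / 2"] by (simp only: abs_minus_cancel) (simp add: abs_mult)
  \<comment> \<open>The duplication formula of the complex Gamma function is evaluated on the real
    axis.\<close>
  have "of_real (1 - \<alpha> / 2) + 1 / 2 = complex_of_real ((3 - \<alpha>) / 2)"
    by (simp add: field_simps)
  moreover have "2 * of_real (1 - \<alpha> / 2) = complex_of_real (2 - \<alpha>)" by simp
  moreover have "exp ((1 - complex_of_real (2 - \<alpha>)) * of_real (ln 2)) = of_real (exp ((\<alpha> - 1) * ln 2))"
    by (simp flip: exp_of_real)
  ultimately have "complex_of_real (Gamma (1 - \<alpha> / 2) * Gamma ((3 - \<alpha>) / 2))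
     = of_real (exp ((\<alpha> - 1) * ln 2) * sqrt pi * Gamma (2 - \<alpha>))"
    using Gamma_legendre_duplication[of "of_real (1 - \<alpha> / 2)"] nz[of "1 - \<alpha> / 2"] nz[of "(3 - \<alpha>) / 2"] \<alpha>
    by (simp only: Gamma_complex_of_real of_real_in_nonpos_Ints_iff of_real_mult) simp
  then have 2: "Gamma (1 - \<alpha> / 2) * Gamma ((3 - \<alpha>) / 2) = 2 powr (\<alpha> - 1) * sqrt pi * Gamma (2 - \<alpha>)"
    unfolding of_real_eq_iff by (simp add: powr_def mult.commute)
  define P Q R where "P = Gamma (1 - \<alpha> / 2)" and "Q = Gamma ((3 - \<alpha>) / 2)"
    and "R = Gamma ((real d + \<alpha>) / 2)"
  have P: "P > 0" "Q > 0" "R > 0" using \<alpha> by (auto simp: P_def Q_def R_def intro!: Gamma_real_pos)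
  have 3: "P * Q = 2 powr \<alpha> / 2 * sqrt pi * Gamma (2 - \<alpha>)" using 2 by (simp add: P_def Q_def powr_diff)
  have 4: "pi powr ((real d - 1) / 2) = pi powr (real d / 2) / sqrt pi"
    by (simp add: diff_divide_distrib powr_diff powr_half_sqrt)
  have "stable_const d \<alpha> * pi powr ((real d - 1) / 2) * Gamma ((1 + \<alpha>) / 2) / Gamma ((real d + \<alpha>) / 2) *
     (Gamma ((1 + \<alpha>) / 2) * Gamma (2 - \<alpha>) / (\<alpha> * Q)) =
     (Gamma ((1 + \<alpha>) / 2))\<^sup>2 * (2 powr \<alpha> / 2 * Gamma (2 - \<alpha>)) / (sqrt pi * (P * Q))"
    unfolding stable_const_def 1 4 P_def[symmetric] R_def[symmetric] using P \<alpha>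
    by (simp add: powr_minus field_simps power2_eq_square)
  also have "\<dots> = (Gamma ((1 + \<alpha>) / 2))\<^sup>2 / pi"
  proof -
    have "Gamma (2 - \<alpha>) \<noteq> 0" using \<alpha> by (intro less_imp_neq[THEN not_sym] Gamma_real_pos) simp
    then show ?thesis unfolding 3 by (simp add: field_simps)
  qed
  finally show ?thesis by (simp add: Q_def)
qed

end

section \<open>The scale-invariant truncation in one variable\<close>

text \<open>The negation makes every pair with a point outside the half-line count as far, so the
  truncation leaves the interaction with the complement untouched.\<close>

definition far_apart :: "real \<Rightarrow> real \<Rightarrow> real \<Rightarrow> bool" where
  "far_apart q s t \<longleftrightarrow> \<not> (0 < s \<and> 0 < t \<and> s < q * t \<and> t < q * s)"

definition half_line_weight :: "real \<Rightarrow> real \<Rightarrow> real" where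
  "half_line_weight \<alpha> t = (if 0 < t then t powr ((\<alpha> - 1) / 2) else 0)"

text \<open>The excess of \<open>far_mass\<close> over \<open>far_weighted_mass\<close>, written
  without subtraction: 1 / \<alpha> comes from r \<le> 0, the integral from r \<le> 1 / q together
  with r \<ge> q folded onto it.\<close>

definition hardy_trunc :: "real \<Rightarrow> real \<Rightarrow> ennreal" where
  "hardy_trunc \<alpha> q = ennreal (1 / \<alpha>) +
     (\<integral>\<^sup>+r. ennreal ((1 - r powr ((\<alpha> - 1) / 2))\<^sup>2 * (1 - r) powr (- (1 + \<alpha>))) * indicator {0<..1 / q} r \<partial>lborel)"

text \<open>The limit of \<open>hardy_trunc\<close> as q decreases to 1. Twice this number is the
  sharp constant for the one-dimensional energy without its normalizing factor.\<close>

definition hardy_const :: "real \<Rightarrow> real" where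
  "hardy_const \<alpha> = Gamma ((1 + \<alpha>) / 2) * Gamma (2 - \<alpha>) / (\<alpha> * Gamma ((3 - \<alpha>) / 2))"

lemma far_apart_sym: "far_apart q s t \<longleftrightarrow> far_apart q t s"
  by (auto simp: far_apart_def)

lemma far_apart_scale:
  assumes "s > 0" shows "far_apart q s (s * r) \<longleftrightarrow> far_apart q 1 r"
proof -
  have "s < q * (s * r) \<longleftrightarrow> s * 1 < s * (q * r)" "s * r < q * s \<longleftrightarrow> s * r < s * q"
    by (simp_all add: ac_simps)
  then show ?thesis using assms by (simp add: far_apart_def zero_less_mult_iff)
qed

lemma measurable_far_apart [measurable]:
  assumes [measurable]: "f \<in> borel_measurable M" "g \<in> borel_measurable M"
  shows "Measurable.pred M (\<lambda>x. far_apart q (f x) (g x))"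
  unfolding far_apart_def by measurable

lemma measurable_half_line_weight [measurable]: "half_line_weight \<alpha> \<in> borel_measurable borel"
  unfolding half_line_weight_def[abs_def] by measurable

text \<open>Being far from 1 means r \<le> 0, 0 < r \<le> 1 / q or r \<ge> q. The first range is
  reflected onto [1, \<infinity>), where the kernel becomes a pure power; the last is inverted onto
  the second, which produces the Jacobian 1 / r^2.\<close>

lemma nn_integral_far_apart_split:
  fixes G :: "real \<Rightarrow> ennreal"
  assumes [measurable]: "G \<in> borel_measurable borel" and q: "q > 1"
  shows "(\<integral>\<^sup>+r. G r * indicator {r. far_apart q 1 r} r \<partial>lborel)
       = (\<integral>\<^sup>+r. G (1 - r) * indicator {1..} r \<partial>lborel)
       + (\<integral>\<^sup>+r. (G r + G (1 / r) * ennreal (1 / r\<^sup>2)) * indicator {0<..1 / q} r \<partial>lborel)"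
proof -
  have "(\<integral>\<^sup>+r. G r * indicator {r. far_apart q 1 r} r \<partial>lborel)
     = (\<integral>\<^sup>+r. G r * indicator {..0} r + (G r * indicator {0<..1 / q} r + (G r * indicator {q..} r) * indicator {1..} r) \<partial>lborel)"
  proof (intro nn_integral_cong)
    fix r :: real
    have "1 / q < 1" using q by simp
    moreover have "1 < q * r \<longleftrightarrow> 1 / q < r" using q by (simp add: field_simps)
    moreover have "1 / q < r" if "q \<le> r" using that q \<open>1 / q < 1\<close> by linarith
    ultimately show "G r * indicator {r. far_apart q 1 r} r =
      G r * indicator {..0} r + (G r * indicator {0<..1 / q} r + (G r * indicator {q..} r) * indicator {1..} r)"
      using q by (auto simp: indicator_def far_apart_def)
  qed
  also have "\<dots> = (\<integral>\<^sup>+r. G r * indicator {..0} r \<partial>lborel) + ((\<integral>\<^sup>+r. G r * indicator {0<..1 / q} r \<partial>lborel)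
      + (\<integral>\<^sup>+r. (G r * indicator {q..} r) * indicator {1..} r \<partial>lborel))"
    by (simp add: nn_integral_add)
  also have "(\<integral>\<^sup>+r. (G r * indicator {q..} r) * indicator {1..} r \<partial>lborel)
     = (\<integral>\<^sup>+r. (G (1 / r) * indicator {q..} (1 / r)) * ennreal (1 / r\<^sup>2) * indicator {0<..1} r \<partial>lborel)"
    by (rule nn_integral_inversion) measurable
  also have "\<dots> = (\<integral>\<^sup>+r. (G (1 / r) * ennreal (1 / r\<^sup>2)) * indicator {0<..1 / q} r \<partial>lborel)"
  proof (intro nn_integral_cong)
    fix r :: real
    have "1 / q < 1" using q by simp
    moreover have "q \<le> 1 / r \<longleftrightarrow> r \<le> 1 / q" if "r > 0" using q that by (simp add: field_simps)
    ultimately show "(G (1 / r) * indicator {q..} (1 / r)) * ennreal (1 / r\<^sup>2) * indicator {0<..1} r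
      = (G (1 / r) * ennreal (1 / r\<^sup>2)) * indicator {0<..1 / q} r"
      by (auto simp: indicator_def)
  qed
  also have "(\<integral>\<^sup>+r. G r * indicator {0<..1 / q} r \<partial>lborel) + \<dots>
      = (\<integral>\<^sup>+r. (G r + G (1 / r) * ennreal (1 / r\<^sup>2)) * indicator {0<..1 / q} r \<partial>lborel)"
    by (subst nn_integral_add[symmetric]) (auto simp: distrib_right)
  also have "(\<integral>\<^sup>+r. G r * indicator {..0} r \<partial>lborel) = (\<integral>\<^sup>+r. G (1 - r) * indicator {1..} r \<partial>lborel)"
    using nn_integral_real_affine[of "\<lambda>r. G r * indicator {..0} r" "-1" 1]
    by (auto intro!: nn_integral_cong simp: indicator_def)
  finally show ?thesis .
qed

lemma nn_integral_powr_tail: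
  assumes "\<alpha> > (0::real)"
  shows "(\<integral>\<^sup>+x. ennreal (x powr (- (1 + \<alpha>))) * indicator {1..} x \<partial>lborel) = ennreal (1 / \<alpha>)"
proof -
  have "(\<integral>\<^sup>+x. ennreal (x powr (- (1 + \<alpha>))) * indicator {1..} x \<partial>lborel) = ennreal (0 - (- (1 powr (- \<alpha>)) / \<alpha>))"
  proof (rule nn_integral_FTC_atLeast[where F="\<lambda>x. - (x powr (- \<alpha>)) / \<alpha>"])
    fix x :: real assume "1 \<le> x"
    moreover have "- (1 + \<alpha>) = - \<alpha> - 1" by simp
    ultimately show "((\<lambda>x. - (x powr (- \<alpha>)) / \<alpha>) has_real_derivative x powr (- (1 + \<alpha>))) (at x)"
      using assms by (simp only:) (auto intro!: derivative_eq_intros)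
  next
    have "((\<lambda>x. x powr (- \<alpha>)) \<longlongrightarrow> 0) at_top"
      using assms by (intro tendsto_neg_powr filterlim_ident) auto
    then show "((\<lambda>x. - (x powr (- \<alpha>)) / \<alpha>) \<longlongrightarrow> 0) at_top"
      using tendsto_divide[OF tendsto_minus tendsto_const, of "\<lambda>x. x powr (- \<alpha>)" 0 at_top \<alpha>] assms by simp
  qed auto
  then show ?thesis by simp
qed

context
  fixes \<alpha> :: real
  assumes \<alpha>: "0 < \<alpha>" "\<alpha> < 2"
begin

text \<open>With t = s r the kernel gives s^(-(1 + \<alpha>)) and the Jacobian s. The product
  s^(-\<alpha>) is the origin of the Hardy weight; the truncation and \<open>h\<close> see only the
  ratio r.\<close>

lemma nn_integral_scale_far_apart:
  fixes h :: "real \<Rightarrow> ennreal"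
  assumes [measurable]: "h \<in> borel_measurable borel" and s: "s > 0"
  shows "(\<integral>\<^sup>+t. h (t / s) * ennreal (\<bar>s - t\<bar> powr (- (1 + \<alpha>))) * indicator {t. far_apart q s t} t \<partial>lborel)
     = ennreal (s powr (- \<alpha>)) *
       (\<integral>\<^sup>+r. h r * ennreal (\<bar>1 - r\<bar> powr (- (1 + \<alpha>))) * indicator {r. far_apart q 1 r} r \<partial>lborel)"
proof -
  have "(\<integral>\<^sup>+t. h (t / s) * ennreal (\<bar>s - t\<bar> powr (- (1 + \<alpha>))) * indicator {t. far_apart q s t} t \<partial>lborel)
    = ennreal \<bar>s\<bar> * (\<integral>\<^sup>+r. h ((0 + s * r) / s) * ennreal (\<bar>s - (0 + s * r)\<bar> powr (- (1 + \<alpha>))) *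
          indicator {t. far_apart q s t} (0 + s * r) \<partial>lborel)"
    using s by (intro nn_integral_real_affine) auto
  also have "(\<integral>\<^sup>+r. h ((0 + s * r) / s) * ennreal (\<bar>s - (0 + s * r)\<bar> powr (- (1 + \<alpha>))) *
          indicator {t. far_apart q s t} (0 + s * r) \<partial>lborel)
    = (\<integral>\<^sup>+r. ennreal (s powr (- (1 + \<alpha>))) * (h r * ennreal (\<bar>1 - r\<bar> powr (- (1 + \<alpha>))) * indicator {r. far_apart q 1 r} r) \<partial>lborel)"
  proof (intro nn_integral_cong)
    fix r
    have "\<bar>s - (0 + s * r)\<bar> = s * \<bar>1 - r\<bar>"
      using s abs_mult[of s "1 - r"] by (simp add: right_diff_distrib)
    then have "ennreal (\<bar>s - (0 + s * r)\<bar> powr (- (1 + \<alpha>))) =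
       ennreal (s powr (- (1 + \<alpha>))) * ennreal (\<bar>1 - r\<bar> powr (- (1 + \<alpha>)))"
      using s by (simp only: powr_mult) (simp add: ennreal_mult)
    then show "h ((0 + s * r) / s) * ennreal (\<bar>s - (0 + s * r)\<bar> powr (- (1 + \<alpha>))) *
          indicator {t. far_apart q s t} (0 + s * r) =
       ennreal (s powr (- (1 + \<alpha>))) * (h r * ennreal (\<bar>1 - r\<bar> powr (- (1 + \<alpha>))) * indicator {r. far_apart q 1 r} r)"
      using s far_apart_scale[OF s, of q r] by (simp add: indicator_def ac_simps)
  qed
  also have "\<dots> = ennreal (s powr (- (1 + \<alpha>))) * (\<integral>\<^sup>+r. h r * ennreal (\<bar>1 - r\<bar> powr (- (1 + \<alpha>))) * indicator {r. far_apart q 1 r} r \<partial>lborel)"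
    by (intro nn_integral_cmult) measurable
  also have "ennreal \<bar>s\<bar> * \<dots> = ennreal (s powr 1 * s powr (- (1 + \<alpha>))) *
       (\<integral>\<^sup>+r. h r * ennreal (\<bar>1 - r\<bar> powr (- (1 + \<alpha>))) * indicator {r. far_apart q 1 r} r \<partial>lborel)"
    using s by (simp add: ennreal_mult mult.assoc)
  also have "s powr 1 * s powr (- (1 + \<alpha>)) = s powr (- \<alpha>)"
    unfolding powr_add[symmetric] by simp
  finally show ?thesis .
qed

text \<open>The multiples of the Hardy integral produced by the terms u(x)^2 and u(x)^2 w(y) / w(x);
  in the second, the quotient of weights is the weight of the ratio r.\<close>

definition "far_mass q = (\<integral>\<^sup>+r. ennreal (\<bar>1 - r\<bar> powr (- (1 + \<alpha>))) * indicator {r. far_apart q 1 r} r \<partial>lborel)"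
definition "far_weighted_mass q = (\<integral>\<^sup>+r. ennreal (half_line_weight \<alpha> r) * ennreal (\<bar>1 - r\<bar> powr (- (1 + \<alpha>))) * indicator {r. far_apart q 1 r} r \<partial>lborel)"

lemma kernel_inversion:
  assumes "0 < r" "r < 1"
  shows "\<bar>1 - 1 / r\<bar> powr (- (1 + \<alpha>)) * (1 / r\<^sup>2) = r powr (\<alpha> - 1) * (1 - r) powr (- (1 + \<alpha>))"
proof -
  have 1: "\<bar>1 - 1 / r\<bar> = (1 - r) / r" using assms by (simp add: abs_if field_simps)
  have 2: "1 / r\<^sup>2 = r powr (- 2)" using assms by (simp add: powr_minus divide_simps)
  have 3: "((1 - r) / r) powr (- (1 + \<alpha>)) = (1 - r) powr (- (1 + \<alpha>)) * r powr (1 + \<alpha>)"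
    using assms powr_divide[of "1 - r" r "- (1 + \<alpha>)"] unfolding powr_minus by (simp add: divide_inverse)
  have "\<bar>1 - 1 / r\<bar> powr (- (1 + \<alpha>)) * (1 / r\<^sup>2) = (1 - r) powr (- (1 + \<alpha>)) * (r powr (1 + \<alpha>) * r powr (- 2))"
    unfolding 1 2 3 by simp
  also have "r powr (1 + \<alpha>) * r powr (- 2) = r powr (\<alpha> - 1)"
    unfolding powr_add[symmetric] by simp
  finally show ?thesis by simp
qed

text \<open>Inversion reproduces the integrand r^((\<alpha> - 1) / 2) (1 - r)^(-(1 + \<alpha>)), so
  the range r \<ge> q contributes as much as r \<le> 1 / q, whence the factor 2. On r \<le> 0 the
  weight vanishes.\<close>

lemma far_weighted_mass_eq:
  assumes q: "q > 1"
  shows "far_weighted_mass q = (\<integral>\<^sup>+r. ennreal (2 * r powr ((\<alpha> - 1) / 2) * (1 - r) powr (- (1 + \<alpha>))) * indicator {0<..1 / q} r \<partial>lborel)"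
proof -
  have "far_weighted_mass q = 0 + (\<integral>\<^sup>+r. (ennreal (half_line_weight \<alpha> r) * ennreal (\<bar>1 - r\<bar> powr (- (1 + \<alpha>)))
      + ennreal (half_line_weight \<alpha> (1 / r)) * ennreal (\<bar>1 - 1 / r\<bar> powr (- (1 + \<alpha>))) * ennreal (1 / r\<^sup>2)) * indicator {0<..1 / q} r \<partial>lborel)"
    unfolding far_weighted_mass_def
    by (subst nn_integral_far_apart_split[OF _ q])
       (auto intro!: nn_integral_zero' simp: half_line_weight_def indicator_def)
  also have "\<dots> = (\<integral>\<^sup>+r. ennreal (2 * r powr ((\<alpha> - 1) / 2) * (1 - r) powr (- (1 + \<alpha>))) * indicator {0<..1 / q} r \<partial>lborel)"
    unfolding add_0_left
  proof (intro nn_integral_cong)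
    fix r :: real
    show "(ennreal (half_line_weight \<alpha> r) * ennreal (\<bar>1 - r\<bar> powr (- (1 + \<alpha>)))
      + ennreal (half_line_weight \<alpha> (1 / r)) * ennreal (\<bar>1 - 1 / r\<bar> powr (- (1 + \<alpha>))) * ennreal (1 / r\<^sup>2)) * indicator {0<..1 / q} r
      = ennreal (2 * r powr ((\<alpha> - 1) / 2) * (1 - r) powr (- (1 + \<alpha>))) * indicator {0<..1 / q} r"
    proof (cases "r \<in> {0<..1 / q}")
      case True
      have "1 / q < 1" using q by simp
      then have r: "0 < r" "r < 1" using True by auto
      have "(1 / r) powr ((\<alpha> - 1) / 2) * r powr (\<alpha> - 1) = r powr (- ((\<alpha> - 1) / 2)) * r powr (\<alpha> - 1)"
        using r by (simp add: powr_minus_divide powr_divide)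
      also have "\<dots> = r powr ((\<alpha> - 1) / 2)" unfolding powr_add[symmetric] by (simp add: field_simps)
      finally have "(1 / r) powr ((\<alpha> - 1) / 2) * (\<bar>1 - 1 / r\<bar> powr (- (1 + \<alpha>)) * (1 / r\<^sup>2))
         = r powr ((\<alpha> - 1) / 2) * (1 - r) powr (- (1 + \<alpha>))"
        unfolding kernel_inversion[OF r] by (simp add: mult.assoc[symmetric])
      then have "ennreal ((1 / r) powr ((\<alpha> - 1) / 2)) * ennreal (\<bar>1 - 1 / r\<bar> powr (- (1 + \<alpha>))) * ennreal (1 / r\<^sup>2)
         = ennreal (r powr ((\<alpha> - 1) / 2) * (1 - r) powr (- (1 + \<alpha>)))"
        by (simp only: mult.assoc flip: ennreal_mult'') (simp flip: ennreal_mult'')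
      then show ?thesis using True r
        by (simp add: half_line_weight_def flip: ennreal_mult'' ennreal_plus)
    qed simp
  qed
  finally show ?thesis .
qed

text \<open>After folding, the integrand is (1 + x^2) Y with x = r^((\<alpha> - 1) / 2) and Y the
  kernel, and 1 + x^2 = 2 x + (1 - x)^2. The part 2 x Y is \<open>far_weighted_mass\<close>, the
  square goes into \<open>hardy_trunc\<close>.\<close>

lemma far_mass_eq:
  assumes q: "q > 1"
  shows "far_mass q = far_weighted_mass q + hardy_trunc \<alpha> q"
proof -
  have "far_mass q = (\<integral>\<^sup>+r. ennreal (\<bar>1 - (1 - r)\<bar> powr (- (1 + \<alpha>))) * indicator {1..} r \<partial>lborel)
     + (\<integral>\<^sup>+r. (ennreal (\<bar>1 - r\<bar> powr (- (1 + \<alpha>)))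
      + ennreal (\<bar>1 - 1 / r\<bar> powr (- (1 + \<alpha>))) * ennreal (1 / r\<^sup>2)) * indicator {0<..1 / q} r \<partial>lborel)"
    unfolding far_mass_def by (rule nn_integral_far_apart_split[OF _ q]) auto
  also have "(\<integral>\<^sup>+r. ennreal (\<bar>1 - (1 - r)\<bar> powr (- (1 + \<alpha>))) * indicator {1..} r \<partial>lborel) = ennreal (1 / \<alpha>)"
    unfolding nn_integral_powr_tail[OF \<alpha>(1), symmetric] by (intro nn_integral_cong) (auto simp: indicator_def)
  also have "(\<integral>\<^sup>+r. (ennreal (\<bar>1 - r\<bar> powr (- (1 + \<alpha>)))
      + ennreal (\<bar>1 - 1 / r\<bar> powr (- (1 + \<alpha>))) * ennreal (1 / r\<^sup>2)) * indicator {0<..1 / q} r \<partial>lborel)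
    = (\<integral>\<^sup>+r. ennreal (2 * r powr ((\<alpha> - 1) / 2) * (1 - r) powr (- (1 + \<alpha>))) * indicator {0<..1 / q} r
         + ennreal ((1 - r powr ((\<alpha> - 1) / 2))\<^sup>2 * (1 - r) powr (- (1 + \<alpha>))) * indicator {0<..1 / q} r \<partial>lborel)"
  proof (intro nn_integral_cong)
    fix r :: real
    show "(ennreal (\<bar>1 - r\<bar> powr (- (1 + \<alpha>)))
      + ennreal (\<bar>1 - 1 / r\<bar> powr (- (1 + \<alpha>))) * ennreal (1 / r\<^sup>2)) * indicator {0<..1 / q} r
      = ennreal (2 * r powr ((\<alpha> - 1) / 2) * (1 - r) powr (- (1 + \<alpha>))) * indicator {0<..1 / q} r
         + ennreal ((1 - r powr ((\<alpha> - 1) / 2))\<^sup>2 * (1 - r) powr (- (1 + \<alpha>))) * indicator {0<..1 / q} r"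
    proof (cases "r \<in> {0<..1 / q}")
      case True
      have "1 / q < 1" using q by simp
      then have r: "0 < r" "r < 1" using True by auto
      have sq: "r powr (\<alpha> - 1) = (r powr ((\<alpha> - 1) / 2))\<^sup>2"
        by (simp add: power2_eq_square flip: powr_add)
      have "ennreal (\<bar>1 - 1 / r\<bar> powr (- (1 + \<alpha>))) * ennreal (1 / r\<^sup>2) = ennreal (r powr (\<alpha> - 1) * (1 - r) powr (- (1 + \<alpha>)))"
        unfolding kernel_inversion[OF r, symmetric] by (rule ennreal_mult''[symmetric]) simp
      moreover have "ennreal y + ennreal (x\<^sup>2 * y) = ennreal (2 * x * y) + ennreal ((1 - x)\<^sup>2 * y)"
        if "0 \<le> x" "0 \<le> y" for x y :: real
      proof -
        have "y + x\<^sup>2 * y = 2 * x * y + (1 - x)\<^sup>2 * y" by (simp add: power2_eq_square algebra_simps)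
        then have "ennreal (y + x\<^sup>2 * y) = ennreal (2 * x * y + (1 - x)\<^sup>2 * y)" by (simp only:)
        then show ?thesis using that by simp
      qed
      ultimately show ?thesis using True r by (simp add: sq)
    qed simp
  qed
  also have "\<dots> = far_weighted_mass q + (\<integral>\<^sup>+r. ennreal ((1 - r powr ((\<alpha> - 1) / 2))\<^sup>2 * (1 - r) powr (- (1 + \<alpha>))) * indicator {0<..1 / q} r \<partial>lborel)"
    unfolding far_weighted_mass_eq[OF q] by (rule nn_integral_add) auto
  finally show ?thesis by (simp add: hardy_trunc_def ac_simps)
qed

text \<open>For r \<le> 1 / q < 1 the kernel is bounded and r^((\<alpha> - 1) / 2) is integrable at
  0. This finiteness, which fails without the truncation, is what allows the weighted mass to be
  cancelled in \<open>energy_eq\<close>.\<close>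

lemma far_weighted_mass_finite:
  assumes q: "q > 1"
  shows "far_weighted_mass q < \<infinity>"
proof -
  define K where "K = 2 * (1 - 1 / q) powr (- (1 + \<alpha>))"
  have "((\<lambda>r. r powr ((1 + \<alpha>) / 2 - 1) * (1 - r) powr (1 - 1)) has_integral Beta ((1 + \<alpha>) / 2) 1) {0..1}"
    using \<alpha> by (intro has_integral_Beta_real) auto
  then have "((\<lambda>r. K * (r powr ((1 + \<alpha>) / 2 - 1) * (1 - r) powr (1 - 1))) has_integral K * Beta ((1 + \<alpha>) / 2) 1) {0..1}"
    by (intro has_integral_mult_right)
  then have "(\<integral>\<^sup>+r. ennreal (K * (r powr ((1 + \<alpha>) / 2 - 1) * (1 - r) powr (1 - 1))) * indicator {0..1} r \<partial>lborel) = ennreal (K * Beta ((1 + \<alpha>) / 2) 1)"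
    by (intro nn_integral_has_integral_lebesgue') (auto simp: K_def)
  moreover have "far_weighted_mass q \<le> (\<integral>\<^sup>+r. ennreal (K * (r powr ((1 + \<alpha>) / 2 - 1) * (1 - r) powr (1 - 1))) * indicator {0..1} r \<partial>lborel)"
    unfolding far_weighted_mass_eq[OF q]
  proof (intro nn_integral_mono)
    fix r :: real
    show "ennreal (2 * r powr ((\<alpha> - 1) / 2) * (1 - r) powr (- (1 + \<alpha>))) * indicator {0<..1 / q} r
      \<le> ennreal (K * (r powr ((1 + \<alpha>) / 2 - 1) * (1 - r) powr (1 - 1))) * indicator {0..1} r"
    proof (cases "r \<in> {0<..1 / q}")
      case True
      have "1 / q < 1" using q by simp
      then have r: "0 < r" "r < 1" "1 - 1 / q > 0" using True by auto
      have "(1 - r) powr (- (1 + \<alpha>)) \<le> (1 - 1 / q) powr (- (1 + \<alpha>))"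
        using True r \<alpha> by (intro powr_mono2') auto
      moreover have "(1 + \<alpha>) / 2 - 1 = (\<alpha> - 1) / 2" by (simp add: field_simps)
      ultimately show ?thesis using True r by (simp add: K_def mult.commute mult.left_commute mult_left_mono)
    qed simp
  qed
  ultimately show ?thesis by (simp add: order_le_less_trans)
qed

text \<open>The 1 / \<alpha> from the complement of the half-line meets the -1 / \<alpha> of the
  Beta computation, and only the Gamma quotient is left.\<close>

lemma hardy_const_nn_integral:
  "ennreal (1 / \<alpha>) + (\<integral>\<^sup>+r. ennreal ((1 - r powr ((\<alpha> - 1) / 2))\<^sup>2 * (1 - r) powr (- (1 + \<alpha>))) * indicator {0..1} r \<partial>lborel)
    = ennreal (hardy_const \<alpha>)"
proof -
  have 1: "(\<integral>\<^sup>+r. ennreal ((1 - r powr ((\<alpha> - 1) / 2))\<^sup>2 * (1 - r) powr (- (1 + \<alpha>))) * indicator {0..1} r \<partial>lborel)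
    = ennreal (hardy_const \<alpha> - 1 / \<alpha>)"
    using has_integral_stable_kernel[OF \<alpha>] unfolding hardy_const_def
    by (intro nn_integral_has_integral_lebesgue') auto
  have "0 \<le> hardy_const \<alpha> - 1 / \<alpha>"
    using has_integral_stable_kernel[OF \<alpha>] unfolding hardy_const_def
    by (rule has_integral_nonneg) auto
  then show ?thesis unfolding 1 using \<alpha> by (simp flip: ennreal_plus)
qed

lemma hardy_trunc_le:
  assumes "q > 1" shows "hardy_trunc \<alpha> q \<le> ennreal (hardy_const \<alpha>)"
proof -
  have "1 / q < 1" using assms by simp
  then show ?thesis
    unfolding hardy_const_nn_integral[symmetric] hardy_trunc_def
    by (intro add_left_mono nn_integral_mono) (auto simp: indicator_def)
qed

lemma SUP_hardy_trunc: "(SUP n. hardy_trunc \<alpha> (1 + 1 / real (Suc n))) = ennreal (hardy_const \<alpha>)"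
proof -
  have U: "(\<Union>n. {0<..1 / (1 + 1 / real (Suc n))}) = {0<..<1::real}"
  proof (intro set_eqI iffI)
    fix r :: real assume r: "r \<in> {0<..<1}"
    then have "0 < 1 / r - 1" by simp
    then obtain n where "1 / real (Suc n) < 1 / r - 1" using nat_approx_posE by blast
    then have "r \<le> 1 / (1 + 1 / real (Suc n))" using r by (simp add: field_simps)
    then show "r \<in> (\<Union>n. {0<..1 / (1 + 1 / real (Suc n))})" using r by auto
  next
    fix r :: real assume "r \<in> (\<Union>n. {0<..1 / (1 + 1 / real (Suc n))})"
    then obtain n where n: "0 < r" "r \<le> 1 / (1 + 1 / real (Suc n))" by auto
    have "1 / (1 + 1 / real (Suc n)) < 1" by (simp add: field_simps)
    then show "r \<in> {0<..<1}" using n by auto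
  qed
  have inc: "incseq (\<lambda>n. {0<..1 / (1 + 1 / real (Suc n))})"
  proof (rule incseq_SucI)
    fix n :: nat
    have "1 / (1 + 1 / real (Suc n)) \<le> 1 / (1 + 1 / real (Suc (Suc n)))"
      by (intro divide_left_mono add_left_mono) (auto intro!: mult_pos_pos add_pos_pos)
    then show "{0<..1 / (1 + 1 / real (Suc n))} \<subseteq> {0<..1 / (1 + 1 / real (Suc (Suc n)))}"
      by auto
  qed
  let ?f = "\<lambda>r. ennreal ((1 - r powr ((\<alpha> - 1) / 2))\<^sup>2 * (1 - r) powr (- (1 + \<alpha>)))"
  have "(SUP n. hardy_trunc \<alpha> (1 + 1 / real (Suc n))) = ennreal (1 / \<alpha>) +
     (SUP n. \<integral>\<^sup>+r. ?f r * indicator {0<..1 / (1 + 1 / real (Suc n))} r \<partial>lborel)"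
    unfolding hardy_trunc_def by (rule ennreal_SUP_add_right[symmetric]) simp
  also have "(SUP n. \<integral>\<^sup>+r. ?f r * indicator {0<..1 / (1 + 1 / real (Suc n))} r \<partial>lborel) = (\<integral>\<^sup>+r. ?f r * indicator {0<..<1} r \<partial>lborel)"
    unfolding U[symmetric] by (rule SUP_nn_integral_indicator_incseq[OF _ _ inc]) auto
  also have "\<dots> = (\<integral>\<^sup>+r. ?f r * indicator {0..1} r \<partial>lborel)"
    using AE_lborel_singleton[of "0::real"] AE_lborel_singleton[of "1::real"]
    by (intro nn_integral_cong_AE) (auto simp: indicator_def elim!: eventually_elim2)
  finally show ?thesis unfolding hardy_const_nn_integral .
qed

end

section \<open>The truncated ground state representation\<close>

definition trunc_kernel :: "'a::euclidean_space \<Rightarrow> real \<Rightarrow> real \<Rightarrow> 'a \<Rightarrow> 'a \<Rightarrow> ennreal" where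
  "trunc_kernel e \<alpha> q x y = (if far_apart q (x \<bullet> e) (y \<bullet> e)
     then ennreal (norm (x - y) powr (- (real DIM('a) + \<alpha>))) else 0)"

lemma trunc_kernel_sym: "trunc_kernel e \<alpha> q x y = trunc_kernel e \<alpha> q y x"
  by (simp add: trunc_kernel_def far_apart_sym[of q "x \<bullet> e"] norm_minus_commute)

lemma measurable_trunc_kernel [measurable]:
  fixes e :: "'a::euclidean_space"
  assumes [measurable]: "f \<in> borel_measurable M" "g \<in> borel_measurable M"
  shows "(\<lambda>x. trunc_kernel e \<alpha> q (f x) (g x)) \<in> borel_measurable M"
  unfolding trunc_kernel_def by measurable

lemma nn_integral_lborel_translate:
  fixes f :: "'a::euclidean_space \<Rightarrow> ennreal"
  assumes [measurable]: "f \<in> borel_measurable borel"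
  shows "(\<integral>\<^sup>+y. f y \<partial>lborel) = (\<integral>\<^sup>+z. f (x + z) \<partial>lborel)"
proof -
  have "(\<integral>\<^sup>+y. f y \<partial>distr lborel borel ((+) x)) = (\<integral>\<^sup>+z. f (x + z) \<partial>lborel)"
    by (subst nn_integral_distr) auto
  then show ?thesis by (simp add: lborel_distr_plus)
qed

lemma slice_const_pos: "\<alpha> > 0 \<Longrightarrow> slice_const d \<alpha> > 0"
  unfolding slice_const_def by (intro divide_pos_pos mult_pos_pos Gamma_real_pos) (auto intro: add_nonneg_pos)

lemma half_line_weight_divide:
  assumes "s > 0" shows "half_line_weight \<alpha> t / half_line_weight \<alpha> s = half_line_weight \<alpha> (t / s)"
  using assms by (auto simp: half_line_weight_def powr_divide zero_less_divide_iff)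

lemma half_line_weight_nonneg [simp]: "half_line_weight \<alpha> t \<ge> 0"
  by (simp add: half_line_weight_def)

text \<open>Since \<open>x / 0 = 0\<close>, this also covers points outside the half-space, where weight and function both vanish.\<close>
lemma ground_state_identity:
  fixes a b v w :: real
  assumes "v = 0 \<Longrightarrow> a = 0" "w = 0 \<Longrightarrow> b = 0"
  shows "(a - b)\<^sup>2 + (a\<^sup>2 * (w / v) + b\<^sup>2 * (v / w)) = (a\<^sup>2 + b\<^sup>2) + v * w * (a / v - b / w)\<^sup>2"
proof (cases "v = 0 \<or> w = 0")
  case False
  then show ?thesis by (simp add: field_simps power2_eq_square)
qed (use assms in auto)

definition stable_energy :: "real \<Rightarrow> ('a::euclidean_space \<Rightarrow> real) \<Rightarrow> ennreal" where
  "stable_energy \<alpha> u =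
     (\<integral>\<^sup>+x. \<integral>\<^sup>+y. ennreal ((u x - u y)\<^sup>2 / norm (x - y) powr (real DIM('a) + \<alpha>)) \<partial>lborel \<partial>lborel)"

text \<open>Stated for any Euclidean space and basis vector, so that it can be instantiated with
  \<open>real^'n\<close> for the inequality and with \<open>real\<close> itself, e = 1, for the
  near-optimizers.\<close>

locale stable_half_space =
  fixes e :: "'a::euclidean_space" and \<alpha> :: real
  assumes e: "e \<in> Basis" and \<alpha>: "0 < \<alpha>" "\<alpha> < 2"
begin

abbreviation w :: "'a \<Rightarrow> real" where "w x \<equiv> half_line_weight \<alpha> (x \<bullet> e)"

text \<open>The integrand depends on y through y - x in the kernel and through the ratio of the
  \<open>e\<close>-coordinates elsewhere. Translation and slicing reduce it to one variable, and
  scaling then leaves x only in the Hardy weight.\<close>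

lemma nn_integral_trunc_kernel:
  fixes h :: "real \<Rightarrow> ennreal"
  assumes [measurable]: "h \<in> borel_measurable borel" and x: "x \<bullet> e > 0"
  shows "(\<integral>\<^sup>+y. h ((y \<bullet> e) / (x \<bullet> e)) * trunc_kernel e \<alpha> q x y \<partial>lborel)
     = ennreal (slice_const DIM('a) \<alpha>) * ennreal ((x \<bullet> e) powr (- \<alpha>)) *
       (\<integral>\<^sup>+r. h r * ennreal (\<bar>1 - r\<bar> powr (- (1 + \<alpha>))) * indicator {r. far_apart q 1 r} r \<partial>lborel)"
proof -
  define s where "s = x \<bullet> e"
  have s: "s > 0" using x by (simp add: s_def)
  define F where "F \<tau> = h ((s + \<tau>) / s) * indicator {t. far_apart q s t} (s + \<tau>)" for \<tau>
  have [measurable]: "F \<in> borel_measurable borel" unfolding F_def[abs_def] by measurable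
  have "(\<integral>\<^sup>+y. h ((y \<bullet> e) / s) * trunc_kernel e \<alpha> q x y \<partial>lborel)
    = (\<integral>\<^sup>+z. h (((x + z) \<bullet> e) / s) * trunc_kernel e \<alpha> q x (x + z) \<partial>lborel)"
    by (rule nn_integral_lborel_translate) measurable
  also have "\<dots> = (\<integral>\<^sup>+z. F (z \<bullet> e) * ennreal (norm z powr (- (real DIM('a) + \<alpha>))) \<partial>lborel)"
    by (intro nn_integral_cong) (auto simp: F_def trunc_kernel_def inner_add_left s_def indicator_def)
  also have "\<dots> = ennreal (slice_const DIM('a) \<alpha>) * (\<integral>\<^sup>+\<tau>. F \<tau> * ennreal (\<bar>\<tau>\<bar> powr (- (1 + \<alpha>))) \<partial>lborel)"
    using e \<alpha> by (intro nn_integral_coordinate_kernel) auto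
  also have "(\<integral>\<^sup>+\<tau>. F \<tau> * ennreal (\<bar>\<tau>\<bar> powr (- (1 + \<alpha>))) \<partial>lborel)
    = (\<integral>\<^sup>+t. h (t / s) * ennreal (\<bar>s - t\<bar> powr (- (1 + \<alpha>))) * indicator {t. far_apart q s t} t \<partial>lborel)"
    by (subst nn_integral_lborel_translate[of "\<lambda>t. h (t / s) * ennreal (\<bar>s - t\<bar> powr (- (1 + \<alpha>))) * indicator {t. far_apart q s t} t" s])
       (auto simp: F_def ac_simps)
  also have "\<dots> = ennreal (s powr (- \<alpha>)) *
       (\<integral>\<^sup>+r. h r * ennreal (\<bar>1 - r\<bar> powr (- (1 + \<alpha>))) * indicator {r. far_apart q 1 r} r \<partial>lborel)"
    by (rule nn_integral_scale_far_apart[OF \<alpha> _ s]) measurable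
  finally show ?thesis by (simp add: s_def mult.assoc)
qed

definition "hardy_integral u = (\<integral>\<^sup>+x. ennreal ((u x)\<^sup>2 * (x \<bullet> e) powr (- \<alpha>)) \<partial>lborel)"
definition "energy q u = (\<integral>\<^sup>+x. \<integral>\<^sup>+y. ennreal ((u x - u y)\<^sup>2) * trunc_kernel e \<alpha> q x y \<partial>lborel \<partial>lborel)"
definition "remainder q u = (\<integral>\<^sup>+x. \<integral>\<^sup>+y. ennreal (w x * w y * (u x / w x - u y / w y)\<^sup>2) * trunc_kernel e \<alpha> q x y \<partial>lborel \<partial>lborel)"

text \<open>The two summands are exchanged by swapping x and y, and for each the inner integral is a
  constant times the Hardy weight. It serves three profiles: h = 1 and h =
  \<open>half_line_weight\<close> in the energy identity, and the weight times (ln r)^2 in the bound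
  of the remainder.\<close>

lemma hardy_weighted_sum:
  fixes h :: "real \<Rightarrow> real"
  assumes [measurable]: "h \<in> borel_measurable borel" "u \<in> borel_measurable borel" and h: "\<And>r. h r \<ge> 0"
    and u: "\<And>x. x \<bullet> e \<le> 0 \<Longrightarrow> u x = 0"
  shows "(\<integral>\<^sup>+x. \<integral>\<^sup>+y. ennreal ((u x)\<^sup>2 * h ((y \<bullet> e) / (x \<bullet> e)) + (u y)\<^sup>2 * h ((x \<bullet> e) / (y \<bullet> e))) * trunc_kernel e \<alpha> q x y \<partial>lborel \<partial>lborel)
    = 2 * (ennreal (slice_const DIM('a) \<alpha>) * (\<integral>\<^sup>+r. ennreal (h r) * ennreal (\<bar>1 - r\<bar> powr (- (1 + \<alpha>))) * indicator {r. far_apart q 1 r} r \<partial>lborel) * hardy_integral u)"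
proof -
  let ?I = "\<integral>\<^sup>+r. ennreal (h r) * ennreal (\<bar>1 - r\<bar> powr (- (1 + \<alpha>))) * indicator {r. far_apart q 1 r} r \<partial>lborel"
  let ?f = "\<lambda>x y. ennreal ((u x)\<^sup>2 * h ((y \<bullet> e) / (x \<bullet> e))) * trunc_kernel e \<alpha> q x y"
  have m[measurable]: "(\<lambda>(x, y). ?f x y) \<in> borel_measurable (lborel \<Otimes>\<^sub>M lborel)" by measurable
  have 1: "(\<integral>\<^sup>+x. \<integral>\<^sup>+y. ?f x y \<partial>lborel \<partial>lborel) = ennreal (slice_const DIM('a) \<alpha>) * ?I * hardy_integral u"
  proof -
    have "(\<integral>\<^sup>+y. ?f x y \<partial>lborel) = ennreal (slice_const DIM('a) \<alpha>) * ?I * ennreal ((u x)\<^sup>2 * (x \<bullet> e) powr (- \<alpha>))" for x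
    proof (cases "x \<bullet> e > 0")
      case True
      have "(\<integral>\<^sup>+y. ?f x y \<partial>lborel) = (\<integral>\<^sup>+y. ennreal ((u x)\<^sup>2) * (ennreal (h ((y \<bullet> e) / (x \<bullet> e))) * trunc_kernel e \<alpha> q x y) \<partial>lborel)"
        using h by (simp add: ennreal_mult mult.assoc)
      also have "\<dots> = ennreal ((u x)\<^sup>2) * (\<integral>\<^sup>+y. ennreal (h ((y \<bullet> e) / (x \<bullet> e))) * trunc_kernel e \<alpha> q x y \<partial>lborel)"
        by (rule nn_integral_cmult) measurable
      also have "(\<integral>\<^sup>+y. ennreal (h ((y \<bullet> e) / (x \<bullet> e))) * trunc_kernel e \<alpha> q x y \<partial>lborel) = ennreal (slice_const DIM('a) \<alpha>) * ennreal ((x \<bullet> e) powr (- \<alpha>)) * ?I"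
        by (rule nn_integral_trunc_kernel[OF _ True]) measurable
      finally show ?thesis by (simp add: ennreal_mult ac_simps)
    next
      case False
      then show ?thesis using u[of x] by simp
    qed
    then show ?thesis unfolding hardy_integral_def by (simp add: nn_integral_cmult)
  qed
  have "(\<integral>\<^sup>+x. \<integral>\<^sup>+y. ?f y x \<partial>lborel \<partial>lborel) = (\<integral>\<^sup>+x. \<integral>\<^sup>+y. ?f x y \<partial>lborel \<partial>lborel)"
    by (rule lborel_pair.Fubini') measurable
  moreover have "(\<integral>\<^sup>+x. \<integral>\<^sup>+y. ennreal ((u x)\<^sup>2 * h ((y \<bullet> e) / (x \<bullet> e)) + (u y)\<^sup>2 * h ((x \<bullet> e) / (y \<bullet> e))) * trunc_kernel e \<alpha> q x y \<partial>lborel \<partial>lborel)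
    = (\<integral>\<^sup>+x. (\<integral>\<^sup>+y. ?f x y + ?f y x \<partial>lborel) \<partial>lborel)"
    using h by (intro nn_integral_cong) (simp add: distrib_right trunc_kernel_sym[of e \<alpha> q])
  moreover have "\<dots> = (\<integral>\<^sup>+x. \<integral>\<^sup>+y. ?f x y \<partial>lborel \<partial>lborel) + (\<integral>\<^sup>+x. \<integral>\<^sup>+y. ?f y x \<partial>lborel \<partial>lborel)"
    by (subst nn_integral_add, measurable, subst nn_integral_add[symmetric], measurable)
  ultimately show ?thesis using 1 by (simp add: mult_2)
qed

text \<open>The pointwise ground state identity, integrated with the negative terms moved to the
  other side so that everything stays in [0, \<infinity>].\<close>

lemma energy_identity:
  assumes [measurable]: "u \<in> borel_measurable borel" and u: "\<And>x. x \<bullet> e \<le> 0 \<Longrightarrow> u x = 0"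
  shows "energy q u + 2 * (ennreal (slice_const DIM('a) \<alpha>) * far_weighted_mass \<alpha> q * hardy_integral u)
    = 2 * (ennreal (slice_const DIM('a) \<alpha>) * far_mass \<alpha> q * hardy_integral u) + remainder q u"
proof -
  let ?P = "\<lambda>x y. ennreal ((u x)\<^sup>2 * half_line_weight \<alpha> ((y \<bullet> e) / (x \<bullet> e)) + (u y)\<^sup>2 * half_line_weight \<alpha> ((x \<bullet> e) / (y \<bullet> e))) * trunc_kernel e \<alpha> q x y"
  let ?Q = "\<lambda>x y. ennreal ((u x)\<^sup>2 * 1 + (u y)\<^sup>2 * 1) * trunc_kernel e \<alpha> q x y"
  let ?E = "\<lambda>x y. ennreal ((u x - u y)\<^sup>2) * trunc_kernel e \<alpha> q x y"
  let ?R = "\<lambda>x y. ennreal (w x * w y * (u x / w x - u y / w y)\<^sup>2) * trunc_kernel e \<alpha> q x y"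
  have [measurable]: "(\<lambda>(x, y). ?P x y) \<in> borel_measurable (lborel \<Otimes>\<^sub>M lborel)"
    "(\<lambda>(x, y). ?Q x y) \<in> borel_measurable (lborel \<Otimes>\<^sub>M lborel)"
    "(\<lambda>(x, y). ?E x y) \<in> borel_measurable (lborel \<Otimes>\<^sub>M lborel)"
    "(\<lambda>(x, y). ?R x y) \<in> borel_measurable (lborel \<Otimes>\<^sub>M lborel)" by measurable
  have eq: "?E x y + ?P x y = ?Q x y + ?R x y" for x y
  proof -
    have uw: "u x = 0" if "w x = 0" for x
      using that u[of x] by (cases "x \<bullet> e > 0") (auto simp: half_line_weight_def)
    have P: "(u x)\<^sup>2 * half_line_weight \<alpha> ((y \<bullet> e) / (x \<bullet> e)) = (u x)\<^sup>2 * (w y / w x)" for x y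
      using u[of x] by (cases "x \<bullet> e > 0") (auto simp: half_line_weight_divide)
    have "ennreal ((u x - u y)\<^sup>2) + ennreal ((u x)\<^sup>2 * half_line_weight \<alpha> ((y \<bullet> e) / (x \<bullet> e)) + (u y)\<^sup>2 * half_line_weight \<alpha> ((x \<bullet> e) / (y \<bullet> e)))
      = ennreal ((u x - u y)\<^sup>2 + ((u x)\<^sup>2 * (w y / w x) + (u y)\<^sup>2 * (w x / w y)))"
      unfolding P by (rule ennreal_plus[symmetric]) auto
    also have "\<dots> = ennreal ((u x)\<^sup>2 * 1 + (u y)\<^sup>2 * 1) + ennreal (w x * w y * (u x / w x - u y / w y)\<^sup>2)"
      by (subst ground_state_identity) (auto simp: uw)
    finally show ?thesis by (simp only: distrib_right[symmetric])
  qed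
  have P: "(\<integral>\<^sup>+x. \<integral>\<^sup>+y. ?P x y \<partial>lborel \<partial>lborel) = 2 * (ennreal (slice_const DIM('a) \<alpha>) * far_weighted_mass \<alpha> q * hardy_integral u)"
    unfolding far_weighted_mass_def[OF \<alpha>] using u by (intro hardy_weighted_sum) auto
  have Q: "(\<integral>\<^sup>+x. \<integral>\<^sup>+y. ?Q x y \<partial>lborel \<partial>lborel) = 2 * (ennreal (slice_const DIM('a) \<alpha>) * far_mass \<alpha> q * hardy_integral u)"
    using hardy_weighted_sum[of "\<lambda>_. 1" u q] u by (simp add: far_mass_def[OF \<alpha>])
  have "energy q u + 2 * (ennreal (slice_const DIM('a) \<alpha>) * far_weighted_mass \<alpha> q * hardy_integral u)
     = (\<integral>\<^sup>+x. \<integral>\<^sup>+y. ?E x y + ?P x y \<partial>lborel \<partial>lborel)"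
    unfolding energy_def P[symmetric]
    by (subst nn_integral_add[symmetric], measurable, subst nn_integral_add[symmetric], measurable)
  also have "\<dots> = (\<integral>\<^sup>+x. \<integral>\<^sup>+y. ?Q x y + ?R x y \<partial>lborel \<partial>lborel)"
    by (simp only: eq)
  also have "\<dots> = 2 * (ennreal (slice_const DIM('a) \<alpha>) * far_mass \<alpha> q * hardy_integral u) + remainder q u"
    unfolding remainder_def Q[symmetric]
    by (subst nn_integral_add[symmetric], measurable, subst nn_integral_add[symmetric], measurable)
  finally show ?thesis .
qed

text \<open>The weighted mass occurs on both sides of \<open>energy_identity\<close> once
  \<open>far_mass\<close> is decomposed. Cancelling it requires that it be finite, hence the
  hypothesis on the Hardy integral.\<close>

lemma energy_eq:
  assumes [measurable]: "u \<in> borel_measurable borel" and u: "\<And>x. x \<bullet> e \<le> 0 \<Longrightarrow> u x = 0"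
    and q: "q > 1" and H: "hardy_integral u < \<infinity>"
  shows "energy q u = 2 * (ennreal (slice_const DIM('a) \<alpha>) * hardy_trunc \<alpha> q * hardy_integral u) + remainder q u"
proof -
  let ?B = "2 * (ennreal (slice_const DIM('a) \<alpha>) * far_weighted_mass \<alpha> q * hardy_integral u)"
  have "?B \<noteq> \<infinity>"
    using H far_weighted_mass_finite[OF \<alpha> q] by (auto simp: ennreal_mult_eq_top_iff)
  moreover have "?B + energy q u = ?B + (2 * (ennreal (slice_const DIM('a) \<alpha>) * hardy_trunc \<alpha> q * hardy_integral u) + remainder q u)"
    using energy_identity[OF assms(1) u, of q] unfolding far_mass_eq[OF \<alpha> q]
    by (simp add: distrib_left distrib_right ac_simps)
  ultimately show ?thesis by (simp add: ennreal_add_left_cancel)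
qed


lemma energy_le_full: "energy q u \<le> stable_energy \<alpha> u"
  unfolding energy_def stable_energy_def trunc_kernel_def powr_minus
  by (intro nn_integral_mono)
     (auto simp: divide_inverse simp flip: ennreal_mult)

text \<open>For each q the remainder is discarded and the truncated energy is at most the full one.
  Only the constant has to pass to the limit, so no convergence of energies enters here.\<close>

theorem fractional_hardy:
  assumes [measurable]: "u \<in> borel_measurable borel" and u: "\<And>x. x \<bullet> e \<le> 0 \<Longrightarrow> u x = 0"
    and H: "hardy_integral u < \<infinity>"
  shows "2 * (ennreal (slice_const DIM('a) \<alpha>) * ennreal (hardy_const \<alpha>) * hardy_integral u) \<le> stable_energy \<alpha> u"
proof -
  have *: "2 * (ennreal (slice_const DIM('a) \<alpha>) * ennreal (hardy_const \<alpha>) * hardy_integral u)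
     = (SUP n. (2 * ennreal (slice_const DIM('a) \<alpha>) * hardy_integral u) * hardy_trunc \<alpha> (1 + 1 / real (Suc n)))"
    unfolding SUP_hardy_trunc[OF \<alpha>, symmetric] by (simp add: SUP_mult_left_ennreal ac_simps)
  show ?thesis unfolding *
  proof (rule SUP_least)
    fix n
    have "(2 * ennreal (slice_const DIM('a) \<alpha>) * hardy_integral u) * hardy_trunc \<alpha> (1 + 1 / real (Suc n)) \<le> energy (1 + 1 / real (Suc n)) u"
      using u H by (subst energy_eq) (auto simp: ac_simps)
    also have "\<dots> \<le> stable_energy \<alpha> u" by (rule energy_le_full)
    finally show "(2 * ennreal (slice_const DIM('a) \<alpha>) * hardy_integral u) * hardy_trunc \<alpha> (1 + 1 / real (Suc n)) \<le> stable_energy \<alpha> u" .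
  qed
qed

end

section \<open>Smooth test functions\<close>

text \<open>The test functions are products of functions of one coordinate, for which
  \<open>C_class\<close> reduces to this one-variable notion. The set S allows powers and logarithms
  on the positive half-line, and gluing over open sets.\<close>

primrec ck_on :: "nat \<Rightarrow> real set \<Rightarrow> (real \<Rightarrow> real) \<Rightarrow> bool" where
  "ck_on 0 S f \<longleftrightarrow> continuous_on S f"
| "ck_on (Suc m) S f \<longleftrightarrow> (\<forall>x\<in>S. f field_differentiable (at x)) \<and> ck_on m S (deriv f)"

lemma ck_on_cong:
  assumes "open S" "\<And>x. x \<in> S \<Longrightarrow> f x = g x" "ck_on m S f"
  shows "ck_on m S g"
  using assms(2,3)
proof (induction m arbitrary: f g)
  case 0
  then show ?case using continuous_on_cong[of S S f g] by simp
next
  case (Suc m)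
  have ev: "eventually (\<lambda>y. f y = g y) (nhds x)" if "x \<in> S" for x
    using Suc.prems(1) assms(1) that by (metis (mono_tags, lifting) eventually_nhds)
  have "g field_differentiable (at x)" if "x \<in> S" for x
  proof -
    from Suc.prems(2) that have "(f has_field_derivative deriv f x) (at x)"
      by (simp add: DERIV_deriv_iff_field_differentiable)
    then have "(g has_field_derivative deriv f x) (at x)"
      using ev[OF that] by (subst (asm) DERIV_cong_ev) auto
    then show ?thesis using field_differentiable_def by blast
  qed
  moreover have "ck_on m S (deriv g)"
    using Suc.prems ev by (intro Suc.IH[of "deriv f" "deriv g"]) (auto intro!: deriv_cong_ev)
  ultimately show ?case by simp
qed

lemma ck_on_Suc_I:
  assumes "open S" "\<And>x. x \<in> S \<Longrightarrow> (f has_real_derivative f' x) (at x)" "ck_on m S f'"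
  shows "ck_on (Suc m) S f"
  using assms by (auto simp: field_differentiable_def intro!: ck_on_cong[of S f' "deriv f"] DERIV_imp_deriv[symmetric])

lemma ck_on_Suc_D:
  assumes "ck_on (Suc m) S f"
  shows "x \<in> S \<Longrightarrow> (f has_real_derivative deriv f x) (at x)" "ck_on m S (deriv f)"
  using assms by (simp_all add: DERIV_deriv_iff_field_differentiable)

lemma ck_on_imp_continuous_on: "ck_on m S f \<Longrightarrow> continuous_on S f"
  by (cases m) (auto intro!: continuous_at_imp_continuous_on field_differentiable_imp_continuous_at)

lemma ck_on_pred: "ck_on (Suc m) S f \<Longrightarrow> ck_on m S f"
proof (induction m arbitrary: f)
  case 0
  then show ?case using ck_on_imp_continuous_on by fastforce
qed simp

lemma ck_on_Un:
  assumes "open S" "open T" "ck_on m S f" "ck_on m T f" shows "ck_on m (S \<union> T) f"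
  using assms(3,4) by (induction m arbitrary: f) (auto intro: continuous_on_open_Un assms)

lemma ck_on_const: "open S \<Longrightarrow> ck_on m S (\<lambda>x. c)"
proof (induction m arbitrary: c)
  case (Suc m)
  then show ?case by (intro ck_on_Suc_I[where f' = "\<lambda>x. 0"]) auto
qed simp

lemma ck_on_ident: "open S \<Longrightarrow> ck_on m S (\<lambda>x. x)"
  by (cases m) (auto intro!: ck_on_Suc_I[where f' = "\<lambda>x. 1"] ck_on_const simp del: ck_on.simps(2))

lemma ck_on_add:
  assumes "open S" "ck_on m S f" "ck_on m S g" shows "ck_on m S (\<lambda>x. f x + g x)"
  using assms(2,3)
proof (induction m arbitrary: f g)
  case 0 then show ?case by (auto intro: continuous_on_add)
next
  case (Suc m)
  then show ?case using assms(1)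
    by (intro ck_on_Suc_I[where f' = "\<lambda>x. deriv f x + deriv g x"])
       (auto intro!: derivative_eq_intros Suc.IH dest: ck_on_Suc_D simp del: ck_on.simps)
qed

lemma ck_on_mult:
  assumes "open S" "ck_on m S f" "ck_on m S g" shows "ck_on m S (\<lambda>x. f x * g x)"
  using assms(2,3)
proof (induction m arbitrary: f g)
  case 0 then show ?case by (auto intro: continuous_on_mult)
next
  case (Suc m)
  note D = ck_on_Suc_D[OF Suc.prems(1)] ck_on_Suc_D[OF Suc.prems(2)]
  show ?case
  proof (rule ck_on_Suc_I[OF assms(1)])
    show "((\<lambda>x. f x * g x) has_real_derivative (deriv f x * g x + f x * deriv g x)) (at x)" if "x \<in> S" for x
      using D(1,3)[OF that] by (auto intro!: derivative_eq_intros)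
    show "ck_on m S (\<lambda>x. deriv f x * g x + f x * deriv g x)"
      by (intro ck_on_add assms(1) Suc.IH D(2,4) Suc.prems[THEN ck_on_pred])
  qed
qed

lemma ck_on_compose:
  assumes S: "open S" and "ck_on m T f" "ck_on m S g" "g ` S \<subseteq> T"
  shows "ck_on m S (\<lambda>x. f (g x))"
  using assms(2-4)
proof (induction m arbitrary: f g)
  case 0 then show ?case by (auto intro: continuous_on_compose2)
next
  case (Suc m)
  note D = ck_on_Suc_D[OF Suc.prems(1)] ck_on_Suc_D[OF Suc.prems(2)]
  show ?case
  proof (rule ck_on_Suc_I[OF S])
    show "((\<lambda>x. f (g x)) has_real_derivative (deriv f (g x) * deriv g x)) (at x)" if "x \<in> S" for x
      using D(1)[of "g x"] D(3)[OF that] that Suc.prems(3) by (intro DERIV_chain2) auto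
    show "ck_on m S (\<lambda>x. deriv f (g x) * deriv g x)"
      by (intro ck_on_mult S Suc.IH[of "deriv f"] D(2,4) Suc.prems(3) ck_on_pred[OF Suc.prems(2)])
  qed
qed

lemma ck_on_powr: "ck_on m {0<..} (\<lambda>x. x powr a)"
proof (induction m arbitrary: a)
  case 0
  show ?case by (auto intro!: continuous_intros)
next
  case (Suc m)
  show ?case
    by (rule ck_on_Suc_I[where f' = "\<lambda>x. a * x powr (a - 1)"])
       (auto intro!: has_real_derivative_powr ck_on_mult ck_on_const Suc)
qed

lemma ck_on_ln: "ck_on m {0<..} ln"
proof (cases m)
  case 0
  then show ?thesis by (auto intro!: continuous_intros)
next
  case (Suc n)
  then show ?thesis
    by (auto intro!: ck_on_Suc_I[where f' = "\<lambda>x. x powr (- 1)"] ck_on_powr derivative_eq_intros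
        simp: powr_minus divide_inverse simp del: ck_on.simps)
qed

section \<open>A bump function with explicit bounds\<close>

text \<open>For k = 0 this is the classical flat function exp (-1/x). The whole family is introduced
  because derivatives are linear combinations of its members, so smoothness of all of them is a
  single induction.\<close>

definition exp_flat :: "nat \<Rightarrow> real \<Rightarrow> real" where
  "exp_flat k x = (if x > 0 then (1 / x) ^ k * exp (- (1 / x)) else 0)"

lemma exp_flat_Suc: "x \<noteq> 0 \<Longrightarrow> exp_flat k x / x = exp_flat (Suc k) x"
  by (simp add: exp_flat_def)

lemma tendsto_exp_flat: "((exp_flat k) \<longlongrightarrow> 0) (at 0)"
proof (rule filterlim_split_at)
  show "((exp_flat k) \<longlongrightarrow> 0) (at_left 0)"
    by (rule tendsto_eventually) (auto simp: eventually_at_filter exp_flat_def)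
  have "((\<lambda>x::real. (inverse x) ^ k / exp (inverse x)) \<longlongrightarrow> 0) (at_right 0)"
    by (rule filterlim_compose[OF tendsto_power_div_exp_0 filterlim_inverse_at_top_right])
  then show "((exp_flat k) \<longlongrightarrow> 0) (at_right 0)"
    by (rule Lim_transform_eventually)
       (auto simp: eventually_at_filter exp_flat_def exp_minus divide_inverse)
qed

text \<open>At 0 the difference quotient of \<open>exp_flat k\<close> is
  \<open>exp_flat (Suc k)\<close>, which tends to 0. For x > 0 it is the chain rule in y =
  1/x.\<close>

lemma DERIV_exp_flat:
  "(exp_flat k has_real_derivative (exp_flat (k + 2) x - real k * exp_flat (k + 1) x)) (at x)"
proof -
  consider "x < 0" | "x = 0" | "x > 0" by linarith
  then show ?thesis
  proof cases
    case 1
    have "((\<lambda>x. 0) has_real_derivative 0) (at x)" by simp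
    then have "(exp_flat k has_real_derivative 0) (at x)"
      by (rule has_field_derivative_transform_within_open[where S="{..<0}"]) (use 1 in \<open>auto simp: exp_flat_def\<close>)
    then show ?thesis using 1 by (simp add: exp_flat_def)
  next
    case 2
    have "((\<lambda>y. (exp_flat k y - exp_flat k 0) / (y - 0)) \<longlongrightarrow> 0) (at 0)"
      by (rule Lim_transform_eventually[OF tendsto_exp_flat[of "Suc k"]])
         (auto simp: eventually_at_filter exp_flat_Suc, auto simp: exp_flat_def)
    then show ?thesis using 2 by (simp add: has_field_derivative_iff exp_flat_def)
  next
    case 3
    have "((\<lambda>y. y ^ k * exp (- y)) has_real_derivative
        (real k * (1 / x) ^ (k - 1) * exp (- (1 / x)) - (1 / x) ^ k * exp (- (1 / x)))) (at (1 / x))"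
      by (auto intro!: derivative_eq_intros simp: ac_simps)
    moreover have "((\<lambda>x. 1 / x) has_real_derivative - ((1 / x)\<^sup>2)) (at x)"
      using 3 by (auto intro!: derivative_eq_intros simp: power2_eq_square)
    ultimately have "((\<lambda>x. (1 / x) ^ k * exp (- (1 / x))) has_real_derivative
        (real k * (1 / x) ^ (k - 1) * exp (- (1 / x)) - (1 / x) ^ k * exp (- (1 / x))) * (- ((1 / x)\<^sup>2))) (at x)"
      by (rule DERIV_chain2)
    also have "(real k * (1 / x) ^ (k - 1) * exp (- (1 / x)) - (1 / x) ^ k * exp (- (1 / x))) * (- ((1 / x)\<^sup>2))
        = exp_flat (k + 2) x - real k * exp_flat (k + 1) x"
    proof -
      \<comment> \<open>For k = 0 the truncated difference \<open>k - 1\<close> is harmless, since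
        the factor \<open>real k\<close> vanishes.\<close>
      have 1: "real k * y ^ (k - 1) * y\<^sup>2 = real k * y ^ (k + 1)" for y :: real
        by (cases k) (auto simp: power2_eq_square)
      have "(real k * y ^ (k - 1) * E - y ^ k * E) * (- (y\<^sup>2)) = y ^ (k + 2) * E - real k * (y ^ (k + 1) * E)"
        for y E :: real
      proof -
        have "(real k * y ^ (k - 1) * E - y ^ k * E) * (- (y\<^sup>2)) = y ^ k * y\<^sup>2 * E - (real k * y ^ (k - 1) * y\<^sup>2) * E"
          by (simp add: algebra_simps)
        then show ?thesis unfolding 1 by (simp only: power_add mult.assoc)
      qed
      from this[of "1 / x" "exp (- (1 / x))"] show ?thesis
        using 3 by (simp add: exp_flat_def)
    qed
    finally show ?thesis
      by (rule has_field_derivative_transform_within_open[where S="{0<..}"]) (use 3 in \<open>auto simp: exp_flat_def\<close>)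
  qed
qed

lemma ck_on_exp_flat: "ck_on m UNIV (exp_flat k)"
proof (induction m arbitrary: k)
  case 0
  show ?case by (auto intro!: continuous_at_imp_continuous_on DERIV_isCont[OF DERIV_exp_flat])
next
  case (Suc m)
  have "ck_on m UNIV (\<lambda>x. exp_flat (k + 2) x + (- real k) * exp_flat (k + 1) x)"
    by (intro ck_on_add ck_on_mult ck_on_const Suc open_UNIV)
  then show ?case using DERIV_exp_flat[of k] by (intro ck_on_Suc_I[where f' = "\<lambda>x. exp_flat (k + 2) x - real k * exp_flat (k + 1) x"]) auto
qed

lemma exp_flat_0_bounds: "0 \<le> exp_flat 0 x" "exp_flat 0 x \<le> 1"
  by (auto simp: exp_flat_def)

text \<open>The derivative is y^2 exp (-y) with y = 1/x, and exp y \<ge> y^2 / 2 bounds it by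
  2.\<close>

lemma exp_flat_0_lipschitz: "\<bar>exp_flat 0 x - exp_flat 0 y\<bar> \<le> 2 * \<bar>x - y\<bar>"
proof -
  have "\<bar>exp_flat 2 x\<bar> \<le> 2" for x
  proof (cases "x > 0")
    case True
    have "(1 / x)\<^sup>2 \<le> 2 * exp (1 / x)"
    proof -
      have "0 < 1 / x" using True by simp
      with exp_lower_Taylor_quadratic[of "1 / x"] show ?thesis by linarith
    qed
    then show ?thesis using True by (simp add: exp_flat_def exp_minus field_simps)
  qed (simp add: exp_flat_def)
  then have "norm (exp_flat 0 x - exp_flat 0 y) \<le> 2 * norm (x - y)"
    using DERIV_exp_flat[of 0] by (intro field_differentiable_bound[of UNIV _ "exp_flat 2"]) (auto simp: numeral_2_eq_2)
  then show ?thesis by simp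
qed

text \<open>Neither a plateau nor a normalization is asked for, only values in [0, 1], support in
  [-1, 1], a positive lower bound on [-1/2, 1/2] and a Lipschitz constant; a product of two flat
  functions provides all of these.\<close>

definition bump :: "real \<Rightarrow> real" where
  "bump x = exp_flat 0 (1 - x) * exp_flat 0 (1 + x)"

lemma ck_on_bump: "ck_on m UNIV bump"
proof -
  have "ck_on m UNIV (\<lambda>x. exp_flat 0 (1 + (- 1) * x) * exp_flat 0 (1 + x))"
    by (intro ck_on_mult ck_on_compose[OF _ ck_on_exp_flat] ck_on_add ck_on_const ck_on_ident) auto
  then show ?thesis by (simp add: bump_def[abs_def])
qed

lemma bump_bounds: "0 \<le> bump x" "bump x \<le> 1"
  unfolding bump_def by (auto intro!: mult_nonneg_nonneg mult_le_one exp_flat_0_bounds)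

lemma bump_eq_0: "\<bar>x\<bar> \<ge> 1 \<Longrightarrow> bump x = 0"
  by (auto simp: bump_def exp_flat_def)

lemma bump_ge: "\<bar>x\<bar> \<le> 1 / 2 \<Longrightarrow> bump x \<ge> exp (- 4)"
proof -
  assume x: "\<bar>x\<bar> \<le> 1 / 2"
  then have p: "1 - x \<ge> 1 / 2" "1 + x \<ge> 1 / 2" by auto
  have "exp (- 2) \<le> exp_flat 0 y" if "y \<ge> 1 / 2" for y
    using that by (auto simp: exp_flat_def field_simps)
  with p have "exp (- 2) * exp (- 2) \<le> bump x"
    unfolding bump_def by (intro mult_mono) (auto simp: exp_flat_0_bounds)
  then show ?thesis by (simp flip: exp_add)
qed

lemma bump_lipschitz: "\<bar>bump x - bump y\<bar> \<le> 4 * \<bar>x - y\<bar>"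
proof -
  have "\<bar>bump x - bump y\<bar> = \<bar>(exp_flat 0 (1 - x) - exp_flat 0 (1 - y)) * exp_flat 0 (1 + x) + exp_flat 0 (1 - y) * (exp_flat 0 (1 + x) - exp_flat 0 (1 + y))\<bar>"
    by (simp add: bump_def algebra_simps)
  also have "\<dots> \<le> \<bar>exp_flat 0 (1 - x) - exp_flat 0 (1 - y)\<bar> * 1 + 1 * \<bar>exp_flat 0 (1 + x) - exp_flat 0 (1 + y)\<bar>"
    by (rule order_trans[OF abs_triangle_ineq], unfold abs_mult, intro add_mono mult_mono)
       (auto simp: exp_flat_0_bounds)
  also have "\<dots> \<le> 2 * \<bar>x - y\<bar> * 1 + 1 * (2 * \<bar>x - y\<bar>)"
    using exp_flat_0_lipschitz[of "1 - x" "1 - y"] exp_flat_0_lipschitz[of "1 + x" "1 + y"]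
    by (simp add: abs_minus_commute)
  finally show ?thesis by simp
qed

section \<open>Products of one-variable functions as test functions\<close>

text \<open>The j-th partial derivative of a product replaces the j-th factor by its derivative and
  is again such a product. The induction therefore runs over arbitrary families of factors.\<close>

lemma C_class_prod:
  fixes f :: "'n::finite \<Rightarrow> real \<Rightarrow> real"
  assumes "\<And>i. ck_on m UNIV (f i)"
  shows "C_class m (\<lambda>x::real^'n. \<Prod>i\<in>UNIV. f i (x $ i))"
  using assms
proof (induction m arbitrary: f)
  case 0
  then show ?case
    by (auto intro!: continuous_on_prod continuous_on_compose2[OF 0[simplified]] continuous_on_component)
next
  case (Suc m)
  note D = ck_on_Suc_D[OF Suc.prems]
  let ?u = "\<lambda>x::real^'n. \<Prod>i\<in>UNIV. f i (x $ i)"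
  have d: "(?u has_derivative (\<lambda>y. \<Sum>i\<in>UNIV. (deriv (f i) (x $ i) * (y $ i)) * (\<Prod>j\<in>UNIV - {i}. f j (x $ j)))) (at x)" for x
  proof (rule has_derivative_prod)
    fix i
    have "(f i has_derivative (\<lambda>t. deriv (f i) (x $ i) * t)) (at (x $ i))"
      using D(1)[of "x $ i" i] by (simp add: has_field_derivative_def)
    then show "((\<lambda>x. f i (x $ i)) has_derivative (\<lambda>y. deriv (f i) (x $ i) * (y $ i))) (at x)"
      by (rule has_derivative_compose[rotated]) (auto intro!: derivative_eq_intros bounded_linear_imp_has_derivative bounded_linear_vec_nth)
  qed
  have fd: "frechet_derivative ?u (at x) (axis j 1) = (\<Prod>i\<in>UNIV. (f(j := deriv (f j))) i (x $ i))" for x j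
  proof -
    have "frechet_derivative ?u (at x) (axis j 1) = (\<Sum>i\<in>UNIV. (deriv (f i) (x $ i) * (axis j 1 $ i)) * (\<Prod>j\<in>UNIV - {i}. f j (x $ j)))"
      by (simp only: frechet_derivative_at[OF d[of x], symmetric])
    also have "\<dots> = (\<Sum>i\<in>{j}. (deriv (f i) (x $ i) * (axis j 1 $ i)) * (\<Prod>j\<in>UNIV - {i}. f j (x $ j)))"
      by (intro sum.mono_neutral_right) (auto simp: axis_def)
    also have "\<dots> = (\<Prod>i\<in>UNIV. (f(j := deriv (f j))) i (x $ i))"
      by (subst prod.remove[of _ j]) (auto simp: axis_def intro!: prod.cong)
    finally show ?thesis .
  qed
  have "C_class m (\<lambda>x. \<Prod>i\<in>UNIV. (f(j := deriv (f j))) i (x $ i))" for j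
    using D(2) ck_on_pred[OF Suc.prems] by (intro Suc.IH) simp
  then show ?case using d by (auto simp: fd differentiable_def)
qed

lemma prod_in_Cc_infinity:
  fixes f :: "'n::finite \<Rightarrow> real \<Rightarrow> real"
  assumes ck: "\<And>m i. ck_on m UNIV (f i)"
    and supp: "\<And>i t. f i t \<noteq> 0 \<Longrightarrow> l i \<le> t \<and> t \<le> r i" and pos: "l k > 0"
  shows "(\<lambda>x::real^'n. \<Prod>i\<in>UNIV. f i (x $ i)) \<in> Cc_infinity (half_space k)"
proof -
  let ?u = "\<lambda>x::real^'n. \<Prod>i\<in>UNIV. f i (x $ i)"
  have "support_on UNIV ?u \<subseteq> cbox (\<chi> i. l i) (\<chi> i. r i)"
    using supp by (auto simp: support_on_def mem_box_cart)
  then have sub: "closure (support_on UNIV ?u) \<subseteq> cbox (\<chi> i. l i) (\<chi> i. r i)"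
    by (rule closure_minimal) (rule closed_cbox)
  then have "compact (closure (support_on UNIV ?u))"
    by (simp add: compact_eq_bounded_closed bounded_subset[OF bounded_cbox sub])
  moreover have "cbox (\<chi> i. l i) (\<chi> i. r i) \<subseteq> half_space k"
    using pos by (auto simp: half_space_def mem_box_cart intro: less_le_trans)
  ultimately show ?thesis
    using sub C_class_prod[OF ck] by (auto simp: Cc_infinity_def smooth_def)
qed

section \<open>Near-optimizers on the half-line\<close>

lemma slice_const_1: "\<alpha> > 0 \<Longrightarrow> slice_const 1 \<alpha> = 1"
proof -
  assume "\<alpha> > 0"
  then have "Gamma ((1 + \<alpha>) / 2) \<noteq> 0" by (intro less_imp_neq[THEN not_sym] Gamma_real_pos) simp
  then show ?thesis by (simp add: slice_const_def)
qed

text \<open>Any small exponent would do; with \<open>1 / 4\<close> the Beta integral in \<open>log_mass_bound\<close> converges for all \<open>\<alpha> > 0\<close>.\<close>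
lemma ln_square_le:
  fixes r :: real
  assumes "0 < r" "r < 1"
  shows "(ln r)\<^sup>2 \<le> 64 * r powr (- (1 / 4)) * (1 - r)\<^sup>2"
proof -
  define x where "x = r powr (- (1 / 8))"
  have "ln x \<le> x - 1" using assms by (intro ln_le_minus_one) (simp add: x_def)
  then have "- ln r \<le> 8 * (x - 1)" using assms by (simp add: x_def ln_powr)
  also have "x - 1 \<le> x * (1 - r)"
  proof -
    have "x * r = r powr (7 / 8)" using assms powr_add[of r "- (1 / 8)" 1] by (simp add: x_def)
    also have "\<dots> \<le> 1" using assms by (intro powr_le1) auto
    finally show ?thesis by (simp add: right_diff_distrib)
  qed
  finally have "(- ln r)\<^sup>2 \<le> (8 * (x * (1 - r)))\<^sup>2" using assms by (intro power_mono) auto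
  also have "\<dots> = 64 * (x\<^sup>2) * (1 - r)\<^sup>2" by (simp add: power_mult_distrib)
  also have "x\<^sup>2 = r powr (- (1 / 4))" by (simp add: x_def power2_eq_square flip: powr_add)
  finally show ?thesis by simp
qed

lemma nn_integral_inverse_Icc:
  assumes "0 < a" "a \<le> b"
  shows "(\<integral>\<^sup>+x. ennreal (1 / x) * indicator {a..b} x \<partial>lborel) = ennreal (ln b - ln a)"
  using assms by (intro nn_integral_FTC_Icc) (auto intro!: derivative_eq_intros)

text \<open>The double zero of (ln r)^2 at r = 1 lowers the singularity to (1 - r)^(1 - \<alpha>),
  so in contrast to \<open>far_weighted_mass\<close> the bound is uniform in q.\<close>

lemma (in stable_half_space) log_mass_bound:
  assumes q: "q > 1"
  shows "(\<integral>\<^sup>+r. ennreal (half_line_weight \<alpha> r * (ln r)\<^sup>2) * ennreal (\<bar>1 - r\<bar> powr (- (1 + \<alpha>))) * indicator {r. far_apart q 1 r} r \<partial>lborel)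
    \<le> ennreal (128 * Beta ((\<alpha> - 1) / 2 + 3 / 4) (2 - \<alpha>))"
proof -
  \<comment> \<open>The exponent of r is (\<alpha> - 1) / 2 from the weight and -1/4 from
    \<open>ln_square_le\<close>, and b - 1 is their sum. The constant 128 is the 64 of that lemma,
    doubled because the folded half contributes equally.\<close>
  define b where "b = (\<alpha> - 1) / 2 + 3 / 4"
  let ?g = "\<lambda>r::real. r powr (b - 1) * (1 - r) powr ((2 - \<alpha>) - 1)"
  have b: "b > 0" using \<alpha> by (simp add: b_def field_simps)
  have I: "(\<integral>\<^sup>+r. ennreal (128 * ?g r) * indicator {0..1} r \<partial>lborel) = ennreal (128 * Beta b (2 - \<alpha>))"
    using b \<alpha> by (intro nn_integral_has_integral_lebesgue' has_integral_mult_right has_integral_Beta_real) auto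
  have "(\<integral>\<^sup>+r. ennreal (half_line_weight \<alpha> r * (ln r)\<^sup>2) * ennreal (\<bar>1 - r\<bar> powr (- (1 + \<alpha>))) * indicator {r. far_apart q 1 r} r \<partial>lborel)
     = 0 + (\<integral>\<^sup>+r. (ennreal (half_line_weight \<alpha> r * (ln r)\<^sup>2) * ennreal (\<bar>1 - r\<bar> powr (- (1 + \<alpha>)))
       + ennreal (half_line_weight \<alpha> (1 / r) * (ln (1 / r))\<^sup>2) * ennreal (\<bar>1 - 1 / r\<bar> powr (- (1 + \<alpha>))) * ennreal (1 / r\<^sup>2)) * indicator {0<..1 / q} r \<partial>lborel)"
    by (subst nn_integral_far_apart_split[OF _ q])
       (auto intro!: nn_integral_zero' simp: half_line_weight_def indicator_def)
  also have "\<dots> \<le> (\<integral>\<^sup>+r. ennreal (128 * ?g r) * indicator {0..1} r \<partial>lborel)"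
    unfolding add_0_left
  proof (intro nn_integral_mono)
    fix r :: real
    show "(ennreal (half_line_weight \<alpha> r * (ln r)\<^sup>2) * ennreal (\<bar>1 - r\<bar> powr (- (1 + \<alpha>)))
       + ennreal (half_line_weight \<alpha> (1 / r) * (ln (1 / r))\<^sup>2) * ennreal (\<bar>1 - 1 / r\<bar> powr (- (1 + \<alpha>))) * ennreal (1 / r\<^sup>2)) * indicator {0<..1 / q} r
      \<le> ennreal (128 * ?g r) * indicator {0..1} r"
    proof (cases "r \<in> {0<..1 / q}")
      case True
      have "1 / q < 1" using q by simp
      then have r: "0 < r" "r < 1" using True by auto
      define Y where "Y = (1 - r) powr (- (1 + \<alpha>))"
      have "(1 / r) powr ((\<alpha> - 1) / 2) * r powr (\<alpha> - 1) = r powr (- ((\<alpha> - 1) / 2)) * r powr (\<alpha> - 1)"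
        using r by (simp add: powr_minus_divide powr_divide)
      also have "\<dots> = r powr ((\<alpha> - 1) / 2)" unfolding powr_add[symmetric] by (simp add: field_simps)
      finally have pw: "(1 / r) powr ((\<alpha> - 1) / 2) * (\<bar>1 - 1 / r\<bar> powr (- (1 + \<alpha>)) * (1 / r\<^sup>2)) = r powr ((\<alpha> - 1) / 2) * Y"
        unfolding kernel_inversion[OF \<alpha> r] by (simp add: mult.assoc[symmetric] Y_def)
      have "(half_line_weight \<alpha> (1 / r) * (ln (1 / r))\<^sup>2) * \<bar>1 - 1 / r\<bar> powr (- (1 + \<alpha>)) * (1 / r\<^sup>2)
         = (ln r)\<^sup>2 * ((1 / r) powr ((\<alpha> - 1) / 2) * (\<bar>1 - 1 / r\<bar> powr (- (1 + \<alpha>)) * (1 / r\<^sup>2)))"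
        using r by (simp add: half_line_weight_def ln_div)
      also have "\<dots> = (ln r)\<^sup>2 * (r powr ((\<alpha> - 1) / 2) * Y)" unfolding pw ..
      finally have 1: "ennreal (half_line_weight \<alpha> (1 / r) * (ln (1 / r))\<^sup>2) * ennreal (\<bar>1 - 1 / r\<bar> powr (- (1 + \<alpha>))) * ennreal (1 / r\<^sup>2)
         = ennreal ((ln r)\<^sup>2 * (r powr ((\<alpha> - 1) / 2) * Y))"
        by (subst ennreal_mult''[symmetric], simp)+ (simp only:)
      have 2: "ennreal (half_line_weight \<alpha> r * (ln r)\<^sup>2) * ennreal (\<bar>1 - r\<bar> powr (- (1 + \<alpha>))) = ennreal ((ln r)\<^sup>2 * (r powr ((\<alpha> - 1) / 2) * Y))"
        using r by (subst ennreal_mult''[symmetric]) (simp_all add: half_line_weight_def Y_def ac_simps)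
      have "(ln r)\<^sup>2 * (r powr ((\<alpha> - 1) / 2) * Y) \<le> 64 * r powr (- (1 / 4)) * (1 - r)\<^sup>2 * (r powr ((\<alpha> - 1) / 2) * Y)"
        using ln_square_le[OF r] by (intro mult_right_mono) (auto simp: Y_def)
      also have "\<dots> = 64 * ((r powr (- (1 / 4)) * r powr ((\<alpha> - 1) / 2)) * ((1 - r) powr 2 * Y))"
        using r by simp
      also have "r powr (- (1 / 4)) * r powr ((\<alpha> - 1) / 2) = r powr (b - 1)"
        unfolding powr_add[symmetric] by (simp add: b_def)
      also have "(1 - r) powr 2 * Y = (1 - r) powr ((2 - \<alpha>) - 1)"
        unfolding Y_def powr_add[symmetric] by simp
      finally have 3: "(ln r)\<^sup>2 * (r powr ((\<alpha> - 1) / 2) * Y) \<le> 64 * ?g r" .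
      have "0 \<le> (ln r)\<^sup>2 * (r powr ((\<alpha> - 1) / 2) * Y)" by (simp add: Y_def)
      then have "ennreal ((ln r)\<^sup>2 * (r powr ((\<alpha> - 1) / 2) * Y)) + ennreal ((ln r)\<^sup>2 * (r powr ((\<alpha> - 1) / 2) * Y)) \<le> ennreal (128 * ?g r)"
      proof -
        have "ennreal z + ennreal z \<le> ennreal (128 * g)" if "0 \<le> z" "z \<le> 64 * g" for z g :: real
          using that by (subst ennreal_plus[symmetric]) (auto intro!: ennreal_leI)
        from this[OF \<open>0 \<le> _\<close> 3] show ?thesis .
      qed
      then show ?thesis unfolding 1 2 using True r by simp
    qed simp
  qed
  also note I
  finally show ?thesis unfolding b_def .
qed

definition log_bump :: "real \<Rightarrow> real \<Rightarrow> real" where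
  "log_bump n s = bump (ln s / n)"

text \<open>Divided by the weight, this varies only in ln s, with slope of order 1/n over a range of
  length 2n. A squared slope 1/n^2 over a length of order n leaves a remainder of order 1/n.\<close>

definition near_optimizer :: "real \<Rightarrow> real \<Rightarrow> real \<Rightarrow> real" where
  "near_optimizer \<alpha> n s = half_line_weight \<alpha> s * log_bump n s"

lemma measurable_bump [measurable]: "bump \<in> borel_measurable borel"
  using ck_on_bump[of 0] by (simp add: borel_measurable_continuous_onI)

lemma measurable_log_bump [measurable]: "log_bump n \<in> borel_measurable borel"
  unfolding log_bump_def[abs_def] by measurable

lemma measurable_near_optimizer [measurable]: "near_optimizer \<alpha> n \<in> borel_measurable borel"
  unfolding near_optimizer_def[abs_def] by measurable

lemma log_bump_support:
  assumes "s > 0" "n > 0" "log_bump n s \<noteq> 0" shows "s \<in> {exp (- n)..exp n}"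
proof -
  have "\<bar>ln s / n\<bar> < 1" using assms(3) bump_eq_0[of "ln s / n"] by (force simp: log_bump_def)
  then have "- n < ln s" "ln s < n" using assms(2) by (auto simp: abs_less_iff field_simps)
  then have "exp (- n) \<le> exp (ln s)" "exp (ln s) \<le> exp n" by simp_all
  then show ?thesis using assms(1) by simp
qed

lemma near_optimizer_support:
  assumes "n > 0" "near_optimizer \<alpha> n s \<noteq> 0" shows "exp (- n) \<le> s \<and> s \<le> exp n"
  using assms log_bump_support[of s n] by (auto simp: near_optimizer_def half_line_weight_def split: if_splits)

text \<open>The formula is smooth for s > 0, and the function vanishes identically for s < exp (-n).
  These two overlapping open sets cover the line, so nothing has to be checked at 0.\<close>

lemma ck_on_near_optimizer:
  assumes n: "n > 0" shows "ck_on m UNIV (near_optimizer \<alpha> n)"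
proof -
  have "ck_on m {0<..} (\<lambda>s. s powr ((\<alpha> - 1) / 2) * bump ((1 / n) * ln s))"
    by (intro ck_on_mult ck_on_powr ck_on_compose[OF _ ck_on_bump] ck_on_const ck_on_ln) auto
  then have 1: "ck_on m {0<..} (near_optimizer \<alpha> n)"
    by (rule ck_on_cong[rotated 2]) (auto simp: near_optimizer_def half_line_weight_def log_bump_def)
  have 2: "ck_on m {..<exp (- n)} (near_optimizer \<alpha> n)"
    by (rule ck_on_cong[OF _ _ ck_on_const[of _ _ 0]]) (use near_optimizer_support[OF n] in force)+
  have "{0<..} \<union> {..<exp (- n)} = UNIV" by (auto, metis exp_gt_zero linorder_not_le order_less_le_trans not_le)
  then show ?thesis using ck_on_Un[OF _ _ 1 2] by simp
qed

text \<open>Unless both values vanish, at least one of the points lies in the support interval, so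
  the two indicators sum to at least 1. This brings the Lipschitz bound, squared to 16, into the
  symmetric form that \<open>hardy_weighted_sum\<close> can integrate.\<close>

lemma log_bump_diff_square:
  assumes "0 < s" "0 < t" and n: "n > 0"
  shows "(log_bump n s - log_bump n t)\<^sup>2 \<le> 16 / n\<^sup>2 * ((ln (t / s))\<^sup>2 * indicator {exp (- n)..exp n} s + (ln (s / t))\<^sup>2 * indicator {exp (- n)..exp n} t)"
proof (cases "log_bump n s = 0 \<and> log_bump n t = 0")
  case False
  have "\<bar>log_bump n s - log_bump n t\<bar> \<le> 4 * \<bar>ln s / n - ln t / n\<bar>"
    unfolding log_bump_def by (rule bump_lipschitz)
  then have "\<bar>log_bump n s - log_bump n t\<bar>\<^sup>2 \<le> (4 * \<bar>ln s / n - ln t / n\<bar>)\<^sup>2"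
    by (intro power_mono) auto
  also have "\<dots> = 16 / n\<^sup>2 * (ln s - ln t)\<^sup>2"
    by (simp add: power_mult_distrib power_divide flip: diff_divide_distrib)
  finally have *: "(log_bump n s - log_bump n t)\<^sup>2 \<le> 16 / n\<^sup>2 * (ln s - ln t)\<^sup>2" by simp
  have l: "(ln (t / s))\<^sup>2 = (ln s - ln t)\<^sup>2" "(ln (s / t))\<^sup>2 = (ln s - ln t)\<^sup>2"
    using assms by (simp_all add: ln_div power2_commute)
  have "s \<in> {exp (- n)..exp n} \<or> t \<in> {exp (- n)..exp n}"
    using False log_bump_support assms by blast
  then have "1 \<le> (indicator {exp (- n)..exp n} s + indicator {exp (- n)..exp n} t :: real)"
    by (auto simp: indicator_def)
  then have "16 / n\<^sup>2 * (ln s - ln t)\<^sup>2 * 1 \<le> 16 / n\<^sup>2 * (ln s - ln t)\<^sup>2 * (indicator {exp (- n)..exp n} s + indicator {exp (- n)..exp n} t)"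
    by (intro mult_left_mono) auto
  with * show ?thesis unfolding l by (simp add: distrib_left mult.assoc)
next
  case True
  then show ?thesis by (auto intro!: mult_nonneg_nonneg add_nonneg_nonneg)
qed

text \<open>In dimension one any two distinct points become far apart once q is close enough to 1,
  and on the diagonal both integrands are 0. The truncated integrands thus increase pointwise to the
  full one, and monotone convergence applies twice.\<close>

lemma stable_energy_eq_SUP:
  fixes u :: "real \<Rightarrow> real"
  assumes \<alpha>: "0 < \<alpha>" "\<alpha> < 2" and [measurable]: "u \<in> borel_measurable borel"
  shows "stable_energy \<alpha> u = (SUP n. stable_half_space.energy (1::real) \<alpha> (1 + 1 / real (Suc n)) u)"
proof -
  interpret stable_half_space "1::real" \<alpha> by unfold_locales (use \<alpha> in auto)
  let ?q = "\<lambda>n. 1 + 1 / real (Suc n)"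
  let ?g = "\<lambda>n x y. ennreal ((u x - u y)\<^sup>2) * trunc_kernel (1::real) \<alpha> (?q n) x y"
  have far_mono: "far_apart (?q n) s t \<Longrightarrow> far_apart (?q (Suc n)) s t" for n s t
  proof -
    have "?q (Suc n) \<le> ?q n" by (intro add_left_mono divide_left_mono) auto
    then have "s < ?q (Suc n) * t \<Longrightarrow> s < ?q n * t" "t < ?q (Suc n) * s \<Longrightarrow> t < ?q n * s" if "s > 0" "t > 0"
      using that mult_right_mono[of "?q (Suc n)" "?q n" t] mult_right_mono[of "?q (Suc n)" "?q n" s] by linarith+
    then show "far_apart (?q n) s t \<Longrightarrow> far_apart (?q (Suc n)) s t"
      unfolding far_apart_def by blast
  qed
  have inc: "?g n x y \<le> ?g (Suc n) x y" for n x y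
    using far_mono[of n x y] by (auto simp: trunc_kernel_def intro!: mult_left_mono)
  have incy: "incseq (\<lambda>n. ?g n x)" for x
    using inc by (intro incseq_SucI le_funI)
  have incx: "incseq (\<lambda>n x. \<integral>\<^sup>+y. ?g n x y \<partial>lborel)"
    using inc by (intro incseq_SucI le_funI nn_integral_mono)
  have ev: "\<exists>n. far_apart (?q n) x y" if "x \<noteq> y" for x y :: real
  proof (cases "0 < x \<and> 0 < y")
    case True
    define m M where "m = min x y" and "M = max x y"
    have mM: "0 < m" "m < M" using True that by (auto simp: m_def M_def)
    then have "0 < M / m - 1" by simp
    then obtain n where "1 / real (Suc n) < M / m - 1" using nat_approx_posE by blast
    then have "?q n * m < M" using mM by (simp add: field_simps)
    then have "far_apart (?q n) x y" using True by (auto simp: far_apart_def m_def M_def min_def max_def split: if_splits)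
    then show ?thesis ..
  qed (auto simp: far_apart_def)
  have lim: "ennreal ((u x - u y)\<^sup>2 / norm (x - y) powr (real DIM(real) + \<alpha>)) = (SUP n. ?g n x y)" for x y
  proof (cases "x = y")
    case False
    let ?v = "ennreal ((u x - u y)\<^sup>2) * ennreal (norm (x - y) powr (- (real DIM(real) + \<alpha>)))"
    have "(SUP n. ?g n x y) = ?v"
    proof (rule antisym)
      show "(SUP n. ?g n x y) \<le> ?v" by (rule SUP_least) (simp add: trunc_kernel_def)
      obtain n where "far_apart (?q n) x y" using ev[OF False] by blast
      then have "?v \<le> ?g n x y" by (simp add: trunc_kernel_def)
      then show "?v \<le> (SUP n. ?g n x y)" by (rule SUP_upper2[rotated]) simp
    qed
    then show ?thesis unfolding powr_minus by (simp add: divide_inverse ennreal_mult)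
  qed simp
  have "stable_energy \<alpha> u = (\<integral>\<^sup>+x. (SUP n. \<integral>\<^sup>+y. ?g n x y \<partial>lborel) \<partial>lborel)"
    unfolding stable_energy_def lim by (subst nn_integral_monotone_convergence_SUP[OF incy]) auto
  also have "\<dots> = (SUP n. energy (?q n) u)"
    unfolding energy_def by (rule nn_integral_monotone_convergence_SUP[OF incx]) measurable
  finally show ?thesis .
qed

lemma half_line_weight_square:
  assumes "s > 0" shows "(half_line_weight \<alpha> s)\<^sup>2 * s powr (- \<alpha>) = 1 / s"
proof -
  have "(s powr ((\<alpha> - 1) / 2))\<^sup>2 * s powr (- \<alpha>) = s powr (- 1)"
    by (simp add: power2_eq_square flip: powr_add)
  also have "\<dots> = 1 / s" using assms powr_minus_divide[of s 1] by simp
  finally show ?thesis using assms by (simp add: half_line_weight_def)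
qed

text \<open>The square of the weight times s^(-\<alpha>) is 1/s, so lengths are measured in ln s:
  the bump is at least exp (-4) on a logarithmic length n, and at most 1 on its support, of
  logarithmic length 2n.\<close>

lemma near_optimizer_hardy_integral:
  assumes \<alpha>: "0 < \<alpha>" "\<alpha> < 2" and n: "n > 0"
  shows "ennreal (exp (- 8) * n) \<le> (\<integral>\<^sup>+s. ennreal ((near_optimizer \<alpha> n s)\<^sup>2 * s powr (- \<alpha>)) \<partial>lborel)"
    and "(\<integral>\<^sup>+s. ennreal ((near_optimizer \<alpha> n s)\<^sup>2 * s powr (- \<alpha>)) \<partial>lborel) \<le> ennreal (2 * n)"
proof -
  have eq: "(near_optimizer \<alpha> n s)\<^sup>2 * s powr (- \<alpha>) = (log_bump n s)\<^sup>2 * (1 / s)" if "s > 0" for s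
    unfolding half_line_weight_square[OF that, of \<alpha>, symmetric]
    by (simp add: near_optimizer_def power_mult_distrib)
  have "ennreal (exp (- 8) * n) = ennreal (exp (- 8)) * (\<integral>\<^sup>+s. ennreal (1 / s) * indicator {exp (- (n / 2))..exp (n / 2)} s \<partial>lborel)"
    using n by (subst nn_integral_inverse_Icc) (auto simp: ennreal_mult)
  also have "\<dots> = (\<integral>\<^sup>+s. ennreal (exp (- 8)) * (ennreal (1 / s) * indicator {exp (- (n / 2))..exp (n / 2)} s) \<partial>lborel)"
    by (rule nn_integral_cmult[symmetric]) measurable
  also have "\<dots> \<le> (\<integral>\<^sup>+s. ennreal ((near_optimizer \<alpha> n s)\<^sup>2 * s powr (- \<alpha>)) \<partial>lborel)"
  proof (intro nn_integral_mono)
    fix s :: real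
    show "ennreal (exp (- 8)) * (ennreal (1 / s) * indicator {exp (- (n / 2))..exp (n / 2)} s) \<le> ennreal ((near_optimizer \<alpha> n s)\<^sup>2 * s powr (- \<alpha>))"
    proof (cases "s \<in> {exp (- (n / 2))..exp (n / 2)}")
      case True
      then have s: "s > 0" by (auto intro: less_le_trans[OF exp_gt_zero])
      have "- (n / 2) \<le> ln s" "ln s \<le> n / 2"
        using True s ln_mono[of "exp (- (n / 2))" s] ln_mono[of s "exp (n / 2)"] by auto
      then have "\<bar>ln s / n\<bar> \<le> 1 / 2" using n by (auto simp: abs_le_iff field_simps)
      then have "(exp (- 4))\<^sup>2 \<le> (log_bump n s)\<^sup>2" unfolding log_bump_def by (intro power_mono bump_ge) auto
      then have "exp (- 8) \<le> (log_bump n s)\<^sup>2" by (simp flip: exp_double)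
      then have "exp (- 8) * (1 / s) \<le> (log_bump n s)\<^sup>2 * (1 / s)" using s by (intro mult_right_mono) auto
      then show ?thesis using True s unfolding eq[OF s] by (simp flip: ennreal_mult)
    qed simp
  qed
  finally show "ennreal (exp (- 8) * n) \<le> (\<integral>\<^sup>+s. ennreal ((near_optimizer \<alpha> n s)\<^sup>2 * s powr (- \<alpha>)) \<partial>lborel)" .
  have "(\<integral>\<^sup>+s. ennreal ((near_optimizer \<alpha> n s)\<^sup>2 * s powr (- \<alpha>)) \<partial>lborel) \<le> (\<integral>\<^sup>+s. ennreal (1 / s) * indicator {exp (- n)..exp n} s \<partial>lborel)"
  proof (intro nn_integral_mono)
    fix s :: real
    show "ennreal ((near_optimizer \<alpha> n s)\<^sup>2 * s powr (- \<alpha>)) \<le> ennreal (1 / s) * indicator {exp (- n)..exp n} s"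
    proof (cases "near_optimizer \<alpha> n s = 0")
      case False
      with near_optimizer_support[OF n False] have s: "s > 0" "s \<in> {exp (- n)..exp n}" by (auto simp: near_optimizer_def half_line_weight_def split: if_splits)
      have "(log_bump n s)\<^sup>2 \<le> 1" unfolding log_bump_def by (simp add: power_le_one bump_bounds)
      then have "(log_bump n s)\<^sup>2 * (1 / s) \<le> 1 / s" using s by (intro mult_left_le_one_le) auto
      then show ?thesis using s(2) unfolding eq[OF s(1)] by (simp add: ennreal_leI)
    qed simp
  qed
  also have "\<dots> = ennreal (2 * n)"
    using n by (subst nn_integral_inverse_Icc) auto
  finally show "(\<integral>\<^sup>+s. ennreal ((near_optimizer \<alpha> n s)\<^sup>2 * s powr (- \<alpha>)) \<partial>lborel) \<le> ennreal (2 * n)" .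
qed

lemma near_optimizer_energy:
  assumes \<alpha>: "0 < \<alpha>" "\<alpha> < 2" and n: "n > 0"
  shows "stable_energy \<alpha> (near_optimizer \<alpha> n)
    \<le> ennreal (2 * hardy_const \<alpha>) * (\<integral>\<^sup>+s. ennreal ((near_optimizer \<alpha> n s)\<^sup>2 * s powr (- \<alpha>)) \<partial>lborel)
      + ennreal (8192 * Beta ((\<alpha> - 1) / 2 + 3 / 4) (2 - \<alpha>) / n)"
proof -
  interpret stable_half_space "1::real" \<alpha> by unfold_locales (use \<alpha> in auto)
  let ?u = "near_optimizer \<alpha> n"
  let ?B = "Beta ((\<alpha> - 1) / 2 + 3 / 4) (2 - \<alpha>)"
  let ?I = "{exp (- n)..exp n}"
  have c1: "slice_const DIM(real) \<alpha> = 1" using slice_const_1[OF \<alpha>(1)] by simp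
  have B: "?B \<ge> 0"
    by (rule has_integral_nonneg[OF has_integral_Beta_real]) (use \<alpha> in \<open>auto simp: field_simps\<close>)
  have u0: "?u x = 0" if "x \<bullet> 1 \<le> 0" for x using that by (simp add: near_optimizer_def half_line_weight_def)
  have H: "hardy_integral ?u = (\<integral>\<^sup>+s. ennreal ((?u s)\<^sup>2 * s powr (- \<alpha>)) \<partial>lborel)"
    by (simp add: hardy_integral_def)
  have Hfin: "hardy_integral ?u < \<infinity>"
    unfolding H using near_optimizer_hardy_integral(2)[OF \<alpha> n] by (rule order_le_less_trans) simp
  \<comment> \<open>The weight with a sharp cutoff absorbs the indicators of
    \<open>log_bump_diff_square\<close>. It need not be smooth, and its Hardy integral is computed
    exactly.\<close>
  define v where "v s = half_line_weight \<alpha> s * indicator ?I s" for s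
  have [measurable]: "v \<in> borel_measurable borel" unfolding v_def[abs_def] by measurable
  have Hv: "hardy_integral v = ennreal (2 * n)"
  proof -
    have "hardy_integral v = (\<integral>\<^sup>+s. ennreal (1 / s) * indicator ?I s \<partial>lborel)"
      unfolding hardy_integral_def
    proof (intro nn_integral_cong)
      fix s :: real
      show "ennreal ((v s)\<^sup>2 * (s \<bullet> 1) powr (- \<alpha>)) = ennreal (1 / s) * indicator ?I s"
      proof (cases "s \<in> ?I")
        case True
        then have s: "s > 0" by (auto intro: less_le_trans[OF exp_gt_zero])
        then show ?thesis using True half_line_weight_square[OF s, of \<alpha>] by (simp add: v_def)
      qed (simp add: v_def)
    qed
    also have "\<dots> = ennreal (2 * n)" using n by (subst nn_integral_inverse_Icc) auto
    finally show ?thesis .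
  qed
  \<comment> \<open>Uniform in q, so the bound survives the supremum over truncations. The constant
    is 16 * 2 * 128 * 2, and 1/n^2 against the mass 2n of v leaves 1/n.\<close>
  have R: "remainder q ?u \<le> ennreal (8192 * ?B / n)" if q: "q > 1" for q
  proof -
    let ?h = "\<lambda>r. half_line_weight \<alpha> r * (ln r)\<^sup>2"
    have "remainder q ?u \<le> (\<integral>\<^sup>+x. \<integral>\<^sup>+y. ennreal (16 / n\<^sup>2) * (ennreal ((v x)\<^sup>2 * ?h ((y \<bullet> 1) / (x \<bullet> 1)) + (v y)\<^sup>2 * ?h ((x \<bullet> 1) / (y \<bullet> 1))) * trunc_kernel 1 \<alpha> q x y) \<partial>lborel \<partial>lborel)"
      unfolding remainder_def
    proof (intro nn_integral_mono)
      fix x y :: real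
      have "w x * w y * (?u x / w x - ?u y / w y)\<^sup>2 \<le> 16 / n\<^sup>2 * ((v x)\<^sup>2 * ?h (y / x) + (v y)\<^sup>2 * ?h (x / y))"
      proof (cases "x > 0 \<and> y > 0")
        case True
        then have xy: "x > 0" "y > 0" by auto
        then have wpos: "w x > 0" "w y > 0" by (auto simp: half_line_weight_def)
        have d: "?u x / w x = log_bump n x" "?u y / w y = log_bump n y" using wpos by (simp_all add: near_optimizer_def)
        \<comment> \<open>Multiplicativity of the weight rewrites the symmetric factor w x * w y as
          a square at one point times a function of the ratio.\<close>
        have hw: "(w x)\<^sup>2 * half_line_weight \<alpha> (y / x) = w x * w y" "(w y)\<^sup>2 * half_line_weight \<alpha> (x / y) = w x * w y"
          using wpos unfolding half_line_weight_divide[OF xy(1), symmetric] half_line_weight_divide[OF xy(2), symmetric]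
          by (simp_all add: power2_eq_square)
        have "w x * w y * (log_bump n x - log_bump n y)\<^sup>2 \<le> w x * w y * (16 / n\<^sup>2 * ((ln (y / x))\<^sup>2 * indicator ?I x + (ln (x / y))\<^sup>2 * indicator ?I y))"
          using wpos by (intro mult_left_mono log_bump_diff_square xy n) auto
        also have "\<dots> = 16 / n\<^sup>2 * ((w x * w y) * (ln (y / x))\<^sup>2 * indicator ?I x + (w x * w y) * (ln (x / y))\<^sup>2 * indicator ?I y)"
          by (simp add: algebra_simps)
        also have "(w x * w y) * (ln (y / x))\<^sup>2 * indicator ?I x = (v x)\<^sup>2 * ?h (y / x)"
          unfolding hw(1)[symmetric] by (simp add: v_def indicator_def power_mult_distrib)
        also have "(w x * w y) * (ln (x / y))\<^sup>2 * indicator ?I y = (v y)\<^sup>2 * ?h (x / y)"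
          unfolding hw(2)[symmetric] by (simp add: v_def indicator_def power_mult_distrib)
        finally show ?thesis unfolding d .
      next
        case False
        then have "w x * w y = 0" by (auto simp: half_line_weight_def)
        then show ?thesis by (auto intro!: add_nonneg_nonneg mult_nonneg_nonneg)
      qed
      then have "ennreal (w x * w y * (?u x / w x - ?u y / w y)\<^sup>2)
        \<le> ennreal (16 / n\<^sup>2) * ennreal ((v x)\<^sup>2 * ?h (y / x) + (v y)\<^sup>2 * ?h (x / y))"
        by (subst ennreal_mult'[symmetric], simp, intro ennreal_leI)
      then show "ennreal (w x * w y * (?u x / w x - ?u y / w y)\<^sup>2) * trunc_kernel 1 \<alpha> q x y \<le>
        ennreal (16 / n\<^sup>2) * (ennreal ((v x)\<^sup>2 * ?h ((y \<bullet> 1) / (x \<bullet> 1)) + (v y)\<^sup>2 * ?h ((x \<bullet> 1) / (y \<bullet> 1))) * trunc_kernel 1 \<alpha> q x y)"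
        unfolding inner_real_def mult_1_right mult.assoc[of "ennreal (16 / n\<^sup>2)", symmetric]
        by (rule mult_right_mono) simp
    qed
    also have "\<dots> = ennreal (16 / n\<^sup>2) * (\<integral>\<^sup>+x. \<integral>\<^sup>+y. ennreal ((v x)\<^sup>2 * ?h ((y \<bullet> 1) / (x \<bullet> 1)) + (v y)\<^sup>2 * ?h ((x \<bullet> 1) / (y \<bullet> 1))) * trunc_kernel 1 \<alpha> q x y \<partial>lborel \<partial>lborel)"
      by (subst nn_integral_cmult[symmetric], measurable, intro nn_integral_cong, rule nn_integral_cmult, measurable)
    also have "\<dots> \<le> ennreal (16 / n\<^sup>2) * (2 * (ennreal (slice_const DIM(real) \<alpha>) * ennreal (128 * ?B) * ennreal (2 * n)))"
    proof -
      have "?h \<in> borel_measurable borel" "v \<in> borel_measurable borel" by measurable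
      moreover have "\<And>r. ?h r \<ge> 0" by simp
      moreover have "v x = 0" if "x \<bullet> 1 \<le> 0" for x using that by (simp add: v_def half_line_weight_def)
      ultimately show ?thesis unfolding Hv[symmetric]
        by (subst hardy_weighted_sum) (assumption | intro mult_left_mono mult_right_mono log_mass_bound q zero_le)+
    qed
    also have "\<dots> = ennreal (16 / n\<^sup>2 * (2 * (1 * (128 * ?B) * (2 * n))))"
      using n B unfolding c1 by (simp flip: ennreal_mult ennreal_numeral)
    also have "16 / n\<^sup>2 * (2 * (1 * (128 * ?B) * (2 * n))) = 8192 * ?B / n"
      using n by (simp add: power2_eq_square field_simps)
    finally show ?thesis .
  qed
  show ?thesis unfolding stable_energy_eq_SUP[OF \<alpha> measurable_near_optimizer]
  proof (rule SUP_least)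
    fix i :: nat
    have q: "1 + 1 / real (Suc i) > 1" by simp
    have "energy (1 + 1 / real (Suc i)) ?u = 2 * (ennreal (slice_const DIM(real) \<alpha>) * hardy_trunc \<alpha> (1 + 1 / real (Suc i)) * hardy_integral ?u) + remainder (1 + 1 / real (Suc i)) ?u"
      using u0 Hfin by (intro energy_eq q) auto
    also have "\<dots> \<le> 2 * (ennreal (slice_const DIM(real) \<alpha>) * ennreal (hardy_const \<alpha>) * hardy_integral ?u) + ennreal (8192 * ?B / n)"
      by (intro add_mono mult_left_mono mult_right_mono hardy_trunc_le[OF \<alpha> q] R q) auto
    also have "2 * (ennreal (slice_const DIM(real) \<alpha>) * ennreal (hardy_const \<alpha>) * hardy_integral ?u) = ennreal (2 * hardy_const \<alpha>) * hardy_integral ?u"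
      unfolding c1 by (simp add: ennreal_mult' mult.assoc)
    finally show "energy (1 + 1 / real (Suc i)) ?u \<le> ennreal (2 * hardy_const \<alpha>) * (\<integral>\<^sup>+s. ennreal ((?u s)\<^sup>2 * s powr (- \<alpha>)) \<partial>lborel) + ennreal (8192 * ?B / n)"
      unfolding H .
  qed
qed

section \<open>Products with wide bumps\<close>

lemma exists_near_optimizer:
  assumes \<alpha>: "0 < \<alpha>" "\<alpha> < 2" and \<epsilon>: "\<epsilon> > (0::real)"
  obtains n where "n > 0" "stable_energy \<alpha> (near_optimizer \<alpha> n)
    \<le> ennreal (2 * hardy_const \<alpha> + \<epsilon>) * (\<integral>\<^sup>+s. ennreal ((near_optimizer \<alpha> n s)\<^sup>2 * s powr (- \<alpha>)) \<partial>lborel)"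
proof -
  define b where "b = 8192 * Beta ((\<alpha> - 1) / 2 + 3 / 4) (2 - \<alpha>)"
  have "Beta ((\<alpha> - 1) / 2 + 3 / 4) (2 - \<alpha>) \<ge> 0"
    by (rule has_integral_nonneg[OF has_integral_Beta_real]) (use \<alpha> in \<open>auto simp: field_simps\<close>)
  then have b: "b \<ge> 0" by (simp add: b_def)
  \<comment> \<open>The error b / n must be at most \<epsilon> times the lower bound exp (-8) * n of
    the Hardy integral, that is n^2 \<ge> b * exp 8 / \<epsilon>. The summand 1 gives n \<le>
    n^2.\<close>
  define n where "n = 1 + b * exp 8 / \<epsilon>"
  have n: "n \<ge> 1" using b \<epsilon> by (simp add: n_def)
  have "b * exp 8 / \<epsilon> \<le> n * 1" by (simp add: n_def)
  also have "\<dots> \<le> n * n" using n by (intro mult_left_mono) auto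
  finally have "b / n \<le> \<epsilon> * (exp (- 8) * n)"
    using n \<epsilon> by (simp add: field_simps exp_minus)
  then have "ennreal (b / n) \<le> ennreal \<epsilon> * ennreal (exp (- 8) * n)"
    using \<epsilon> n by (simp add: ennreal_leI flip: ennreal_mult)
  also have "\<dots> \<le> ennreal \<epsilon> * (\<integral>\<^sup>+s. ennreal ((near_optimizer \<alpha> n s)\<^sup>2 * s powr (- \<alpha>)) \<partial>lborel)"
    using n by (intro mult_left_mono near_optimizer_hardy_integral[OF \<alpha>]) auto
  finally have "stable_energy \<alpha> (near_optimizer \<alpha> n)
    \<le> ennreal (2 * hardy_const \<alpha>) * (\<integral>\<^sup>+s. ennreal ((near_optimizer \<alpha> n s)\<^sup>2 * s powr (- \<alpha>)) \<partial>lborel)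
      + ennreal \<epsilon> * (\<integral>\<^sup>+s. ennreal ((near_optimizer \<alpha> n s)\<^sup>2 * s powr (- \<alpha>)) \<partial>lborel)"
    using near_optimizer_energy[OF \<alpha>, of n] n unfolding b_def[symmetric]
    by (meson add_left_mono order_trans less_le_trans zero_less_one)
  also have "\<dots> = ennreal (2 * hardy_const \<alpha> + \<epsilon>) * (\<integral>\<^sup>+s. ennreal ((near_optimizer \<alpha> n s)\<^sup>2 * s powr (- \<alpha>)) \<partial>lborel)"
  proof -
    have "hardy_const \<alpha> \<ge> 0" unfolding hardy_const_def
      using \<alpha> by (intro divide_nonneg_pos mult_nonneg_nonneg mult_pos_pos less_imp_le[OF Gamma_real_pos] Gamma_real_pos) auto
    then show ?thesis using \<epsilon> by (simp add: distrib_right)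
  qed
  finally show ?thesis using that[of n] n by simp
qed

lemma nn_integral_prod_vec:
  fixes f :: "'n::finite \<Rightarrow> real \<Rightarrow> ennreal"
  assumes [measurable]: "\<And>i. f i \<in> borel_measurable borel"
  shows "(\<integral>\<^sup>+x. (\<Prod>i\<in>UNIV. f i (x $ i)) \<partial>(lborel :: (real^'n) measure)) = (\<Prod>i\<in>UNIV. (\<integral>\<^sup>+t. f i t \<partial>lborel))"
proof -
  \<comment> \<open>The product formula runs over basis vectors; \<open>g\<close> recovers the index
    from the vector.\<close>
  define g :: "real^'n \<Rightarrow> 'n" where "g b = (THE i. b = axis i 1)" for b
  have inj: "inj (\<lambda>i::'n. axis i (1::real))" by (auto simp: inj_on_def axis_eq_axis)
  have g: "g (axis i 1) = i" for i by (simp add: g_def axis_eq_axis)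
  have B: "(Basis :: (real^'n) set) = range (\<lambda>i. axis i 1)" by (auto simp: Basis_vec_def)
  have "(\<integral>\<^sup>+x. (\<Prod>b\<in>Basis. f (g b) (x \<bullet> b)) \<partial>(lborel :: (real^'n) measure)) = (\<Prod>b\<in>(Basis :: (real^'n) set). (\<integral>\<^sup>+t. f (g b) t \<partial>lborel))"
    by (rule nn_integral_lborel_prod) auto
  then show ?thesis unfolding B by (simp add: prod.reindex[OF inj] g inner_axis o_def)
qed

lemma nn_integral_vec_split:
  fixes k :: "'n::finite" and G h :: "real \<Rightarrow> ennreal"
  assumes [measurable]: "G \<in> borel_measurable borel" "h \<in> borel_measurable borel"
  shows "(\<integral>\<^sup>+x. G (x $ k) * (\<Prod>i\<in>UNIV - {k}. h (x $ i)) \<partial>(lborel :: (real^'n) measure))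
    = (\<integral>\<^sup>+t. G t \<partial>lborel) * (\<integral>\<^sup>+t. h t \<partial>lborel) ^ (CARD('n) - 1)"
proof -
  define f where "f i = (if i = k then G else h)" for i
  have [measurable]: "f i \<in> borel_measurable borel" for i by (simp add: f_def)
  have "(\<integral>\<^sup>+x. (\<Prod>i\<in>UNIV. f i (x $ i)) \<partial>(lborel :: (real^'n) measure)) = (\<Prod>i\<in>UNIV. (\<integral>\<^sup>+t. f i t \<partial>lborel))"
    by (rule nn_integral_prod_vec) measurable
  moreover have "(\<Prod>i\<in>UNIV. f i (x $ i)) = G (x $ k) * (\<Prod>i\<in>UNIV - {k}. h (x $ i))" for x :: "real^'n"
    by (subst prod.remove[of _ k]) (auto simp: f_def intro!: prod.cong)
  moreover have "(\<Prod>i\<in>UNIV. (\<integral>\<^sup>+t. f i t \<partial>lborel)) = (\<integral>\<^sup>+t. G t \<partial>lborel) * (\<Prod>i\<in>UNIV - {k}. (\<integral>\<^sup>+t. h t \<partial>lborel))"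
    by (subst prod.remove[of _ k]) (auto simp: f_def intro!: prod.cong)
  ultimately show ?thesis by (simp add: card_Diff_singleton)
qed

text \<open>Used with i = k for the energy of the profile, and with the remaining coordinates for
  the cost of the cutoff.\<close>

lemma nn_integral_coordinate_kernel_centered:
  fixes x :: "real^'n" and G :: "real \<Rightarrow> ennreal"
  assumes [measurable]: "G \<in> borel_measurable borel" and \<alpha>: "\<alpha> > 0"
  shows "(\<integral>\<^sup>+y. G (y $ i) * ennreal (norm (x - y) powr (- (real CARD('n) + \<alpha>))) \<partial>lborel)
    = ennreal (slice_const CARD('n) \<alpha>) * (\<integral>\<^sup>+t. G t * ennreal (\<bar>x $ i - t\<bar> powr (- (1 + \<alpha>))) \<partial>lborel)"
proof -
  have e: "axis i 1 \<in> (Basis :: (real^'n) set)" by (auto simp: Basis_vec_def)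
  have "(\<integral>\<^sup>+y. G (y $ i) * ennreal (norm (x - y) powr (- (real CARD('n) + \<alpha>))) \<partial>lborel)
     = (\<integral>\<^sup>+z. G ((x + z) $ i) * ennreal (norm (x - (x + z)) powr (- (real CARD('n) + \<alpha>))) \<partial>lborel)"
    by (rule nn_integral_lborel_translate) measurable
  also have "\<dots> = (\<integral>\<^sup>+z. (\<lambda>t. G (x $ i + t)) (z \<bullet> axis i 1) * ennreal (norm z powr (- (real DIM(real^'n) + \<alpha>))) \<partial>(lborel :: (real^'n) measure))"
    by (simp add: inner_axis)
  also have "\<dots> = ennreal (slice_const DIM(real^'n) \<alpha>) * (\<integral>\<^sup>+t. G (x $ i + t) * ennreal (\<bar>t\<bar> powr (- (1 + \<alpha>))) \<partial>lborel)"
    by (rule nn_integral_coordinate_kernel[OF e _ \<alpha>]) measurable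
  also have "(\<integral>\<^sup>+t. G (x $ i + t) * ennreal (\<bar>t\<bar> powr (- (1 + \<alpha>))) \<partial>lborel)
    = (\<integral>\<^sup>+t. G t * ennreal (\<bar>x $ i - t\<bar> powr (- (1 + \<alpha>))) \<partial>lborel)"
    by (subst nn_integral_lborel_translate[of "\<lambda>t. G t * ennreal (\<bar>x $ i - t\<bar> powr (- (1 + \<alpha>)))" "x $ i"]) auto
  finally show ?thesis by simp
qed

section \<open>The energy cost of the cutoff in the other coordinates\<close>

text \<open>The factor 16 is the square of the Lipschitz constant in \<open>bump_lipschitz\<close>.\<close>
definition cap :: "real \<Rightarrow> real \<Rightarrow> real" where
  "cap R t = min 1 (16 * t\<^sup>2 / R\<^sup>2)"

lemma measurable_cap [measurable]: "cap R \<in> borel_measurable borel"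
  unfolding cap_def[abs_def] by measurable

lemma cap_nonneg [simp]: "cap R t \<ge> 0" by (simp add: cap_def)

definition cap_mass :: "real \<Rightarrow> real \<Rightarrow> ennreal" where
  "cap_mass \<alpha> R = (\<integral>\<^sup>+t. ennreal (cap R t) * ennreal (\<bar>t\<bar> powr (- (1 + \<alpha>))) \<partial>lborel)"

text \<open>\<open>cap R\<close> at R t equals \<open>cap 1\<close> at t, so t -> R t leaves only a
  Jacobian and a power. This is where the relative cost R^(-\<alpha>) of the cutoff comes
  from.\<close>

lemma cap_mass_scale:
  assumes "R > 0" shows "cap_mass \<alpha> R = ennreal (R powr (- \<alpha>)) * cap_mass \<alpha> 1"
proof -
  have "cap_mass \<alpha> R = ennreal \<bar>R\<bar> * (\<integral>\<^sup>+t. ennreal (cap R (0 + R * t)) * ennreal (\<bar>0 + R * t\<bar> powr (- (1 + \<alpha>))) \<partial>lborel)"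
    unfolding cap_mass_def using assms by (intro nn_integral_real_affine) auto
  also have "(\<integral>\<^sup>+t. ennreal (cap R (0 + R * t)) * ennreal (\<bar>0 + R * t\<bar> powr (- (1 + \<alpha>))) \<partial>lborel)
    = (\<integral>\<^sup>+t. ennreal (R powr (- (1 + \<alpha>))) * (ennreal (cap 1 t) * ennreal (\<bar>t\<bar> powr (- (1 + \<alpha>)))) \<partial>lborel)"
    using assms by (intro nn_integral_cong) (simp add: cap_def abs_mult powr_mult power_mult_distrib ennreal_mult ac_simps)
  also have "\<dots> = ennreal (R powr (- (1 + \<alpha>))) * cap_mass \<alpha> 1"
    unfolding cap_mass_def by (rule nn_integral_cmult) measurable
  also have "ennreal \<bar>R\<bar> * \<dots> = ennreal (R powr 1 * R powr (- (1 + \<alpha>))) * cap_mass \<alpha> 1"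
    using assms by (simp add: ennreal_mult mult.assoc)
  also have "R powr 1 * R powr (- (1 + \<alpha>)) = R powr (- \<alpha>)" unfolding powr_add[symmetric] by simp
  finally show ?thesis .
qed

text \<open>Near 0 the quadratic branch of the cap gives t^(1 - \<alpha>), integrable since \<alpha>
  < 2; at infinity the cap is 1 and the kernel decays integrably since \<alpha> > 0.\<close>

lemma cap_mass_finite:
  assumes \<alpha>: "0 < \<alpha>" "\<alpha> < 2" shows "cap_mass \<alpha> 1 < \<infinity>"
proof -
  define h where "h t = ennreal (16 * (t powr ((2 - \<alpha>) - 1) * (1 - t) powr (1 - 1))) * indicator {0..1} t
     + ennreal (t powr (- (1 + \<alpha>))) * indicator {1..} t" for t :: real
  have [measurable]: "h \<in> borel_measurable borel" unfolding h_def[abs_def] by measurable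
  have "(\<integral>\<^sup>+t. ennreal (16 * (t powr ((2 - \<alpha>) - 1) * (1 - t) powr (1 - 1))) * indicator {0..1} t \<partial>lborel) = ennreal (16 * Beta (2 - \<alpha>) 1)"
    using \<alpha> by (intro nn_integral_has_integral_lebesgue' has_integral_mult_right has_integral_Beta_real) auto
  then have h: "(\<integral>\<^sup>+t. h t \<partial>lborel) < \<infinity>"
    unfolding h_def using nn_integral_powr_tail[OF \<alpha>(1)] by (simp add: nn_integral_add)
  have "(\<integral>\<^sup>+t. h t \<partial>lborel) = (\<integral>\<^sup>+t. h (- t) \<partial>lborel)"
    using nn_integral_real_affine[of h "-1" 0] by simp
  then have "(\<integral>\<^sup>+t. h t + h (- t) \<partial>lborel) < \<infinity>" using h by (simp add: nn_integral_add)
  moreover have "cap_mass \<alpha> 1 \<le> (\<integral>\<^sup>+t. h t + h (- t) \<partial>lborel)"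
    unfolding cap_mass_def
  proof (intro nn_integral_mono)
    fix t :: real
    have pos: "ennreal (cap 1 t) * ennreal (\<bar>t\<bar> powr (- (1 + \<alpha>))) \<le> h t" if "t > 0" for t
    proof (cases "t < 1")
      case True
      have "16 * t\<^sup>2 * t powr (- (1 + \<alpha>)) = 16 * (t powr 2 * t powr (- (1 + \<alpha>)))" using that by simp
      also have "t powr 2 * t powr (- (1 + \<alpha>)) = t powr ((2 - \<alpha>) - 1)" unfolding powr_add[symmetric] by simp
      finally have "cap 1 t * t powr (- (1 + \<alpha>)) \<le> 16 * t powr ((2 - \<alpha>) - 1)"
        using mult_right_mono[of "cap 1 t" "16 * t\<^sup>2" "t powr (- (1 + \<alpha>))"] by (simp add: cap_def)
      then have "ennreal (cap 1 t) * ennreal (\<bar>t\<bar> powr (- (1 + \<alpha>))) \<le> ennreal (16 * t powr ((2 - \<alpha>) - 1))"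
        using that by (subst ennreal_mult[symmetric]) (auto intro!: ennreal_leI)
      then show ?thesis using that True by (simp add: h_def)
    next
      case False
      have "ennreal (cap 1 t) * ennreal (\<bar>t\<bar> powr (- (1 + \<alpha>))) \<le> 1 * ennreal (\<bar>t\<bar> powr (- (1 + \<alpha>)))"
        by (intro mult_right_mono) (auto simp: cap_def ennreal_le_1)
      also have "\<dots> \<le> h t" using that False by (simp add: h_def)
      finally show ?thesis .
    qed
    consider "t > 0" | "t = 0" | "t < 0" by linarith
    then show "ennreal (cap 1 t) * ennreal (\<bar>t\<bar> powr (- (1 + \<alpha>))) \<le> h t + h (- t)"
    proof cases
      case 1 then show ?thesis using pos[of t] by (simp add: add_increasing2)
    next
      case 3
      then have "ennreal (cap 1 (- t)) * ennreal (\<bar>- t\<bar> powr (- (1 + \<alpha>))) \<le> h (- t)" by (intro pos) simp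
      then show ?thesis by (simp add: cap_def add_increasing)
    qed simp
  qed
  ultimately show ?thesis by (rule order_le_less_trans[rotated])
qed

definition cutoff :: "'n::finite \<Rightarrow> real \<Rightarrow> real^'n \<Rightarrow> real" where
  "cutoff k R x = (\<Prod>i\<in>UNIV - {k}. bump (x $ i / R))"

text \<open>A tube around the k-th axis containing the support of \<open>cutoff\<close>. The product
  form lets integrals against functions of the k-th coordinate factor.\<close>

definition in_slab :: "'n::finite \<Rightarrow> real \<Rightarrow> real^'n \<Rightarrow> real" where
  "in_slab k R x = (\<Prod>i\<in>UNIV - {k}. indicator {- R..R} (x $ i))"

lemma measurable_component [measurable]:
  assumes [measurable]: "f \<in> borel_measurable M"
  shows "(\<lambda>x. f x $ i) \<in> borel_measurable M"
  using measurable_compose[OF assms, of "\<lambda>v. v $ i" borel] by (simp add: borel_measurable_continuous_onI continuous_on_component)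

lemma measurable_cutoff [measurable]: "cutoff k R \<in> borel_measurable borel"
  unfolding cutoff_def[abs_def] by measurable

lemma measurable_in_slab [measurable]: "in_slab k R \<in> borel_measurable borel"
  unfolding in_slab_def[abs_def] by measurable

lemma in_slab_nonneg [simp]: "in_slab k R x \<ge> 0"
  by (simp add: in_slab_def prod_nonneg)

lemma in_slab_eq_1: "R > 0 \<Longrightarrow> cutoff k R x \<noteq> 0 \<Longrightarrow> in_slab k R x = 1"
proof -
  assume R: "R > 0" and c: "cutoff k R x \<noteq> 0"
  have "x $ i \<in> {- R..R}" if "i \<noteq> k" for i
  proof -
    have "bump (x $ i / R) \<noteq> 0" using c that by (auto simp: cutoff_def)
    then have "\<bar>x $ i / R\<bar> < 1" using bump_eq_0[of "x $ i / R"] by force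
    then show ?thesis using R by (auto simp: abs_less_iff field_simps)
  qed
  then show ?thesis unfolding in_slab_def by (intro prod.neutral) auto
qed

text \<open>All factors lie in [0, 1], so a difference of products is at most the sum of the
  differences of factors; Cauchy-Schwarz then costs a factor CARD('n). As in the logarithmic case,
  one of the two points lies in the tube unless the left side is 0.\<close>

lemma cutoff_diff_square:
  fixes x y :: "real^'n"
  assumes R: "R > 0"
  shows "(cutoff k R x - cutoff k R y)\<^sup>2 \<le> real CARD('n) * (\<Sum>i\<in>UNIV - {k}. cap R (x $ i - y $ i) * in_slab k R x + cap R (x $ i - y $ i) * in_slab k R y)"
proof (cases "cutoff k R x = 0 \<and> cutoff k R y = 0")
  case True
  then show ?thesis by (auto intro!: mult_nonneg_nonneg sum_nonneg)
next
  case False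
  let ?I = "UNIV - {k}" and ?d = "\<lambda>i. \<bar>bump (x $ i / R) - bump (y $ i / R)\<bar>"
  have "\<bar>cutoff k R x - cutoff k R y\<bar> \<le> (\<Sum>i\<in>?I. ?d i)"
    unfolding cutoff_def
    using norm_prod_diff[of ?I "\<lambda>i. bump (x $ i / R)" "\<lambda>i. bump (y $ i / R)"] bump_bounds by simp
  then have "\<bar>cutoff k R x - cutoff k R y\<bar>\<^sup>2 \<le> (\<Sum>i\<in>?I. ?d i)\<^sup>2"
    by (intro power_mono) auto
  also have "\<dots> \<le> (\<Sum>i\<in>?I. (?d i)\<^sup>2) * real (card ?I)"
    by (rule sum_squared_le_sum_of_squares)
  also have "\<dots> \<le> (\<Sum>i\<in>?I. cap R (x $ i - y $ i)) * real CARD('n)"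
  proof (intro mult_mono sum_mono)
    fix i
    have "?d i \<le> 1" using bump_bounds[of "x $ i / R"] bump_bounds[of "y $ i / R"] by (auto simp: abs_le_iff)
    then have 1: "(?d i)\<^sup>2 \<le> 1" by (intro power_le_one) auto
    have "(?d i)\<^sup>2 \<le> (4 * \<bar>x $ i / R - y $ i / R\<bar>)\<^sup>2" by (intro power_mono bump_lipschitz) auto
    also have "\<dots> = 16 * (x $ i - y $ i)\<^sup>2 / R\<^sup>2"
      by (simp add: power_mult_distrib power_divide flip: diff_divide_distrib)
    finally show "(?d i)\<^sup>2 \<le> cap R (x $ i - y $ i)" using 1 by (simp add: cap_def)
  qed (auto intro!: sum_nonneg card_mono)
  also have "\<dots> = real CARD('n) * (\<Sum>i\<in>?I. cap R (x $ i - y $ i)) * 1" by simp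
  also have "\<dots> \<le> real CARD('n) * (\<Sum>i\<in>?I. cap R (x $ i - y $ i)) * (in_slab k R x + in_slab k R y)"
  proof (rule mult_left_mono)
    have "in_slab k R x = 1 \<or> in_slab k R y = 1" using False in_slab_eq_1[OF R] by blast
    then show "1 \<le> in_slab k R x + in_slab k R y" using in_slab_nonneg[of k R x] in_slab_nonneg[of k R y] by linarith
  qed (auto intro!: mult_nonneg_nonneg sum_nonneg)
  also have "\<dots> = real CARD('n) * (\<Sum>i\<in>?I. cap R (x $ i - y $ i) * in_slab k R x + cap R (x $ i - y $ i) * in_slab k R y)"
    by (simp only: mult.assoc sum_distrib_right distrib_left sum.distrib)
  finally show ?thesis by simp
qed

lemma square_add_le:
  fixes a b \<eta> :: real
  assumes "\<eta> > 0" shows "(a + b)\<^sup>2 \<le> (1 + \<eta>) * a\<^sup>2 + (1 + 1 / \<eta>) * b\<^sup>2"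
proof -
  have "0 \<le> (\<eta> * a - b)\<^sup>2 / \<eta>" using assms by simp
  also have "\<dots> = (1 + \<eta>) * a\<^sup>2 + (1 + 1 / \<eta>) * b\<^sup>2 - (a + b)\<^sup>2"
    using assms by (simp add: power2_eq_square field_simps)
  finally show ?thesis by simp
qed

text \<open>With y = x + z the kernel and the cap depend on z alone. If the x-integral of V is the
  same for every displacement z, the double integral splits into a product.\<close>

lemma nn_integral_cap_kernel:
  fixes V :: "real^'n \<Rightarrow> real^'n \<Rightarrow> ennreal"
  assumes V[measurable]: "(\<lambda>(x, y). V x y) \<in> borel_measurable (borel \<Otimes>\<^sub>M borel)" and \<alpha>: "\<alpha> > 0"
    and T: "\<And>z. (\<integral>\<^sup>+x. V x (x + z) \<partial>lborel) = T"
  shows "(\<integral>\<^sup>+x. \<integral>\<^sup>+y. V x y * ennreal (cap R (x $ i - y $ i)) * ennreal (norm (x - y) powr (- (real CARD('n) + \<alpha>))) \<partial>lborel \<partial>lborel)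
    = ennreal (slice_const CARD('n) \<alpha>) * cap_mass \<alpha> R * T"
proof -
  let ?K = "\<lambda>z::real^'n. ennreal (cap R (z $ i)) * ennreal (norm (0 - z) powr (- (real CARD('n) + \<alpha>)))"
  have [measurable]: "(\<lambda>(x, z). V x (x + z)) \<in> borel_measurable (borel \<Otimes>\<^sub>M borel)"
    by measurable
  have cap_minus: "cap R (- t) = cap R t" for t by (simp add: cap_def)
  have "(\<integral>\<^sup>+x. \<integral>\<^sup>+y. V x y * ennreal (cap R (x $ i - y $ i)) * ennreal (norm (x - y) powr (- (real CARD('n) + \<alpha>))) \<partial>lborel \<partial>lborel)
    = (\<integral>\<^sup>+x. \<integral>\<^sup>+z. V x (x + z) * ?K z \<partial>lborel \<partial>lborel)"
  proof (rule nn_integral_cong)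
    fix x :: "real^'n"
    show "(\<integral>\<^sup>+y. V x y * ennreal (cap R (x $ i - y $ i)) * ennreal (norm (x - y) powr (- (real CARD('n) + \<alpha>))) \<partial>lborel)
      = (\<integral>\<^sup>+z. V x (x + z) * ?K z \<partial>lborel)"
      by (subst nn_integral_lborel_translate[of _ x]) (auto simp: cap_minus mult.assoc)
  qed
  also have "\<dots> = (\<integral>\<^sup>+z. \<integral>\<^sup>+x. V x (x + z) * ?K z \<partial>lborel \<partial>lborel)"
    by (rule lborel_pair.Fubini') measurable
  also have "\<dots> = (\<integral>\<^sup>+z. T * ?K z \<partial>lborel)"
    by (rule nn_integral_cong, subst nn_integral_multc) (auto simp: T)
  also have "\<dots> = T * (\<integral>\<^sup>+z. ?K z \<partial>lborel)"
    by (rule nn_integral_cmult) measurable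
  also have "(\<integral>\<^sup>+z. ?K z \<partial>lborel) = ennreal (slice_const CARD('n) \<alpha>) * cap_mass \<alpha> R"
    using nn_integral_coordinate_kernel_centered[of "\<lambda>t. ennreal (cap R t)" \<alpha> i "0::real^'n"] \<alpha>
    by (simp add: cap_mass_def)
  finally show ?thesis by (simp add: mult.commute)
qed

text \<open>The first term is the one-dimensional energy times the mass of the bumps, with no loss
  except 1 + \<eta>. The second carries all differences of the cutoff and is small through
  \<open>cap_mass\<close> when R is large. The parameter \<eta> stays free because it has to be
  chosen before R.\<close>

lemma tensor_energy_bound:
  fixes k :: "'n::finite" and F :: "real \<Rightarrow> real"
  assumes \<alpha>: "0 < \<alpha>" and R: "R > 0" and \<eta>: "\<eta> > 0" and [measurable]: "F \<in> borel_measurable borel"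
  shows "stable_energy \<alpha> (\<lambda>x::real^'n. F (x $ k) * cutoff k R x)
    \<le> ennreal (1 + \<eta>) * (ennreal (slice_const CARD('n) \<alpha>) * (stable_energy \<alpha> F * (\<integral>\<^sup>+t. ennreal ((bump (t / R))\<^sup>2) \<partial>lborel) ^ (CARD('n) - 1)))
      + ennreal ((1 + 1 / \<eta>) * real CARD('n)) * (of_nat (2 * CARD('n)) *
         (ennreal (slice_const CARD('n) \<alpha>) * cap_mass \<alpha> R * ((\<integral>\<^sup>+t. ennreal ((F t)\<^sup>2) \<partial>lborel) * ennreal (2 * R) ^ (CARD('n) - 1))))"
proof -
  let ?c = "ennreal (slice_const CARD('n) \<alpha>)"
  let ?g = "cutoff k R" and ?S = "in_slab k R"
  let ?K = "\<lambda>x y::real^'n. ennreal (norm (x - y) powr (- (real CARD('n) + \<alpha>)))"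
  let ?J = "\<integral>\<^sup>+t. ennreal ((F t)\<^sup>2) \<partial>lborel"
  let ?Q = "ennreal (2 * R) ^ (CARD('n) - 1)"
  let ?P = "(\<integral>\<^sup>+t. ennreal ((bump (t / R))\<^sup>2) \<partial>lborel) ^ (CARD('n) - 1)"
  let ?T = "\<lambda>x y::real^'n. ennreal ((?g x)\<^sup>2) * (ennreal ((F (x $ k) - F (y $ k))\<^sup>2) * ?K x y)"
  let ?A = "\<lambda>i x y::real^'n. (ennreal ((F (y $ k))\<^sup>2) * ennreal (?S x)) * ennreal (cap R (x $ i - y $ i)) * ?K x y"
  let ?B = "\<lambda>i x y::real^'n. (ennreal ((F (y $ k))\<^sup>2) * ennreal (?S y)) * ennreal (cap R (x $ i - y $ i)) * ?K x y"
  have S_prod: "ennreal (?S x) = (\<Prod>i\<in>UNIV - {k}. indicator {- R..R} (x $ i))" for x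
    by (simp add: in_slab_def prod_ennreal[symmetric] ennreal_indicator)
  have ind: "(\<integral>\<^sup>+t. indicator {- R..R} t \<partial>lborel) = ennreal (2 * R)" using R by simp
  have shift: "(\<integral>\<^sup>+t. ennreal ((F (t + s))\<^sup>2) \<partial>lborel) = ?J" for s
    by (subst nn_integral_lborel_translate[of "\<lambda>t. ennreal ((F t)\<^sup>2)" s]) (auto simp: add.commute)
  \<comment> \<open>F is evaluated at y and the tube at x. The displacement still disappears,
    because the tube ignores the k-th coordinate and F sees nothing else.\<close>
  have A: "(\<integral>\<^sup>+x. \<integral>\<^sup>+y. ?A i x y \<partial>lborel \<partial>lborel) = ?c * cap_mass \<alpha> R * (?J * ?Q)" for i
  proof (rule nn_integral_cap_kernel[OF _ \<alpha>])
    fix z :: "real^'n"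
    have "(\<integral>\<^sup>+x. ennreal ((F ((x + z) $ k))\<^sup>2) * ennreal (?S x) \<partial>lborel)
      = (\<integral>\<^sup>+t. ennreal ((F (t + z $ k))\<^sup>2) \<partial>lborel) * (\<integral>\<^sup>+t. indicator {- R..R} t \<partial>lborel) ^ (CARD('n) - 1)"
      unfolding S_prod vector_add_component by (rule nn_integral_vec_split) measurable
    then show "(\<integral>\<^sup>+x. ennreal ((F ((x + z) $ k))\<^sup>2) * ennreal (?S x) \<partial>lborel) = ?J * ?Q"
      unfolding ind shift .
  qed measurable
  have B: "(\<integral>\<^sup>+x. \<integral>\<^sup>+y. ?B i x y \<partial>lborel \<partial>lborel) = ?c * cap_mass \<alpha> R * (?J * ?Q)" for i
  proof (rule nn_integral_cap_kernel[OF _ \<alpha>])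
    fix z :: "real^'n"
    have "(\<integral>\<^sup>+x. ennreal ((F ((x + z) $ k))\<^sup>2) * ennreal (?S (x + z)) \<partial>lborel)
       = (\<integral>\<^sup>+x. ennreal ((F (x $ k))\<^sup>2) * ennreal (?S x) \<partial>lborel)"
      by (subst nn_integral_lborel_translate[of "\<lambda>x. ennreal ((F (x $ k))\<^sup>2) * ennreal (?S x)" z]) (auto simp: add.commute)
    also have "\<dots> = ?J * (\<integral>\<^sup>+t. indicator {- R..R} t \<partial>lborel) ^ (CARD('n) - 1)"
      unfolding S_prod by (rule nn_integral_vec_split) measurable
    finally show "(\<integral>\<^sup>+x. ennreal ((F ((x + z) $ k))\<^sup>2) * ennreal (?S (x + z)) \<partial>lborel) = ?J * ?Q"
      unfolding ind .
  qed measurable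
  have T: "(\<integral>\<^sup>+x. \<integral>\<^sup>+y. ?T x y \<partial>lborel \<partial>lborel) = ?c * (stable_energy \<alpha> F * ?P)"
  proof -
    define \<Phi> where "\<Phi> s = (\<integral>\<^sup>+t. ennreal ((F s - F t)\<^sup>2) * ennreal (\<bar>s - t\<bar> powr (- (1 + \<alpha>))) \<partial>lborel)" for s
    have [measurable]: "\<Phi> \<in> borel_measurable borel" unfolding \<Phi>_def[abs_def] by measurable
    have "(\<integral>\<^sup>+y. ?T x y \<partial>lborel) = ?c * (\<Phi> (x $ k) * ennreal ((?g x)\<^sup>2))" for x
    proof -
      have "(\<integral>\<^sup>+y. ?T x y \<partial>lborel) = ennreal ((?g x)\<^sup>2) * (\<integral>\<^sup>+y. ennreal ((F (x $ k) - F (y $ k))\<^sup>2) * ?K x y \<partial>lborel)"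
        by (rule nn_integral_cmult) measurable
      also have "(\<integral>\<^sup>+y. ennreal ((F (x $ k) - F (y $ k))\<^sup>2) * ?K x y \<partial>lborel) = ?c * \<Phi> (x $ k)"
        unfolding \<Phi>_def by (rule nn_integral_coordinate_kernel_centered[OF _ \<alpha>]) measurable
      finally show ?thesis by (simp add: ac_simps)
    qed
    then have "(\<integral>\<^sup>+x. \<integral>\<^sup>+y. ?T x y \<partial>lborel \<partial>lborel) = ?c * (\<integral>\<^sup>+x. \<Phi> (x $ k) * ennreal ((?g x)\<^sup>2) \<partial>lborel)"
      by (simp add: nn_integral_cmult)
    also have "(\<integral>\<^sup>+x. \<Phi> (x $ k) * ennreal ((?g x)\<^sup>2) \<partial>lborel) = (\<integral>\<^sup>+x. \<Phi> (x $ k) * (\<Prod>i\<in>UNIV - {k}. ennreal ((bump (x $ i / R))\<^sup>2)) \<partial>lborel)"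
      by (simp add: cutoff_def prod_ennreal prod_power_distrib)
    also have "\<dots> = (\<integral>\<^sup>+s. \<Phi> s \<partial>lborel) * ?P"
      by (rule nn_integral_vec_split) measurable
    also have "(\<integral>\<^sup>+s. \<Phi> s \<partial>lborel) = stable_energy \<alpha> F"
      unfolding \<Phi>_def stable_energy_def powr_minus by (simp add: divide_inverse ennreal_mult)
    finally show ?thesis .
  qed
  have le: "ennreal ((F (x $ k) * ?g x - F (y $ k) * ?g y)\<^sup>2 / norm (x - y) powr (real DIM(real^'n) + \<alpha>))
     \<le> ennreal (1 + \<eta>) * ?T x y + ennreal ((1 + 1 / \<eta>) * real CARD('n)) * (\<Sum>i\<in>UNIV - {k}. ?A i x y + ?B i x y)" for x y
  proof -
    let ?s = "\<Sum>i\<in>UNIV - {k}. cap R (x $ i - y $ i) * ?S x + cap R (x $ i - y $ i) * ?S y"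
    have s: "ennreal ((F (y $ k))\<^sup>2 * ?s) * ?K x y = (\<Sum>i\<in>UNIV - {k}. ?A i x y + ?B i x y)"
    proof -
      have "ennreal ((F (y $ k))\<^sup>2 * ?s) * ?K x y =
        ennreal ((F (y $ k))\<^sup>2) * (\<Sum>i\<in>UNIV - {k}. ennreal (cap R (x $ i - y $ i) * ?S x + cap R (x $ i - y $ i) * ?S y)) * ?K x y"
        by (subst sum_ennreal) (auto simp: ennreal_mult sum_nonneg)
      also have "\<dots> = (\<Sum>i\<in>UNIV - {k}. ennreal ((F (y $ k))\<^sup>2) * ennreal (cap R (x $ i - y $ i) * ?S x + cap R (x $ i - y $ i) * ?S y) * ?K x y)"
        by (simp only: sum_distrib_left sum_distrib_right)
      also have "\<dots> = (\<Sum>i\<in>UNIV - {k}. ?A i x y + ?B i x y)"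
        by (intro sum.cong refl) (simp add: ennreal_mult distrib_left distrib_right ac_simps)
      finally show ?thesis .
    qed
    \<comment> \<open>Discrete product rule, followed by Young's inequality with parameter
      \<eta>.\<close>
    have "(F (x $ k) * ?g x - F (y $ k) * ?g y)\<^sup>2 = ((F (x $ k) - F (y $ k)) * ?g x + F (y $ k) * (?g x - ?g y))\<^sup>2"
      by (simp add: algebra_simps)
    also have "\<dots> \<le> (1 + \<eta>) * ((F (x $ k) - F (y $ k)) * ?g x)\<^sup>2 + (1 + 1 / \<eta>) * (F (y $ k) * (?g x - ?g y))\<^sup>2"
      by (rule square_add_le[OF \<eta>])
    also have "\<dots> \<le> (1 + \<eta>) * ((F (x $ k) - F (y $ k)) * ?g x)\<^sup>2 + (1 + 1 / \<eta>) * ((F (y $ k))\<^sup>2 * (real CARD('n) * ?s))"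
      unfolding power_mult_distrib[of "F (y $ k)"] using \<eta>
      by (intro add_left_mono mult_left_mono cutoff_diff_square[OF R]) auto
    finally have "ennreal ((F (x $ k) * ?g x - F (y $ k) * ?g y)\<^sup>2) \<le>
      ennreal ((1 + \<eta>) * ((F (x $ k) - F (y $ k)) * ?g x)\<^sup>2 + (1 + 1 / \<eta>) * ((F (y $ k))\<^sup>2 * (real CARD('n) * ?s)))"
      by (rule ennreal_leI)
    also have "\<dots> = ennreal (1 + \<eta>) * (ennreal ((?g x)\<^sup>2) * ennreal ((F (x $ k) - F (y $ k))\<^sup>2))
       + ennreal ((1 + 1 / \<eta>) * real CARD('n)) * ennreal ((F (y $ k))\<^sup>2 * ?s)"
    proof -
      have "0 \<le> ?s" by (intro sum_nonneg) auto
      then have 1: "ennreal ((1 + \<eta>) * a + (1 + 1 / \<eta>) * (f * (real CARD('n) * ?s))) = ennreal (1 + \<eta>) * ennreal a + ennreal ((1 + 1 / \<eta>) * real CARD('n)) * ennreal (f * ?s)"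
        if "0 \<le> a" "0 \<le> f" for a f :: real
        using that \<eta> by (subst (1 2) ennreal_mult[symmetric]) (simp_all add: ac_simps flip: ennreal_plus)
      show ?thesis by (subst 1) (simp_all add: power_mult_distrib ennreal_mult mult.commute)
    qed
    finally have "ennreal ((F (x $ k) * ?g x - F (y $ k) * ?g y)\<^sup>2) * ?K x y \<le> (ennreal (1 + \<eta>) * (ennreal ((?g x)\<^sup>2) * ennreal ((F (x $ k) - F (y $ k))\<^sup>2))
       + ennreal ((1 + 1 / \<eta>) * real CARD('n)) * ennreal ((F (y $ k))\<^sup>2 * ?s)) * ?K x y"
      by (rule mult_right_mono) simp
    also have "\<dots> = ennreal (1 + \<eta>) * ?T x y + ennreal ((1 + 1 / \<eta>) * real CARD('n)) * (\<Sum>i\<in>UNIV - {k}. ?A i x y + ?B i x y)"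
      unfolding s[symmetric] by (simp only: distrib_right mult.assoc)
    finally show ?thesis unfolding powr_minus by (simp add: divide_inverse ennreal_mult)
  qed
  have m[measurable]: "(\<lambda>(x, y). ?T x y) \<in> borel_measurable (lborel \<Otimes>\<^sub>M lborel)"
    "\<And>i. (\<lambda>(x, y). ?A i x y) \<in> borel_measurable (lborel \<Otimes>\<^sub>M lborel)"
    "\<And>i. (\<lambda>(x, y). ?B i x y) \<in> borel_measurable (lborel \<Otimes>\<^sub>M lborel)" by measurable
  have "stable_energy \<alpha> (\<lambda>x::real^'n. F (x $ k) * ?g x) \<le>
    (\<integral>\<^sup>+x. \<integral>\<^sup>+y. ennreal (1 + \<eta>) * ?T x y + ennreal ((1 + 1 / \<eta>) * real CARD('n)) * (\<Sum>i\<in>UNIV - {k}. ?A i x y + ?B i x y) \<partial>lborel \<partial>lborel)"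
    unfolding stable_energy_def by (intro nn_integral_mono le)
  also have "\<dots> = ennreal (1 + \<eta>) * (\<integral>\<^sup>+x. \<integral>\<^sup>+y. ?T x y \<partial>lborel \<partial>lborel)
    + ennreal ((1 + 1 / \<eta>) * real CARD('n)) * (\<Sum>i\<in>UNIV - {k}. (\<integral>\<^sup>+x. \<integral>\<^sup>+y. ?A i x y \<partial>lborel \<partial>lborel) + (\<integral>\<^sup>+x. \<integral>\<^sup>+y. ?B i x y \<partial>lborel \<partial>lborel))"
    by (simp add: nn_integral_add nn_integral_cmult nn_integral_sum)
  also have "(\<Sum>i\<in>UNIV - {k}. (\<integral>\<^sup>+x. \<integral>\<^sup>+y. ?A i x y \<partial>lborel \<partial>lborel) + (\<integral>\<^sup>+x. \<integral>\<^sup>+y. ?B i x y \<partial>lborel \<partial>lborel))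
     = of_nat (2 * card (UNIV - {k})) * (?c * cap_mass \<alpha> R * (?J * ?Q))"
    unfolding A B by (simp add: mult_2[symmetric] ac_simps)
  also have "\<dots> \<le> of_nat (2 * CARD('n)) * (?c * cap_mass \<alpha> R * (?J * ?Q))"
    by (intro mult_right_mono of_nat_mono mult_left_mono card_mono) auto
  finally show ?thesis unfolding T by (simp add: add_left_mono mult_left_mono)
qed

section \<open>The Hardy inequality and its sharpness\<close>

lemma hardy_const_pos:
  assumes "0 < \<alpha>" "\<alpha> < 2" shows "hardy_const \<alpha> > 0"
  unfolding hardy_const_def using assms by (intro divide_pos_pos mult_pos_pos Gamma_real_pos) auto

lemma stable_slice_hardy_const:
  assumes "0 < \<alpha>" "\<alpha> < 2"
  shows "stable_const d \<alpha> * slice_const d \<alpha> * hardy_const \<alpha> = (Gamma ((1 + \<alpha>) / 2))\<^sup>2 / pi"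
  using stable_const_identity[OF assms, of d] by (simp add: slice_const_def hardy_const_def)

text \<open>Read off from the constant identity: the product is positive and so are the other two
  factors, which avoids discussing Gamma at a negative argument.\<close>

lemma stable_const_pos:
  assumes "0 < \<alpha>" "\<alpha> < 2" shows "stable_const d \<alpha> > 0"
proof -
  have "Gamma ((1 + \<alpha>) / 2) > 0" using assms by (intro Gamma_real_pos) auto
  then have "0 < (Gamma ((1 + \<alpha>) / 2))\<^sup>2 / pi" by (intro divide_pos_pos zero_less_power pi_gt_zero)
  then have "0 < stable_const d \<alpha> * (slice_const d \<alpha> * hardy_const \<alpha>)"
    unfolding stable_slice_hardy_const[OF assms, symmetric, of d] by (simp add: mult.assoc)
  then show ?thesis
    by (rule zero_less_mult_pos2) (intro mult_pos_pos slice_const_pos hardy_const_pos assms)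
qed

lemma dirichlet_form_eq:
  "dirichlet_form \<alpha> u = ennreal (1 / 2 * stable_const CARD('n) \<alpha>) * stable_energy \<alpha> (u :: real^'n::finite \<Rightarrow> real)"
  by (simp add: dirichlet_form_def stable_energy_def)

lemma set_nn_integral_half_space:
  assumes "\<And>x::real^'n::finite. x $ k \<le> 0 \<Longrightarrow> u x = 0"
  shows "(\<integral>\<^sup>+x\<in>half_space k. ennreal ((u x)\<^sup>2 * (x $ k) powr (- \<alpha>)) \<partial>lborel) = (\<integral>\<^sup>+x. ennreal ((u x)\<^sup>2 * (x $ k) powr (- \<alpha>)) \<partial>lborel)"
  by (intro nn_integral_cong) (use assms in \<open>auto simp: half_space_def indicator_def not_less\<close>)

lemma Cc_infinity_half_spaceD:
  fixes u :: "real^'n::finite \<Rightarrow> real"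
  assumes "u \<in> Cc_infinity (half_space k)"
  shows "continuous_on UNIV u" "\<And>x. x $ k \<le> 0 \<Longrightarrow> u x = 0"
proof -
  show "continuous_on UNIV u" using assms by (auto simp: Cc_infinity_def smooth_def dest!: spec[of _ 0])
  show "u x = 0" if "x $ k \<le> 0" for x
  proof (rule ccontr)
    assume "u x \<noteq> 0"
    then have "x \<in> closure (support_on UNIV u)" by (intro subsetD[OF closure_subset]) (simp add: support_on_def)
    then show False using assms that by (auto simp: Cc_infinity_def half_space_def)
  qed
qed

text \<open>On the compact support the k-th coordinate is positive, so the integrand is continuous,
  hence bounded, on a set of finite measure. This supplies the finiteness hypothesis of
  \<open>fractional_hardy\<close>.\<close>

lemma Cc_infinity_hardy_integral_finite:
  fixes u :: "real^'n::finite \<Rightarrow> real"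
  assumes u: "u \<in> Cc_infinity (half_space k)" and \<alpha>: "\<alpha> > 0"
  shows "(\<integral>\<^sup>+x. ennreal ((u x)\<^sup>2 * (x $ k) powr (- \<alpha>)) \<partial>lborel) < \<infinity>"
proof -
  define S where "S = closure (support_on UNIV u)"
  have S: "compact S" "\<And>x. x \<in> S \<Longrightarrow> x $ k > 0" using u by (auto simp: Cc_infinity_def S_def half_space_def)
  have zero: "u x = 0" if "x \<notin> S" for x
    using that closure_subset[of "support_on UNIV u"] by (auto simp: S_def support_on_def)
  have "continuous_on S (\<lambda>x. (u x)\<^sup>2 * (x $ k) powr (- \<alpha>))"
    using S(2) continuous_on_subset[OF Cc_infinity_half_spaceD(1)[OF u]]
    by (intro continuous_intros) force+
  then have "bounded ((\<lambda>x. (u x)\<^sup>2 * (x $ k) powr (- \<alpha>)) ` S)"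
    using S(1) by (intro compact_imp_bounded compact_continuous_image)
  then obtain B where B: "\<And>x. x \<in> S \<Longrightarrow> (u x)\<^sup>2 * (x $ k) powr (- \<alpha>) \<le> B"
    by (auto simp: bounded_iff abs_le_iff)
  have "(\<integral>\<^sup>+x. ennreal ((u x)\<^sup>2 * (x $ k) powr (- \<alpha>)) \<partial>lborel) \<le> (\<integral>\<^sup>+x. ennreal B * indicator S x \<partial>lborel)"
    by (intro nn_integral_mono) (use B zero in \<open>auto simp: indicator_def intro!: ennreal_leI\<close>)
  also have "\<dots> = ennreal B * emeasure lborel S"
    using S(1) by (intro nn_integral_cmult_indicator) (simp add: borel_compact)
  also have "\<dots> < \<infinity>" using emeasure_compact_finite[OF S(1)] by (simp add: ennreal_mult_less_top)
  finally show ?thesis .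
qed

text \<open>The factor 1/2 of the form cancels the 2 that arose from the symmetric halves of the
  double integral; the remaining product of constants is
  \<open>stable_slice_hardy_const\<close>.\<close>

lemma hardy_inequality_half_space:
  fixes u :: "real^'n::finite \<Rightarrow> real"
  assumes \<alpha>: "0 < \<alpha>" "\<alpha> < 2" and u: "u \<in> Cc_infinity (half_space k)"
  shows "ennreal ((Gamma ((1 + \<alpha>) / 2))\<^sup>2 / pi) *
    (\<integral>\<^sup>+x\<in>half_space k. ennreal ((u x)\<^sup>2 * (x $ k) powr (- \<alpha>)) \<partial>lborel) \<le> dirichlet_form \<alpha> u"
proof -
  interpret stable_half_space "axis k 1 :: real^'n" \<alpha>
    using \<alpha> by unfold_locales (auto simp: Basis_vec_def)
  let ?H = "\<integral>\<^sup>+x. ennreal ((u x)\<^sup>2 * (x $ k) powr (- \<alpha>)) \<partial>lborel"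
  have H: "hardy_integral u = ?H" by (simp add: hardy_integral_def inner_axis)
  note uD = Cc_infinity_half_spaceD[OF u]
  have "2 * (ennreal (slice_const DIM(real^'n) \<alpha>) * ennreal (hardy_const \<alpha>) * hardy_integral u) \<le> stable_energy \<alpha> u"
    using uD Cc_infinity_hardy_integral_finite[OF u \<alpha>(1)]
    by (intro fractional_hardy) (auto simp: H inner_axis intro: borel_measurable_continuous_onI)
  then have "ennreal (1 / 2 * stable_const CARD('n) \<alpha>) * (2 * (ennreal (slice_const CARD('n) \<alpha>) * ennreal (hardy_const \<alpha>) * ?H)) \<le> dirichlet_form \<alpha> u"
    unfolding dirichlet_form_eq H by (intro mult_left_mono) auto
  also have "ennreal (1 / 2 * stable_const CARD('n) \<alpha>) * (2 * (ennreal (slice_const CARD('n) \<alpha>) * ennreal (hardy_const \<alpha>) * ?H))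
    = (ennreal (1 / 2 * stable_const CARD('n) \<alpha>) * ennreal 2 * ennreal (slice_const CARD('n) \<alpha>) * ennreal (hardy_const \<alpha>)) * ?H"
    by (simp add: ac_simps)
  also have "ennreal (1 / 2 * stable_const CARD('n) \<alpha>) * ennreal 2 * ennreal (slice_const CARD('n) \<alpha>) * ennreal (hardy_const \<alpha>)
    = ennreal (1 / 2 * stable_const CARD('n) \<alpha> * 2 * slice_const CARD('n) \<alpha> * hardy_const \<alpha>)"
    using stable_const_pos[OF \<alpha>, of "CARD('n)"] slice_const_pos[OF \<alpha>(1), of "CARD('n)"] hardy_const_pos[OF \<alpha>]
    by (simp only: ennreal_mult less_imp_le mult_nonneg_nonneg zero_le_numeral divide_nonneg_nonneg zero_le_one)
  also have "1 / 2 * stable_const CARD('n) \<alpha> * 2 * slice_const CARD('n) \<alpha> * hardy_const \<alpha> = (Gamma ((1 + \<alpha>) / 2))\<^sup>2 / pi"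
    using stable_slice_hardy_const[OF \<alpha>, of "CARD('n)"] by simp
  finally show ?thesis by (simp only: set_nn_integral_half_space[OF uD(2)])
qed

section \<open>Optimality: test functions and choice of parameters\<close>

lemma tensor_in_Cc_infinity:
  fixes k :: "'n::finite"
  assumes "n > 0" "R > 0"
  shows "(\<lambda>x. near_optimizer \<alpha> n (x $ k) * cutoff k R x) \<in> Cc_infinity (half_space k)"
proof -
  define f where "f i = (if i = k then near_optimizer \<alpha> n else (\<lambda>t. bump (t / R)))" for i
  have ck: "ck_on m UNIV (\<lambda>t. bump ((1 / R) * t))" for m
    by (intro ck_on_compose[OF _ ck_on_bump] ck_on_mult ck_on_const ck_on_ident) auto
  have "(\<lambda>x::real^'n. \<Prod>i\<in>UNIV. f i (x $ i)) \<in> Cc_infinity (half_space k)"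
  proof (rule prod_in_Cc_infinity[where l = "\<lambda>i. if i = k then exp (- n) else - R" and r = "\<lambda>i. if i = k then exp n else R"])
    show "ck_on m UNIV (f i)" for m i using ck[of m] ck_on_near_optimizer[OF assms(1)] by (simp add: f_def)
    show "(if i = k then exp (- n) else - R) \<le> t \<and> t \<le> (if i = k then exp n else R)" if "f i t \<noteq> 0" for i t
    proof (cases "i = k")
      case True
      then show ?thesis using that near_optimizer_support[OF assms(1)] by (auto simp: f_def)
    next
      case False
      then have "\<bar>t / R\<bar> < 1" using that bump_eq_0[of "t / R"] by (force simp: f_def)
      then show ?thesis using False assms(2) by (auto simp: abs_less_iff field_simps)
    qed
  qed simp
  moreover have "(\<Prod>i\<in>UNIV. f i (x $ i)) = near_optimizer \<alpha> n (x $ k) * cutoff k R x" for x :: "real^'n"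
    unfolding cutoff_def by (subst prod.remove[of _ k]) (auto simp: f_def intro!: prod.cong)
  ultimately show ?thesis by simp
qed

lemma tensor_hardy_integral:
  fixes k :: "'n::finite"
  assumes [measurable]: "F \<in> borel_measurable borel"
  shows "(\<integral>\<^sup>+x. ennreal ((F (x $ k) * cutoff k R x)\<^sup>2 * (x $ k) powr (- \<alpha>)) \<partial>(lborel :: (real^'n) measure))
    = (\<integral>\<^sup>+s. ennreal ((F s)\<^sup>2 * s powr (- \<alpha>)) \<partial>lborel) * (\<integral>\<^sup>+t. ennreal ((bump (t / R))\<^sup>2) \<partial>lborel) ^ (CARD('n) - 1)"
proof -
  have "ennreal ((F (x $ k) * cutoff k R x)\<^sup>2 * (x $ k) powr (- \<alpha>))
     = ennreal ((F (x $ k))\<^sup>2 * (x $ k) powr (- \<alpha>)) * (\<Prod>i\<in>UNIV - {k}. ennreal ((bump (x $ i / R))\<^sup>2))" for x :: "real^'n"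
  proof -
    have "(F (x $ k) * cutoff k R x)\<^sup>2 * (x $ k) powr (- \<alpha>) = ((F (x $ k))\<^sup>2 * (x $ k) powr (- \<alpha>)) * (\<Prod>i\<in>UNIV - {k}. (bump (x $ i / R))\<^sup>2)"
      by (simp add: cutoff_def power_mult_distrib prod_power_distrib)
    then show ?thesis by (simp only:) (subst ennreal_mult, auto simp: prod_nonneg prod_ennreal)
  qed
  then show ?thesis
    using nn_integral_vec_split[of "\<lambda>s. ennreal ((F s)\<^sup>2 * s powr (- \<alpha>))" "\<lambda>t. ennreal ((bump (t / R))\<^sup>2)" k]
    by simp
qed

text \<open>The error term of \<open>tensor_energy_bound\<close> carries powers of 2R, the main term
  powers of the bump mass. The two are comparable with constants independent of R, so their ratio
  does not spoil the decay R^(-\<alpha>).\<close>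

lemma bump_mass_bounds:
  assumes R: "R > 0"
  shows "ennreal (2 * R) \<le> ennreal (2 * exp 8) * (\<integral>\<^sup>+t. ennreal ((bump (t / R))\<^sup>2) \<partial>lborel)"
    and "(\<integral>\<^sup>+t. ennreal ((bump (t / R))\<^sup>2) \<partial>lborel) \<le> ennreal (2 * R)"
proof -
  have "ennreal (2 * R) = ennreal (2 * exp 8) * ennreal (exp (- 8) * R)"
    using R by (simp add: exp_minus flip: ennreal_mult)
  also have "ennreal (exp (- 8) * R) = ennreal (exp (- 8)) * emeasure lborel {- (R / 2)..R / 2}"
    using R by (simp add: ennreal_mult)
  also have "\<dots> = (\<integral>\<^sup>+t. ennreal (exp (- 8)) * indicator {- (R / 2)..R / 2} t \<partial>lborel)"
    by (rule nn_integral_cmult_indicator[symmetric]) simp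
  also have "\<dots> \<le> (\<integral>\<^sup>+t. ennreal ((bump (t / R))\<^sup>2) \<partial>lborel)"
  proof (intro nn_integral_mono)
    fix t :: real
    show "ennreal (exp (- 8)) * indicator {- (R / 2)..R / 2} t \<le> ennreal ((bump (t / R))\<^sup>2)"
    proof (cases "t \<in> {- (R / 2)..R / 2}")
      case True
      then have "\<bar>t / R\<bar> \<le> 1 / 2" using R by (auto simp: abs_le_iff field_simps)
      then have "(exp (- 4))\<^sup>2 \<le> (bump (t / R))\<^sup>2" by (intro power_mono bump_ge) auto
      then have "exp (- 8) \<le> (bump (t / R))\<^sup>2" by (simp flip: exp_double)
      then show ?thesis using True by (simp add: ennreal_leI)
    qed simp
  qed
  finally show "ennreal (2 * R) \<le> ennreal (2 * exp 8) * (\<integral>\<^sup>+t. ennreal ((bump (t / R))\<^sup>2) \<partial>lborel)"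
    by (simp add: mult_left_mono)
  have "(\<integral>\<^sup>+t. ennreal ((bump (t / R))\<^sup>2) \<partial>lborel) \<le> (\<integral>\<^sup>+t. indicator {- R..R} t \<partial>lborel)"
  proof (intro nn_integral_mono)
    fix t :: real
    show "ennreal ((bump (t / R))\<^sup>2) \<le> indicator {- R..R} t"
    proof (cases "t \<in> {- R..R}")
      case True
      then show ?thesis by (simp add: ennreal_le_1 power_le_one bump_bounds)
    next
      case False
      then have "1 \<le> \<bar>t / R\<bar>" using R by (auto simp: le_divide_eq)
      then show ?thesis using bump_eq_0 by simp
    qed
  qed
  also have "\<dots> = ennreal (2 * R)" using R by simp
  finally show "(\<integral>\<^sup>+t. ennreal ((bump (t / R))\<^sup>2) \<partial>lborel) \<le> ennreal (2 * R)" .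
qed

text \<open>On the support t \<le> exp n, hence t^(-\<alpha>) \<ge> exp (-n \<alpha>). The factor is
  huge but depends only on n, which is fixed before R.\<close>

lemma near_optimizer_square_integral:
  assumes \<alpha>: "0 < \<alpha>" and n: "n > 0"
  shows "(\<integral>\<^sup>+t. ennreal ((near_optimizer \<alpha> n t)\<^sup>2) \<partial>lborel)
    \<le> ennreal (exp (n * \<alpha>)) * (\<integral>\<^sup>+s. ennreal ((near_optimizer \<alpha> n s)\<^sup>2 * s powr (- \<alpha>)) \<partial>lborel)"
proof -
  have "(near_optimizer \<alpha> n t)\<^sup>2 \<le> exp (n * \<alpha>) * ((near_optimizer \<alpha> n t)\<^sup>2 * t powr (- \<alpha>))" for t
  proof (cases "near_optimizer \<alpha> n t = 0")
    case False
    from near_optimizer_support[OF n this] have t: "0 < t" "t \<le> exp n"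
      by (auto intro: less_le_trans[OF exp_gt_zero])
    have "exp (- (n * \<alpha>)) = exp n powr (- \<alpha>)" by (simp add: powr_def mult.commute)
    also have "\<dots> \<le> t powr (- \<alpha>)" using t \<alpha> by (intro powr_mono2') auto
    finally have "1 \<le> exp (n * \<alpha>) * t powr (- \<alpha>)" by (simp add: exp_minus field_simps)
    then have "(near_optimizer \<alpha> n t)\<^sup>2 * 1 \<le> (near_optimizer \<alpha> n t)\<^sup>2 * (exp (n * \<alpha>) * t powr (- \<alpha>))"
      by (intro mult_left_mono) auto
    then show ?thesis by (simp add: ac_simps)
  qed simp
  then have "(\<integral>\<^sup>+t. ennreal ((near_optimizer \<alpha> n t)\<^sup>2) \<partial>lborel) \<le> (\<integral>\<^sup>+t. ennreal (exp (n * \<alpha>)) * ennreal ((near_optimizer \<alpha> n t)\<^sup>2 * t powr (- \<alpha>)) \<partial>lborel)"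
    by (intro nn_integral_mono) (simp add: ennreal_leI flip: ennreal_mult')
  also have "\<dots> = ennreal (exp (n * \<alpha>)) * (\<integral>\<^sup>+s. ennreal ((near_optimizer \<alpha> n s)\<^sup>2 * s powr (- \<alpha>)) \<partial>lborel)"
    by (rule nn_integral_cmult) measurable
  finally show ?thesis .
qed

text \<open>The two factors match the two losses: 1 + \<eta> from Young's inequality, and the excess
  \<eta> * a of the near-optimizer.\<close>

lemma exists_small_relative_excess:
  fixes a b :: real
  assumes "0 < a" "a < b"
  obtains \<eta> where "\<eta> > 0" "(1 + \<eta>) * (a + \<eta> * a) < b"
proof -
  define \<delta> where "\<delta> = b / a - 1"
  have \<delta>: "\<delta> > 0" using assms by (simp add: \<delta>_def)
  \<comment> \<open>With \<eta> \<le> 1 one has (1 + \<eta>)^2 \<le> 1 + 3 \<eta>, and 3 \<delta> /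
    4 < \<delta>.\<close>
  define \<eta> where "\<eta> = min 1 (\<delta> / 4)"
  have \<eta>: "0 < \<eta>" "\<eta> \<le> 1" "\<eta> \<le> \<delta> / 4" using \<delta> by (auto simp: \<eta>_def)
  have "\<eta> * \<eta> \<le> \<eta>" using \<eta> by (intro mult_left_le) auto
  moreover have "(1 + \<eta>) * (1 + \<eta>) = 1 + 2 * \<eta> + \<eta> * \<eta>" by (simp add: algebra_simps)
  ultimately have "(1 + \<eta>) * (1 + \<eta>) < 1 + \<delta>" using \<eta> by linarith
  then have "a * ((1 + \<eta>) * (1 + \<eta>)) < a * (1 + \<delta>)" using assms by simp
  also have "a * (1 + \<delta>) = b" using assms by (simp add: \<delta>_def)
  finally have "(1 + \<eta>) * (a + \<eta> * a) < b" by (simp add: algebra_simps)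
  then show ?thesis using that \<eta> by blast
qed

text \<open>Everything rests on the order of choices: \<eta> from the gap between C and the sharp
  constant, then n from \<eta>, and R last, after all constants of the error term are fixed.\<close>

lemma hardy_const_optimal:
  fixes k :: "'n::finite"
  assumes \<alpha>: "0 < \<alpha>" "\<alpha> < 2" and C: "C > (Gamma ((1 + \<alpha>) / 2))\<^sup>2 / pi"
  shows "\<exists>u\<in>Cc_infinity (half_space k). dirichlet_form \<alpha> u <
    ennreal C * (\<integral>\<^sup>+x\<in>half_space k. ennreal ((u x)\<^sup>2 * (x $ k) powr (- \<alpha>)) \<partial>lborel)"
proof -
  let ?N = "CARD('n)"
  define A c \<kappa> where "A = stable_const ?N \<alpha>" and "c = slice_const ?N \<alpha>" and "\<kappa> = hardy_const \<alpha>"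
  have pos: "A > 0" "c > 0" "\<kappa> > 0"
    using stable_const_pos[OF \<alpha>] slice_const_pos[OF \<alpha>(1)] hardy_const_pos[OF \<alpha>] by (auto simp: A_def c_def \<kappa>_def)
  have "A * c * \<kappa> < C" using C stable_slice_hardy_const[OF \<alpha>] by (simp add: A_def c_def \<kappa>_def)
  then have "2 * \<kappa> < 2 * C / (A * c)" using pos by (simp add: field_simps)
  with pos obtain \<eta> where \<eta>: "\<eta> > 0" "(1 + \<eta>) * (2 * \<kappa> + \<eta> * (2 * \<kappa>)) < 2 * C / (A * c)"
    using exists_small_relative_excess[of "2 * \<kappa>" "2 * C / (A * c)"] by auto
  \<comment> \<open>\<eta> serves twice: as the Young parameter, and here as the relative excess
    allowed to the near-optimizer.\<close>
  define \<epsilon> where "\<epsilon> = \<eta> * (2 * \<kappa>)"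
  have \<epsilon>: "\<epsilon> > 0" using pos \<eta> by (simp add: \<epsilon>_def)
  obtain n where n: "n > 0" and nE: "stable_energy \<alpha> (near_optimizer \<alpha> n)
    \<le> ennreal (2 * \<kappa> + \<epsilon>) * (\<integral>\<^sup>+s. ennreal ((near_optimizer \<alpha> n s)\<^sup>2 * s powr (- \<alpha>)) \<partial>lborel)"
    using exists_near_optimizer[OF \<alpha> \<epsilon>] unfolding \<kappa>_def by blast
  let ?F = "near_optimizer \<alpha> n"
  obtain h where h: "(\<integral>\<^sup>+s. ennreal ((?F s)\<^sup>2 * s powr (- \<alpha>)) \<partial>lborel) = ennreal h" "h \<ge> 0"
    using near_optimizer_hardy_integral(2)[OF \<alpha> n]
    by (cases "\<integral>\<^sup>+s. ennreal ((?F s)\<^sup>2 * s powr (- \<alpha>)) \<partial>lborel") (auto simp: top_unique)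
  \<comment> \<open>The strict inequality at the end needs a positive Hardy integral h * p; hence
    the lower bounds for h here and for the bump mass below.\<close>
  have hpos: "h > 0"
  proof -
    have "ennreal (exp (- 8) * n) \<le> ennreal h" using near_optimizer_hardy_integral(1)[OF \<alpha> n] unfolding h .
    then have "exp (- 8) * n \<le> h" using h(2) by simp
    moreover have "0 < exp (- 8) * n" using n by simp
    ultimately show ?thesis by linarith
  qed
  obtain \<mu> where \<mu>: "cap_mass \<alpha> 1 = ennreal \<mu>" "\<mu> \<ge> 0"
    using cap_mass_finite[OF \<alpha>] by (cases "cap_mass \<alpha> 1") auto
  \<comment> \<open>D bounds the ratio of (2R)^(N - 1) to the corresponding power of the bump mass.
    Y collects the error term of \<open>tensor_energy_bound\<close> relative to the main scale c * h
    * p, apart from R^(-\<alpha>); neither depends on R.\<close>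
  define D where "D = (2 * exp 8 :: real) ^ (?N - 1)"
  define Y where "Y = ((1 + 1 / \<eta>) * real ?N) * (real (2 * ?N) * (\<mu> * (exp (n * \<alpha>) * D)))"
  have D: "D \<ge> 0" by (simp add: D_def)
  have "((\<lambda>R. (1 + \<eta>) * (2 * \<kappa> + \<epsilon>) + Y * R powr (- \<alpha>)) \<longlongrightarrow> (1 + \<eta>) * (2 * \<kappa> + \<epsilon>) + Y * 0) at_top"
    using \<alpha> by (intro tendsto_intros tendsto_neg_powr filterlim_ident) auto
  then have "eventually (\<lambda>R. (1 + \<eta>) * (2 * \<kappa> + \<epsilon>) + Y * R powr (- \<alpha>) < 2 * C / (A * c)) at_top"
    by (rule order_tendstoD(2)) (use \<eta>(2) in \<open>simp add: \<epsilon>_def\<close>)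
  with eventually_gt_at_top[of 0]
  have "eventually (\<lambda>R. R > 0 \<and> (1 + \<eta>) * (2 * \<kappa> + \<epsilon>) + Y * R powr (- \<alpha>) < 2 * C / (A * c)) at_top"
    by eventually_elim simp
  then obtain R where R: "R > 0" and RC: "(1 + \<eta>) * (2 * \<kappa> + \<epsilon>) + Y * R powr (- \<alpha>) < 2 * C / (A * c)"
    using eventually_happens'[OF trivial_limit_at_top_linorder] by blast
  let ?m = "\<integral>\<^sup>+t. ennreal ((bump (t / R))\<^sup>2) \<partial>lborel"
  obtain m where m: "?m = ennreal m" "m \<ge> 0"
    using bump_mass_bounds(2)[OF R] by (cases ?m) (auto simp: top_unique)
  have mR: "2 * R \<le> 2 * exp 8 * m"
    using bump_mass_bounds(1)[OF R] unfolding m(1) using m(2) by (simp flip: ennreal_mult)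
  have mpos: "m > 0"
  proof (rule ccontr)
    assume "\<not> m > 0"
    then have "m = 0" using m(2) by simp
    then show False using mR R by simp
  qed
  define p where "p = m ^ (?N - 1)"
  have p: "?m ^ (?N - 1) = ennreal p" "p > 0" using m mpos by (simp_all add: p_def ennreal_power)
  have Q: "(2 * R) ^ (?N - 1) \<le> D * p"
    unfolding D_def p_def power_mult_distrib[symmetric] using R mR by (intro power_mono) auto
  let ?u = "\<lambda>x. ?F (x $ k) * cutoff k R x"
  have u: "?u \<in> Cc_infinity (half_space k)" by (rule tensor_in_Cc_infinity[OF n R])
  have H: "(\<integral>\<^sup>+x\<in>half_space k. ennreal ((?u x)\<^sup>2 * (x $ k) powr (- \<alpha>)) \<partial>lborel) = ennreal (h * p)"
  proof -
    have "?u x = 0" if "x $ k \<le> 0" for x by (rule Cc_infinity_half_spaceD(2)[OF u that])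
    then have "(\<integral>\<^sup>+x\<in>half_space k. ennreal ((?u x)\<^sup>2 * (x $ k) powr (- \<alpha>)) \<partial>lborel)
      = (\<integral>\<^sup>+x. ennreal ((?u x)\<^sup>2 * (x $ k) powr (- \<alpha>)) \<partial>lborel)"
      by (rule set_nn_integral_half_space)
    also have "\<dots> = ennreal h * ennreal p"
      unfolding h(1)[symmetric] p(1)[symmetric] by (rule tensor_hardy_integral) measurable
    finally show ?thesis using h(2) p(2) by (simp add: ennreal_mult)
  qed
  have J: "(\<integral>\<^sup>+t. ennreal ((?F t)\<^sup>2) \<partial>lborel) \<le> ennreal (exp (n * \<alpha>) * h)"
    using near_optimizer_square_integral[OF \<alpha>(1) n] unfolding h(1) using h(2) by (simp add: ennreal_mult)
  have E1: "stable_energy \<alpha> ?F \<le> ennreal ((2 * \<kappa> + \<epsilon>) * h)"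
    using nE unfolding h(1) using h(2) pos \<epsilon> by (simp add: ennreal_mult'')
  have "stable_energy \<alpha> ?u \<le> ennreal (1 + \<eta>) * (ennreal c * (stable_energy \<alpha> ?F * ennreal p))
      + ennreal ((1 + 1 / \<eta>) * real ?N) * (of_nat (2 * ?N) *
         (ennreal c * (ennreal (R powr (- \<alpha>)) * ennreal \<mu>) * ((\<integral>\<^sup>+t. ennreal ((?F t)\<^sup>2) \<partial>lborel) * ennreal (2 * R) ^ (?N - 1))))"
    using tensor_energy_bound[OF \<alpha>(1) R \<eta>(1) measurable_near_optimizer, of \<alpha> n k]
    unfolding cap_mass_scale[OF R] \<mu>(1) p(1) c_def .
  also have "\<dots> \<le> ennreal (1 + \<eta>) * (ennreal c * (ennreal ((2 * \<kappa> + \<epsilon>) * h) * ennreal p))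
      + ennreal ((1 + 1 / \<eta>) * real ?N) * (ennreal (real (2 * ?N)) *
         (ennreal c * (ennreal (R powr (- \<alpha>)) * ennreal \<mu>) * (ennreal (exp (n * \<alpha>) * h) * ennreal (D * p))))"
  proof (intro add_mono mult_left_mono mult_right_mono E1 mult_mono J)
    show "ennreal (2 * R) ^ (?N - 1) \<le> ennreal (D * p)" using R Q by (simp add: ennreal_power ennreal_leI)
  qed (simp_all add: ennreal_of_nat_eq_real_of_nat)
  also have "\<dots> = ennreal ((1 + \<eta>) * (c * ((2 * \<kappa> + \<epsilon>) * h * p))
      + (1 + 1 / \<eta>) * real ?N * (real (2 * ?N) * (c * (R powr (- \<alpha>) * \<mu>) * (exp (n * \<alpha>) * h * (D * p)))))"
    using \<eta>(1) pos \<epsilon> h(2) p(2) \<mu>(2) D by (simp flip: ennreal_mult ennreal_plus)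
  also have "(1 + \<eta>) * (c * ((2 * \<kappa> + \<epsilon>) * h * p))
      + (1 + 1 / \<eta>) * real ?N * (real (2 * ?N) * (c * (R powr (- \<alpha>) * \<mu>) * (exp (n * \<alpha>) * h * (D * p))))
      = c * h * p * ((1 + \<eta>) * (2 * \<kappa> + \<epsilon>) + Y * R powr (- \<alpha>))"
    unfolding Y_def by algebra
  finally have E: "stable_energy \<alpha> ?u \<le> ennreal (c * h * p * ((1 + \<eta>) * (2 * \<kappa> + \<epsilon>) + Y * R powr (- \<alpha>)))" .
  have "dirichlet_form \<alpha> ?u \<le> ennreal (1 / 2 * A) * ennreal (c * h * p * ((1 + \<eta>) * (2 * \<kappa> + \<epsilon>) + Y * R powr (- \<alpha>)))"
    unfolding dirichlet_form_eq A_def[symmetric] by (intro mult_left_mono E) simp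
  also have "\<dots> = ennreal (1 / 2 * A * (c * h * p * ((1 + \<eta>) * (2 * \<kappa> + \<epsilon>) + Y * R powr (- \<alpha>))))"
    using pos by (intro ennreal_mult'[symmetric]) simp
  also have "\<dots> < ennreal (C * (h * p))"
  proof (rule ennreal_lessI)
    have "A * c * \<kappa> > 0" using pos by simp
    then have "C > 0" using \<open>A * c * \<kappa> < C\<close> by linarith
    then show "0 < C * (h * p)" using hpos p(2) by simp
    have "1 / 2 * A * (c * h * p * ((1 + \<eta>) * (2 * \<kappa> + \<epsilon>) + Y * R powr (- \<alpha>))) < 1 / 2 * A * (c * h * p * (2 * C / (A * c)))"
      using RC pos hpos p(2) by (intro mult_strict_left_mono mult_pos_pos) auto
    also have "\<dots> = C * (h * p)" using pos by (simp add: field_simps)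
    finally show "1 / 2 * A * (c * h * p * ((1 + \<eta>) * (2 * \<kappa> + \<epsilon>) + Y * R powr (- \<alpha>))) < C * (h * p)" .
  qed
  also have "\<dots> = ennreal C * ennreal (h * p)"
    using hpos p(2) by (intro ennreal_mult'') simp
  finally show ?thesis using u H by (intro bexI[of _ ?u]) simp_all
qed

theorem mainTheorem2:
  fixes \<alpha> :: real and k :: "'n::finite"
  assumes "0 < \<alpha>" and "\<alpha> < 2"
  shows "(\<forall>u \<in> Cc_infinity (half_space k).
            dirichlet_form \<alpha> u \<ge>
              ennreal ((Gamma ((1 + \<alpha>) / 2))\<^sup>2 / pi) *
              (\<integral>\<^sup>+ x \<in> half_space k. ennreal ((u x)\<^sup>2 * (x $ k) powr (- \<alpha>)) \<partial>lborel))
       \<and> (\<forall>C > (Gamma ((1 + \<alpha>) / 2))\<^sup>2 / pi.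
            \<exists>u \<in> Cc_infinity (half_space k).
              \<not> (dirichlet_form \<alpha> u \<ge>
                   ennreal C *
                   (\<integral>\<^sup>+ x \<in> half_space k. ennreal ((u x)\<^sup>2 * (x $ k) powr (- \<alpha>)) \<partial>lborel)))"
  unfolding not_le
  using hardy_inequality_half_space[OF assms] hardy_const_optimal[OF assms] by blast

end
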